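(* Let $\mathcal{G}$ be a $P_0$-Glivenko-Cantelli class of measurable functions $g:\mathcal{X}\to\mathbb{R}$ with measurable envelope function $G$, such that $\int e^{tG}\,d\nu\le Ce^{ct^2}$ for every $t>0$ and some constants $c,C>0$, and $\int G^{2+\delta}\,dP_0<\infty$ for some $\delta>0$. Then there exists a neighbourhood of $0$ in $\mathbb{R}$ such that for every $t$ in this neighbourhood, as $n\to\infty$, $$\sup_{g\in \mathcal{G}}\left| \mathrm{E}\bigl[e^{t\sqrt{n}(P_ng-\mathbb{P}_ng)} \,\big|\, Z_1,\ldots,Z_n\bigr] - e^{t^2 P_0(g-P_0g)^2/2} \right| \stackrel{as*}{\longrightarrow} 0.$$
   Context: $Z_1,Z_2,\ldots$ are i.i.d. from a probability distribution $P_0$ on a measurable space $(\mathcal{X},\mathcal{A})$, $\mathbb{P}_n=n^{-1}\sum_{i=1}^n\delta_{Z_i}$ is the empirical measure, and $\nu$ is a finite measure on $(\mathcal{X},\mathcal{A})$. Given $Z_1,\ldots,Z_n$, the random probability measure $P_n$ is a draw from the Dirichlet process $\mathrm{DP}(\nu+n\mathbb{P}_n)$ with base measure $\nu+n\mathbb{P}_n$. The case $\nu=0$ is allowed (Bayesian bootstrap). For a measure $\mu$ and function $g$, $\mu g=\int g\,d\mu$. An envelope function of $\mathcal{G}$ is a function $G$ with $|g(x)|\le G(x)$ for all $x\in\mathcal{X}$ and $g\in\mathcal{G}$. For (possibly non-measurable) functions $S_n$ of $Z_1,Z_2,\ldots$, $S_n\stackrel{as*}{\to}0$ means that there exist measurable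 random variables $\Delta_n$ with $|S_n|\le\Delta_n$ and $\Delta_n\to0$ for $P_0^\infty$-almost every sequence $Z_1,Z_2,\ldots$. The class $\mathcal{G}$ is $P_0$-Glivenko-Cantelli if $\sup_{g\in\mathcal{G}}|\mathbb{P}_ng-P_0g|\stackrel{as*}{\to}0$. *)

theory Defs
  imports "HOL-Probability.Probability"
begin

text \<open>
  Sum of two measures; meant for measures on the same measurable space.
\<close>

definition add_measure :: "'a measure \<Rightarrow> 'a measure \<Rightarrow> 'a measure" where
  "add_measure M N = measure_of (space M) (sets M) (\<lambda>A. emeasure M A + emeasure N A)"

lemma space_add_measure [simp]: "space (add_measure M N) = space M"
  and sets_add_measure [simp, measurable_cong]: "sets (add_measure M N) = sets M"
  by (simp_all add: add_measure_def)

lemma emeasure_add_measure: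
  assumes "sets N = sets M" and "A \<in> sets M"
  shows "emeasure (add_measure M N) A = emeasure M A + emeasure N A"
proof (rule emeasure_measure_of[OF add_measure_def])
  show "sets M \<subseteq> Pow (space M)"
    by (rule sets.space_closed)
  show "A \<in> sets (add_measure M N)"
    using assms by simp
  show "positive (sets (add_measure M N)) (\<lambda>A. emeasure M A + emeasure N A)"
    by (simp add: positive_def)
  show "countably_additive (sets (add_measure M N)) (\<lambda>A. emeasure M A + emeasure N A)"
    using assms(1)
    by (auto simp: countably_additive_def suminf_emeasure suminf_add[symmetric])
qed

text \<open>
  Sequences of observations are functions \<open>z :: nat \<Rightarrow> 'a\<close>, with \<open>z 0, z 1, \<dots>\<close> in the role of
  \<open>Z\<^sub>1, Z\<^sub>2, \<dots>\<close>; the first \<open>n\<close> of them are \<open>z i\<close> for \<open>i < n\<close>.  The empirical measure is a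
  probability measure for \<open>n \<ge> 1\<close> only.
\<close>

definition empirical_measure :: "'a measure \<Rightarrow> nat \<Rightarrow> (nat \<Rightarrow> 'a) \<Rightarrow> 'a measure" where
  "empirical_measure M n z = distr (uniform_count_measure {..<n}) M z"

definition iid_seq :: "'a measure \<Rightarrow> (nat \<Rightarrow> 'a) measure" where
  "iid_seq M = PiM UNIV (\<lambda>_. M)"

text \<open>
  Gamma distribution with shape \<open>a\<close> and unit scale; shape \<open>0\<close> is the point mass at \<open>0\<close>.
\<close>

definition gamma_density :: "real \<Rightarrow> real \<Rightarrow> real" where
  "gamma_density a x = (if 0 < x then x powr (a - 1) * exp (- x) / Gamma a else 0)"

definition gamma_dist :: "real \<Rightarrow> real measure" where
  "gamma_dist a =
    (if a = 0 then return borel 0 else density lborel (\<lambda>x. ennreal (gamma_density a x)))"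

text \<open>
  Ferguson's definition of the Dirichlet distribution with parameters \<open>a 0, \<dots>, a (k - 1) \<ge> 0\<close>, not
  all zero: the law of independent gamma variables divided by their sum.  It covers vanishing
  parameters, for which the coordinate is almost surely zero; these do occur in the definition of
  the Dirichlet process, for partition sets that are null sets of the base measure.
\<close>

definition dirichlet_dist :: "nat \<Rightarrow> (nat \<Rightarrow> real) \<Rightarrow> (nat \<Rightarrow> real) measure" where
  "dirichlet_dist k a =
    distr (PiM {..<k} (\<lambda>i. gamma_dist (a i))) (PiM {..<k} (\<lambda>_. borel))
      (\<lambda>y. \<lambda>i\<in>{..<k}. y i / (\<Sum>j<k. y j))"

text \<open>
  \<open>D\<close> is the law of a random probability measure (a probability measure on the space of all
  probability measures on the measurable space of \<open>\<alpha>\<close>) that is a Dirichlet process with base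
  measure \<open>\<alpha>\<close>.  These finite-dimensional distributions determine \<open>D\<close>, as \<open>prob_algebra\<close> carries the
  sigma-algebra generated by the evaluations at measurable sets.
\<close>

definition is_dirichlet_process :: "'a measure \<Rightarrow> 'a measure measure \<Rightarrow> bool" where
  "is_dirichlet_process \<alpha> D \<longleftrightarrow>
    prob_space D \<and> sets D = sets (prob_algebra \<alpha>) \<and>
    (\<forall>(k::nat) A. (\<forall>i<k. A i \<in> sets \<alpha>) \<and> disjoint_family_on A {..<k} \<and> (\<Union>i<k. A i) = space \<alpha> \<longrightarrow>
      distr D (PiM {..<k} (\<lambda>_. borel)) (\<lambda>P. \<lambda>i\<in>{..<k}. measure P (A i)) =
        dirichlet_dist k (\<lambda>i. measure \<alpha> (A i)))"

text \<open>
  The base measure \<open>\<nu> + n \<^bold>P\<^sub>n\<close>, where \<open>\<^bold>P\<^sub>n\<close> is the empirical measure.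
\<close>

definition dp_base :: "'a measure \<Rightarrow> nat \<Rightarrow> (nat \<Rightarrow> 'a) \<Rightarrow> 'a measure" where
  "dp_base \<nu> n z = add_measure \<nu> (scale_measure (of_nat n) (empirical_measure \<nu> n z))"

text \<open>
  Outer almost sure convergence to zero of nonnegative, not necessarily measurable, functions
  indexed by \<open>n \<ge> 1\<close>.  They are \<open>ennreal\<close>-valued so that suprema, also over the empty class, are
  meaningful; the measurable majorants are real-valued.
\<close>

definition as_star_tendsto_zero :: "'b measure \<Rightarrow> (nat \<Rightarrow> 'b \<Rightarrow> ennreal) \<Rightarrow> bool" where
  "as_star_tendsto_zero M S \<longleftrightarrow>
    (\<exists>\<Delta> :: nat \<Rightarrow> 'b \<Rightarrow> real.
      (\<forall>n\<ge>1. \<Delta> n \<in> borel_measurable M) \<and>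
      (\<forall>n\<ge>1. \<forall>\<omega>\<in>space M. 0 \<le> \<Delta> n \<omega> \<and> S n \<omega> \<le> ennreal (\<Delta> n \<omega>)) \<and>
      (AE \<omega> in M. (\<lambda>n. \<Delta> n \<omega>) \<longlonglongrightarrow> 0))"

text \<open>
  Integrability of the members of the class is what gives the expectations in the supremum a
  meaning, since the Bochner integral of a non-integrable function is zero by convention.
\<close>

definition glivenko_cantelli :: "'a measure \<Rightarrow> ('a \<Rightarrow> real) set \<Rightarrow> bool" where
  "glivenko_cantelli P \<G> \<longleftrightarrow>
    (\<forall>g\<in>\<G>. integrable P g) \<and>
    as_star_tendsto_zero (iid_seq P)
      (\<lambda>n z. SUP g\<in>\<G>. ennreal \<bar>(\<integral>x. g x \<partial>empirical_measure P n z) - (\<integral>x. g x \<partial>P)\<bar>)"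

definition envelope :: "'a measure \<Rightarrow> ('a \<Rightarrow> real) set \<Rightarrow> ('a \<Rightarrow> real) \<Rightarrow> bool" where
  "envelope M \<G> G \<longleftrightarrow> (\<forall>g\<in>\<G>. \<forall>x\<in>space M. \<bar>g x\<bar> \<le> G x)"

lemma emeasure_dp_base:
  assumes "1 \<le> n" "\<And>i. z i \<in> space \<nu>" "A \<in> sets \<nu>"
  shows "emeasure (dp_base \<nu> n z) A = emeasure \<nu> A + of_nat (card {i. i < n \<and> z i \<in> A})"
proof -
  have z: "z \<in> measurable (uniform_count_measure {..<n}) \<nu>"
    using assms(2) by (auto simp: measurable_def sets_uniform_count_measure space_uniform_count_measure)
  have eq: "z -` A \<inter> {..<n} = {i. i < n \<and> z i \<in> A}"
    by auto
  have "emeasure (empirical_measure \<nu> n z) A = ennreal (card {i. i < n \<and> z i \<in> A} / n)"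
    using assms z
    by (auto simp: empirical_measure_def emeasure_distr space_uniform_count_measure eq
        intro!: trans[OF emeasure_uniform_count_measure])
  then have "of_nat n * emeasure (empirical_measure \<nu> n z) A = of_nat (card {i. i < n \<and> z i \<in> A})"
    using assms(1) by (simp add: ennreal_of_nat_eq_real_of_nat ennreal_mult[symmetric])
  moreover have "sets (scale_measure (of_nat n) (empirical_measure \<nu> n z)) = sets \<nu>"
    by (simp add: empirical_measure_def)
  ultimately show ?thesis
    using assms(3) by (simp add: dp_base_def emeasure_add_measure)
qed

end

theory Submission
  imports Defs
begin

text \<open>
  Write \<open>\<alpha> = \<nu> + \<Sum>i<n. \<delta>(z i)\<close> for the posterior base measure, \<open>a\<close> for its total mass, and let \<open>h\<close> be
  \<open>g\<close> truncated at height \<open>sqrt n\<close> and centred at its sample mean. The proof compares three quantities: the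
  conditional expectation of the theorem, the same expectation with \<open>h\<close> in place of the centred \<open>g\<close>, and
  \<open>exp (- \<integral>x. ln (1 - v * h x) \<partial>\<alpha>)\<close> with \<open>v = t * sqrt n / a\<close>, which is the Laplace transform of the integral
  of \<open>h\<close> against a gamma process with base measure \<open>\<alpha>\<close>. All estimates are uniform in \<open>g\<close>.

  \<^emph>\<open>From Dirichlet to gamma.\<close> A Dirichlet vector is a gamma vector divided by its total \<open>S\<close>. Tilting a
  gamma vector by \<open>exp (- \<theta> * S)\<close> is the same as rescaling it, and comparing the two at \<open>\<theta> = 0\<close> shows
  that a scale invariant statistic \<open>X\<close> satisfies \<open>E (S^m * X^m) = pochhammer a m * E (X^m)\<close>. Hence the Taylor
  coefficients of the Laplace transforms of \<open>a * X\<close> and \<open>S * X\<close> agree up to a factor between \<open>1 - 2^m / a\<close>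
  and \<open>1\<close>, so that the two transforms differ by \<open>O(1 / a)\<close>
  (\<open>abs_integral_exp_normalized_linear_minus_prod_le\<close>). Finite partitions and approximation by simple
  functions carry this over to \<open>P h\<close> for a bounded \<open>h\<close> and a Dirichlet process \<open>P\<close> (\<open>laplace_bounded\<close>).

  \<^emph>\<open>Expansion.\<close> Since \<open>- ln (1 - y) = y + y\<^sup>2 / 2 + O(\<bar>y\<bar>^3)\<close>, the exponent is, apart from a vanishing
  contribution of \<open>\<nu>\<close>, the sum of a linear term, which vanishes because \<open>h\<close> is centred, the sample variance
  times \<open>t\<^sup>2 / 2\<close>, and a cubic remainder controlled by \<open>max (G (z i)) / sqrt n\<close>, which tends to zero
  because \<open>G\<^sup>2\<close> has a finite mean (\<open>log_laplace_estimate\<close>). Sample means converge uniformly over \<open>\<G>\<close> by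
  assumption; the sample variances converge uniformly once the squares of the class do.

  \<^emph>\<open>Squares of a Glivenko-Cantelli class\<close> (\<open>gc_squares\<close>). It is enough to treat \<open>\<bar>g - c\<bar>\<close>, as \<open>g\<^sup>2\<close> is, up to
  the tails of \<open>G\<close>, the integral of \<open>\<bar>g - c\<bar>\<close> over \<open>c\<close> in a bounded interval, minus a constant. An absolute
  value \<open>\<bar>f\<bar>\<close> is the larger of \<open>f\<close> and \<open>- f\<close>, and replacing the observations one at a time bounds the mean
  of the supremum of the centred sum of the \<open>\<bar>f (z i)\<bar>\<close> by the mean, over random signs, of the supremum of
  the signed sums of the \<open>f (z i)\<close>; this is the contraction principle, in a form in which every supremum is
  replaced by a measurable majorant (\<open>sign_average_majorant\<close>). A signed sum is a difference of two ordinary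
  centred sums over subsamples, which are small by hypothesis. Smallness in mean for one block length becomes
  almost sure smallness by a law of large numbers for functions of consecutive blocks, which is deduced from
  the maximal ergodic inequality (\<open>AE_eventually_block_sum_le\<close>).

  \<^emph>\<open>Truncation.\<close> Almost surely all observations eventually lie below \<open>sqrt n\<close>, so the truncation acts
  only on the \<open>\<nu>\<close>-part of the base measure, which is a vanishing fraction of it. There the sub-Gaussian bound
  makes the exponential moment of \<open>G\<close> beyond \<open>sqrt n\<close> bounded in \<open>n\<close>, if \<open>\<bar>t\<bar>\<close> is at most \<open>1 / (8 * c)\<close>; Young's
  inequality with weight \<open>1 / sqrt n\<close> turns this into an error of order \<open>1 / sqrt n\<close> (\<open>exp_truncation_error\<close>).
\<close>

section \<open>A maximal ergodic inequality\<close>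

text \<open>
  The largest of the partial sums of \<open>Y\<close> along the first \<open>n\<close> steps of the orbit of \<open>z\<close>, the empty sum included.
  The recursion at the front is what makes the maximal ergodic inequality short.
\<close>

primrec maximal_excess :: "('a \<Rightarrow> 'a) \<Rightarrow> ('a \<Rightarrow> real) \<Rightarrow> nat \<Rightarrow> 'a \<Rightarrow> real" where
  "maximal_excess T Y 0 z = 0"
| "maximal_excess T Y (Suc n) z = max 0 (Y z + maximal_excess T Y n (T z))"

lemma maximal_excess_nonneg: "0 \<le> maximal_excess T Y n z"
  by (cases n) auto

lemma maximal_excess_mono: "maximal_excess T Y n z \<le> maximal_excess T Y (Suc n) z"
proof (induction n arbitrary: z)
  case (Suc n)
  show ?case
    using Suc[of "T z"] by (simp add: max_def)
qed simp

lemma maximal_excess_ge: "k \<le> n \<Longrightarrow> (\<Sum>j<k. Y ((T ^^ j) z)) \<le> maximal_excess T Y n z"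
proof (induction n arbitrary: k z)
  case (Suc n)
  show ?case
  proof (cases k)
    case (Suc l)
    have "(\<Sum>j<k. Y ((T ^^ j) z)) = Y z + (\<Sum>j<l. Y ((T ^^ j) (T z)))"
      unfolding Suc by (subst sum.lessThan_Suc_shift) (simp add: funpow_Suc_right del: funpow.simps(2))
    also have "\<dots> \<le> Y z + maximal_excess T Y n (T z)"
      using Suc.IH[of l "T z"] Suc.prems Suc by simp
    finally show ?thesis
      by simp
  qed (simp add: maximal_excess_nonneg)
qed simp

lemma integral_measure_preserving:
  fixes f :: "'a \<Rightarrow> real"
  assumes T: "T \<in> S \<rightarrow>\<^sub>M S" "distr S S T = S" and f: "integrable S f"
  shows "integrable S (\<lambda>z. f (T z))" and "(\<integral>z. f (T z) \<partial>S) = (\<integral>z. f z \<partial>S)"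
proof -
  have fm: "f \<in> borel_measurable S" using f by auto
  show "integrable S (\<lambda>z. f (T z))"
    using integrable_distr_eq[OF T(1) fm] f T(2) by simp
  show "(\<integral>z. f (T z) \<partial>S) = (\<integral>z. f z \<partial>S)"
    using integral_distr[OF T(1) fm] T(2) by simp
qed

text \<open>
  Garsia's argument. Where the maximal sum \<open>M\<close> is positive, the recursion gives \<open>M z - M (T z) \<le> Y z\<close>; elsewhere
  \<open>M z - M (T z) \<le> 0\<close>. The left-hand side has integral zero over the invariant set \<open>E\<close>. Letting the horizon grow
  removes the restriction to positive maxima, because every orbit in \<open>E\<close> has a positive partial sum.
\<close>

lemma maximal_ergodic_inequality:
  fixes Y :: "'a \<Rightarrow> real"
  assumes T: "T \<in> S \<rightarrow>\<^sub>M S" "distr S S T = S" and Y: "integrable S Y"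
    and E: "E \<in> sets S" "\<And>z. z \<in> space S \<Longrightarrow> T z \<in> E \<longleftrightarrow> z \<in> E"
    and pos: "\<And>z. z \<in> E \<Longrightarrow> \<exists>k. 0 < (\<Sum>j<k. Y ((T ^^ j) z))"
  shows "0 \<le> (\<integral>z. indicator E z * Y z \<partial>S)"
proof -
  define M where "M n = maximal_excess T Y n" for n
  note [measurable] = T(1) E(1)
  have [measurable]: "Y \<in> borel_measurable S" using Y by auto
  have Mm[measurable]: "M n \<in> borel_measurable S" and Mi: "integrable S (M n)" for n
  proof (induction n)
    case (Suc n)
    { case 1 show ?case unfolding M_def maximal_excess.simps
        using Suc(1) unfolding M_def by measurable }
    { case 2 show ?case unfolding M_def maximal_excess.simps
        using Suc(2) Y integral_measure_preserving(1)[OF T, of "M n"] unfolding M_def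
        by (intro integrable_max) auto }
  qed (simp_all add: M_def fun_eq_iff[of "maximal_excess T Y 0" "\<lambda>_. 0", THEN iffD2])
  have step: "0 \<le> (\<integral>z. indicator E z * (Y z * indicator {z. 0 < M (Suc n) z} z) \<partial>S)" for n
  proof -
    have i1: "integrable S (\<lambda>z. indicator E z * M (Suc n) z)"
      using integrable_mult_indicator[OF E(1) Mi[of "Suc n"]] by simp
    have i2: "integrable S (\<lambda>z. indicator E z * M (Suc n) (T z))"
      using integrable_mult_indicator[OF E(1) integral_measure_preserving(1)[OF T Mi[of "Suc n"]]] by simp
    have i3: "integrable S (\<lambda>z. indicator E z * (Y z * indicator {z. 0 < M (Suc n) z} z))"
      by (rule Bochner_Integration.integrable_bound[OF Y]) (auto simp: indicator_def)
    have "(\<integral>z. indicator E z * M (Suc n) (T z) \<partial>S) = (\<integral>z. indicator E (T z) * M (Suc n) (T z) \<partial>S)"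
      using E(2) by (intro Bochner_Integration.integral_cong) (auto simp: indicator_def)
    also have "\<dots> = (\<integral>z. indicator E z * M (Suc n) z \<partial>S)"
      using integral_measure_preserving(2)[OF T i1] .
    finally have "0 = (\<integral>z. indicator E z * M (Suc n) z - indicator E z * M (Suc n) (T z) \<partial>S)"
      using i1 i2 by simp
    also have "\<dots> \<le> (\<integral>z. indicator E z * (Y z * indicator {z. 0 < M (Suc n) z} z) \<partial>S)"
    proof (rule integral_mono[OF _ i3])
      fix z
      have "M (Suc n) z - M (Suc n) (T z) \<le> Y z * indicator {z. 0 < M (Suc n) z} z"
        using maximal_excess_mono[of T Y n "T z"] maximal_excess_nonneg[of T Y n "T z"]
        unfolding M_def by (auto simp: indicator_def max_def split: if_splits)
      then show "indicator E z * M (Suc n) z - indicator E z * M (Suc n) (T z)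
          \<le> indicator E z * (Y z * indicator {z. 0 < M (Suc n) z} z)"
        by (auto simp: indicator_def)
    qed (use i1 i2 in auto)
    finally show ?thesis .
  qed
  have "(\<lambda>n. \<integral>z. indicator E z * (Y z * indicator {z. 0 < M (Suc n) z} z) \<partial>S)
      \<longlonglongrightarrow> (\<integral>z. indicator E z * Y z \<partial>S)"
  proof (rule integral_dominated_convergence[where w = "\<lambda>z. norm (Y z)"])
    show "AE z in S. (\<lambda>n. indicator E z * (Y z * indicator {z. 0 < M (Suc n) z} z)) \<longlonglongrightarrow> indicator E z * Y z"
    proof (rule AE_I2)
      fix z
      show "(\<lambda>n. indicator E z * (Y z * indicator {z. 0 < M (Suc n) z} z)) \<longlonglongrightarrow> indicator E z * Y z"
      proof (cases "z \<in> E")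
        case True
        then obtain k where k: "0 < (\<Sum>j<k. Y ((T ^^ j) z))" using pos by blast
        have "0 < M (Suc n) z" if "k \<le> n" for n
          using maximal_excess_ge[of k "Suc n" Y T z] k that unfolding M_def by linarith
        then have "\<forall>\<^sub>F n in sequentially. indicator E z * (Y z * indicator {z. 0 < M (Suc n) z} z) = indicator E z * Y z"
          unfolding eventually_sequentially by (intro exI[of _ k]) auto
        then show ?thesis by (rule tendsto_eventually)
      qed simp
    qed
  qed (use Y in \<open>auto simp: indicator_def\<close>)
  then show ?thesis
    by (rule LIMSEQ_le_const) (use step in auto)
qed

section \<open>Sequences of independent observations\<close>

definition shift_seq :: "nat \<Rightarrow> (nat \<Rightarrow> 'a) \<Rightarrow> nat \<Rightarrow> 'a" where
  "shift_seq m z = (\<lambda>i. z (m + i))"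

lemma shift_seq_funpow: "(shift_seq m ^^ j) z = shift_seq (j * m) z"
  by (induction j arbitrary: z) (auto simp: shift_seq_def fun_eq_iff add_ac)

lemma shift_seq_comb_seq [simp]: "shift_seq m (comb_seq m u v) = v"
  by (simp add: shift_seq_def comb_seq_def)

lemma measurable_shift_seq [measurable]: "shift_seq m \<in> iid_seq M \<rightarrow>\<^sub>M iid_seq M"
  unfolding shift_seq_def iid_seq_def
  by (rule measurable_PiM_single') (auto simp: space_PiM)

lemma space_iid_seq: "z \<in> space (iid_seq M) \<longleftrightarrow> (\<forall>i. z i \<in> space M)"
  by (auto simp: iid_seq_def space_PiM)

lemma measurable_iid_seq_component: "(\<lambda>z. z i) \<in> iid_seq M \<rightarrow>\<^sub>M M"
  unfolding iid_seq_def by measurable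

lemma measurable_iid_seq_comb:
  "(\<lambda>(u, v). comb_seq m u v) \<in> iid_seq M \<Otimes>\<^sub>M iid_seq M \<rightarrow>\<^sub>M iid_seq M"
  unfolding iid_seq_def by (rule measurable_comb_seq)

text \<open>
  Redrawing a single coordinate, as an operation on the pair of a sequence and a fresh observation.
\<close>

lemma measurable_iid_seq_upd:
  "(\<lambda>(z, x). z(i := x)) \<in> iid_seq M \<Otimes>\<^sub>M M \<rightarrow>\<^sub>M iid_seq M"
proof -
  have eq: "(\<lambda>(z, x). z(i := x)) = (\<lambda>p j. if j = i then snd p else fst p j)"
    by (auto simp: fun_eq_iff)
  show ?thesis
    unfolding eq iid_seq_def
  proof (rule measurable_PiM_single')
    fix j
    show "(\<lambda>p. if j = i then snd p else fst p j) \<in> (\<Pi>\<^sub>M i\<in>UNIV. M) \<Otimes>\<^sub>M M \<rightarrow>\<^sub>M M"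
      by (cases "j = i") (auto intro: measurable_compose[OF measurable_fst measurable_component_singleton])
  qed (auto simp: space_pair_measure space_PiM)
qed

lemma space_iid_seq_comb:
  "u \<in> space (iid_seq M) \<Longrightarrow> v \<in> space (iid_seq M) \<Longrightarrow> comb_seq m u v \<in> space (iid_seq M)"
  by (auto simp: space_iid_seq comb_seq_def)

text \<open>
  Change of variables for a map whose image measure has been identified.
\<close>

lemma nn_integral_distr_eq:
  assumes "T \<in> N \<rightarrow>\<^sub>M K" "distr N K T = K" "f \<in> borel_measurable K"
  shows "(\<integral>\<^sup>+x. f x \<partial>K) = (\<integral>\<^sup>+x. f (T x) \<partial>N)"
proof -
  have "f \<in> borel_measurable (distr N K T)"
    unfolding assms(2) by (rule assms(3))
  from nn_integral_distr[OF assms(1) this] show ?thesis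
    unfolding assms(2) .
qed

context prob_space
begin

lemma prob_space_iid_seq: "prob_space (iid_seq M)"
  unfolding iid_seq_def by (intro prob_space_PiM) unfold_locales

lemma iid_seq_comb: "distr (iid_seq M \<Otimes>\<^sub>M iid_seq M) (iid_seq M) (\<lambda>(u, v). comb_seq m u v) = iid_seq M"
proof -
  interpret sequence_space M by unfold_locales
  show ?thesis unfolding iid_seq_def by (rule PiM_comb_seq)
qed

lemma iid_seq_reindex:
  assumes "inj s"
  shows "distr (iid_seq M) (iid_seq M) (\<lambda>z i. z (s i)) = iid_seq M"
  using distr_PiM_reindex[of UNIV "\<lambda>_. M" s UNIV] assms prob_space_axioms
  unfolding iid_seq_def by (simp add: restrict_def)

lemma iid_seq_shift: "distr (iid_seq M) (iid_seq M) (shift_seq m) = iid_seq M"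
  using iid_seq_reindex[of "\<lambda>i. m + i"] unfolding shift_seq_def by (simp add: inj_on_def)

lemma nn_integral_iid_seq_comb:
  assumes f: "f \<in> borel_measurable (iid_seq M)"
  shows "(\<integral>\<^sup>+u. \<integral>\<^sup>+v. f (comb_seq m u v) \<partial>iid_seq M \<partial>iid_seq M) = (\<integral>\<^sup>+z. f z \<partial>iid_seq M)"
proof -
  interpret S: prob_space "iid_seq M" by (rule prob_space_iid_seq)
  have m: "(\<lambda>p. f (case p of (u, v) \<Rightarrow> comb_seq m u v)) \<in> borel_measurable (iid_seq M \<Otimes>\<^sub>M iid_seq M)"
    by (rule measurable_compose[OF measurable_iid_seq_comb f])
  show ?thesis
    unfolding nn_integral_distr_eq[OF measurable_iid_seq_comb iid_seq_comb f, of m]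
    using S.nn_integral_fst[OF m] by (simp only: prod.case)
qed

lemma iid_seq_upd: "distr (iid_seq M \<Otimes>\<^sub>M M) (iid_seq M) (\<lambda>(z, x). z(i := x)) = iid_seq M"
proof -
  note meas = measurable_iid_seq_upd[of i M] and sf = sigma_finite_measure_axioms
    and total = emeasure_space_1
  interpret sequence_space M by unfold_locales
  show ?thesis unfolding iid_seq_def
  proof (rule PiM_eq)
    fix J and F :: "nat \<Rightarrow> 'a set"
    assume J: "finite J" "J \<subseteq> UNIV" and F: "\<And>j. j \<in> J \<Longrightarrow> F j \<in> sets M"
    let ?X = "prod_emb UNIV (\<lambda>_. M) J (Pi\<^sub>E J F)"
    let ?Y = "prod_emb UNIV (\<lambda>_. M) (J - {i}) (Pi\<^sub>E (J - {i}) F)"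
    let ?A = "if i \<in> J then F i else space M"
    have X: "?X \<in> sets (iid_seq M)"
      unfolding iid_seq_def using J F by (intro measurable_prod_emb sets_PiM_I_finite) auto
    have Y: "?Y \<in> sets (iid_seq M)" "?A \<in> sets M"
      unfolding iid_seq_def using J F by (auto intro!: measurable_prod_emb sets_PiM_I_finite)
    have "(\<lambda>(z, x). z(i := x)) -` ?X \<inter> space (iid_seq M \<Otimes>\<^sub>M M) = ?Y \<times> ?A"
    proof (rule set_eqI, clarify)
      fix z x
      have "z(i := x) \<in> ?X \<longleftrightarrow> (\<forall>j. (z(i := x)) j \<in> space M) \<and> (\<forall>j\<in>J. (z(i := x)) j \<in> F j)"
        by (auto simp: prod_emb_def space_PiM PiE_iff)
      moreover have "z \<in> ?Y \<longleftrightarrow> (\<forall>j. z j \<in> space M) \<and> (\<forall>j\<in>J - {i}. z j \<in> F j)"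
        by (auto simp: prod_emb_def space_PiM PiE_iff)
      moreover have "i \<in> J \<Longrightarrow> F i \<subseteq> space M"
        using F sets.sets_into_space by blast
      ultimately show "(z, x) \<in> (\<lambda>(z, x). z(i := x)) -` ?X \<inter> space (iid_seq M \<Otimes>\<^sub>M M) \<longleftrightarrow> (z, x) \<in> ?Y \<times> ?A"
        by (auto simp: space_pair_measure space_iid_seq split: if_splits)
    qed
    then have "emeasure (distr (iid_seq M \<Otimes>\<^sub>M M) (iid_seq M) (\<lambda>(z, x). z(i := x))) ?X
        = emeasure (iid_seq M) ?Y * emeasure M ?A"
      using X meas sigma_finite_measure.emeasure_pair_measure_Times[OF sf Y]
      by (simp only: emeasure_distr)
    also have "\<dots> = (\<Prod>j\<in>J. emeasure M (F j))"
    proof -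
      have "emeasure (iid_seq M) ?Y = (\<Prod>j\<in>J - {i}. emeasure M (F j))"
        unfolding iid_seq_def using J F by (intro emeasure_PiM_emb) auto
      then show ?thesis
        using J total by (auto simp: prod.remove[of J i] mult.commute)
    qed
    finally show "emeasure (distr (Pi\<^sub>M UNIV (\<lambda>_. M) \<Otimes>\<^sub>M M) (Pi\<^sub>M UNIV (\<lambda>_. M)) (\<lambda>(z, x). z(i := x))) ?X
        = (\<Prod>j\<in>J. emeasure M (F j))"
      unfolding iid_seq_def .
  qed simp
qed

lemma nn_integral_iid_seq_upd:
  assumes f: "f \<in> borel_measurable (iid_seq M)"
  shows "(\<integral>\<^sup>+z. \<integral>\<^sup>+x. f (z(i := x)) \<partial>M \<partial>iid_seq M) = (\<integral>\<^sup>+z. f z \<partial>iid_seq M)"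
proof -
  note m = measurable_iid_seq_upd[of i M]
  show ?thesis
    unfolding nn_integral_distr_eq[OF m iid_seq_upd f]
    using nn_integral_fst[OF measurable_compose[OF m f]] by (simp only: prod.case)
qed

lemma borel_measurable_nn_integral_iid_seq_upd [measurable]:
  assumes f: "f \<in> borel_measurable (iid_seq M)"
  shows "(\<lambda>z. \<integral>\<^sup>+x. f (z(i := x)) \<partial>M) \<in> borel_measurable (iid_seq M)"
proof -
  note m = measurable_iid_seq_upd[of i M]
  show ?thesis
    using borel_measurable_nn_integral_fst[OF measurable_compose[OF m f]] by (simp only: prod.case)
qed

lemma nn_integral_iid_seq_reindex:
  assumes "inj s" and [measurable]: "f \<in> borel_measurable (iid_seq M)"
  shows "(\<integral>\<^sup>+z. f (\<lambda>i. z (s i)) \<partial>iid_seq M) = (\<integral>\<^sup>+z. f z \<partial>iid_seq M)"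
proof -
  have m: "(\<lambda>z i. z (s i)) \<in> iid_seq M \<rightarrow>\<^sub>M iid_seq M"
    unfolding iid_seq_def by (rule measurable_PiM_single') (auto simp: space_PiM)
  show ?thesis
    by (rule nn_integral_distr_eq[OF m iid_seq_reindex[OF assms(1)] assms(2), symmetric])
qed

lemma distr_iid_seq_component: "distr (iid_seq M) M (\<lambda>z. z i) = M"
proof -
  interpret sequence_space M by unfold_locales
  show ?thesis
    unfolding iid_seq_def by (rule PiM_component) simp
qed

lemma borel_measurable_iid_seq_component:
  assumes "f \<in> borel_measurable M"
  shows "(\<lambda>z. f (z i)) \<in> borel_measurable (iid_seq M)"
  by (rule measurable_compose[OF measurable_iid_seq_component assms])

lemma integral_iid_seq_component:
  fixes f :: "'a \<Rightarrow> real"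
  assumes f: "integrable M f"
  shows "integrable (iid_seq M) (\<lambda>z. f (z i))" "(\<integral>z. f (z i) \<partial>iid_seq M) = (\<integral>x. f x \<partial>M)"
proof -
  have fm: "f \<in> borel_measurable M" using f by auto
  show "integrable (iid_seq M) (\<lambda>z. f (z i))"
    using integrable_distr_eq[OF measurable_iid_seq_component fm, of i] distr_iid_seq_component[of i] f by simp
  show "(\<integral>z. f (z i) \<partial>iid_seq M) = (\<integral>x. f x \<partial>M)"
    using integral_distr[OF measurable_iid_seq_component fm, of i] distr_iid_seq_component[of i] by simp
qed

lemma integral_sum_iid_seq:
  fixes f :: "'a \<Rightarrow> real"
  assumes f: "integrable M f"
  shows "integrable (iid_seq M) (\<lambda>z. \<Sum>i<n. f (z i))" "(\<integral>z. (\<Sum>i<n. f (z i)) \<partial>iid_seq M) = n * (\<integral>x. f x \<partial>M)"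
  using integral_iid_seq_component[OF f]
  by (auto simp: Bochner_Integration.integral_sum)

section \<open>Laws of large numbers for blocks\<close>

text \<open>
  The upper half of a law of large numbers, for the values of \<open>X\<close> along consecutive blocks of length \<open>m\<close>. Let \<open>E\<close> be
  the event that the partial sums of \<open>X - l'\<close> are unbounded above, for some \<open>l'\<close> between the mean and \<open>l\<close>. It is
  invariant under the shift by \<open>m\<close>, hence does not depend on the first block, on which alone \<open>X\<close> depends. The
  maximal ergodic inequality therefore reads \<open>0 \<le> (E X - l') * P E\<close>, and \<open>P E = 0\<close> as the first factor is
  negative.
\<close>

lemma AE_eventually_block_sum_le:
  assumes X: "integrable (iid_seq M) X"
    and dep: "\<And>u v. u \<in> space (iid_seq M) \<Longrightarrow> v \<in> space (iid_seq M) \<Longrightarrow> X (comb_seq m u v) = X u"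
    and l: "(\<integral>z. X z \<partial>iid_seq M) < l"
  shows "AE z in iid_seq M. \<forall>\<^sub>F k in sequentially. (\<Sum>j<k. X (shift_seq (j * m) z)) \<le> l * real k"
proof -
  interpret S: prob_space "iid_seq M" by (rule prob_space_iid_seq)
  \<comment> \<open>the gap between \<open>l'\<close> and \<open>l\<close> absorbs the random bound on the partial sums\<close>
  obtain l' where l': "(\<integral>z. X z \<partial>iid_seq M) < l'" "l' < l" using l dense by blast
  define Y where "Y z = X z - l'" for z
  define D where "D k z = (\<Sum>j<k. Y (shift_seq (j * m) z))" for k z
  define E where "E = {z\<in>space (iid_seq M). \<forall>B::nat. \<exists>k. real B < D k z}"
  have [measurable]: "X \<in> borel_measurable (iid_seq M)" using X by auto
  have [measurable]: "Y \<in> borel_measurable (iid_seq M)" unfolding Y_def by measurable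
  have [measurable]: "D k \<in> borel_measurable (iid_seq M)" for k unfolding D_def by measurable
  have E_sets[measurable]: "E \<in> sets (iid_seq M)" unfolding E_def by measurable
  have Yi: "integrable (iid_seq M) Y" unfolding Y_def using X by auto
  have shift_space: "z \<in> space (iid_seq M) \<Longrightarrow> shift_seq m z \<in> space (iid_seq M)" for z
    by (auto simp: space_iid_seq shift_seq_def)
  have D_Suc: "D (Suc k) z = Y z + D k (shift_seq m z)" for k z
    unfolding D_def
    by (subst sum.lessThan_Suc_shift) (auto simp: shift_seq_def add_ac)
  \<comment> \<open>one term more or less does not affect unboundedness\<close>
  have inv: "shift_seq m z \<in> E \<longleftrightarrow> z \<in> E" if z: "z \<in> space (iid_seq M)" for z
  proof
    assume *: "shift_seq m z \<in> E"
    show "z \<in> E" unfolding E_def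
    proof (safe intro!: z)
      fix B :: nat
      obtain B' :: nat where B': "real B - Y z < real B'" using reals_Archimedean2 by blast
      from * obtain k where "real B' < D k (shift_seq m z)" unfolding E_def by blast
      with B' D_Suc[of k z] have "real B < D (Suc k) z" by linarith
      then show "\<exists>k. real B < D k z" by blast
    qed
  next
    assume *: "z \<in> E"
    show "shift_seq m z \<in> E" unfolding E_def
    proof (safe intro!: shift_space[OF z])
      fix B :: nat
      obtain B' :: nat where B': "real B + Y z < real B'" using reals_Archimedean2 by blast
      from * obtain k where k: "real B' < D k z" unfolding E_def by blast
      then have "k \<noteq> 0" by (cases k) (auto simp: D_def)
      then obtain k' where k': "k = Suc k'" by (cases k) auto
      have "real B < D k' (shift_seq m z)"
        using B' D_Suc[of k' z] k unfolding k' by linarith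
      then show "\<exists>k. real B < D k (shift_seq m z)" by blast
    qed
  qed
  have "0 \<le> (\<integral>z. indicator E z * Y z \<partial>iid_seq M)"
  proof (rule maximal_ergodic_inequality[OF measurable_shift_seq iid_seq_shift Yi E_sets inv])
    fix z assume "z \<in> E"
    then obtain k where "real 0 < D k z" unfolding E_def by blast
    then show "\<exists>k. 0 < (\<Sum>j<k. Y ((shift_seq m ^^ j) z))"
      by (auto simp: D_def shift_seq_funpow)
  qed
  also have "(\<integral>z. indicator E z * Y z \<partial>iid_seq M) = (\<integral>u. Y u \<partial>iid_seq M) * S.prob E"
  proof -
    have m: "(\<lambda>(u, v). comb_seq m u v) \<in> iid_seq M \<Otimes>\<^sub>M iid_seq M \<rightarrow>\<^sub>M iid_seq M"
      by (rule measurable_iid_seq_comb)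
    interpret P: pair_sigma_finite "iid_seq M" "iid_seq M" by unfold_locales
    have eq: "indicator E (comb_seq m u v) * Y (comb_seq m u v) = Y u * indicator E v"
      if "u \<in> space (iid_seq M)" "v \<in> space (iid_seq M)" for u v
      using inv[OF space_iid_seq_comb[OF that, of m]] dep[OF that]
      by (simp add: indicator_def Y_def)
    have "(\<integral>z. indicator E z * Y z \<partial>iid_seq M)
        = (\<integral>p. (\<lambda>z. indicator E z * Y z) (case p of (u, v) \<Rightarrow> comb_seq m u v) \<partial>(iid_seq M \<Otimes>\<^sub>M iid_seq M))"
      using integral_distr[OF m, of "\<lambda>z. indicator E z * Y z"] unfolding iid_seq_comb by simp
    also have "\<dots> = (\<integral>p. (case p of (u, v) \<Rightarrow> Y u * indicator E v) \<partial>(iid_seq M \<Otimes>\<^sub>M iid_seq M))"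
      by (rule Bochner_Integration.integral_cong[OF refl]) (auto simp: space_pair_measure eq)
    also have "\<dots> = (\<integral>u. \<integral>v. Y u * indicator E v \<partial>iid_seq M \<partial>iid_seq M)"
    proof (rule P.integral_fst[symmetric])
      show "integrable (iid_seq M \<Otimes>\<^sub>M iid_seq M) (\<lambda>(u, v). Y u * indicator E v)"
      proof (rule P.Fubini_integrable)
        have Ei: "integrable (iid_seq M) (indicator E :: _ \<Rightarrow> real)"
          by (rule integrable_real_indicator) (auto simp: S.emeasure_eq_measure)
        show "integrable (iid_seq M) (\<lambda>u. \<integral>v. norm (case (u, v) of (u, v) \<Rightarrow> Y u * indicator E v) \<partial>iid_seq M)"
          using Yi Ei by (simp add: abs_mult)
        show "AE u in iid_seq M. integrable (iid_seq M) (\<lambda>v. case (u, v) of (u, v) \<Rightarrow> Y u * indicator E v)"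
          using Ei by simp
      qed measurable
    qed
    finally show ?thesis by simp
  qed
  also have "(\<integral>u. Y u \<partial>iid_seq M) = (\<integral>u. X u \<partial>iid_seq M) - l'"
    unfolding Y_def using X by (simp add: S.prob_space)
  finally have "S.prob E \<le> 0"
    using l'(1) by (simp add: zero_le_mult_iff)
  then have "S.prob E = 0" using measure_nonneg[of "iid_seq M" E] by linarith
  then have "E \<in> null_sets (iid_seq M)"
    by (intro null_setsI) (auto simp: S.emeasure_eq_measure)
  then have "AE z in iid_seq M. z \<notin> E" by (rule AE_not_in)
  then show ?thesis
  proof (rule AE_mp, intro AE_I2 impI)
    fix z assume z: "z \<in> space (iid_seq M)" and "z \<notin> E"
    then obtain B :: nat where B: "\<And>k. D k z \<le> real B" unfolding E_def by (auto simp: not_less)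
    obtain K :: nat where K: "real B / (l - l') < real K" using reals_Archimedean2 by blast
    show "\<forall>\<^sub>F k in sequentially. (\<Sum>j<k. X (shift_seq (j * m) z)) \<le> l * real k"
      unfolding eventually_sequentially
    proof (intro exI[of _ K] allI impI)
      fix k assume "K \<le> k"
      then have "(l - l') * real K \<le> (l - l') * real k"
        using l'(2) by (intro mult_left_mono) auto
      moreover have "real B < (l - l') * real K"
        using K l'(2) by (simp add: pos_divide_less_eq mult.commute)
      ultimately have "real B \<le> (l - l') * real k"
        by linarith
      moreover have "(\<Sum>j<k. X (shift_seq (j * m) z)) - l' * real k \<le> real B"
        using B[of k] by (simp add: D_def Y_def sum_subtractf mult.commute)
      ultimately show "(\<Sum>j<k. X (shift_seq (j * m) z)) \<le> l * real k"
        by (simp add: algebra_simps)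
    qed
  qed
qed

lemma AE_eventually_sum_le:
  assumes f: "integrable M f" and l: "(\<integral>x. f x \<partial>M) < l"
  shows "AE z in iid_seq M. \<forall>\<^sub>F k in sequentially. (\<Sum>j<k. f (z j)) \<le> l * real k"
proof -
  have D: "distr (iid_seq M) M (\<lambda>z. z 0) = M"
    by (rule distr_iid_seq_component)
  have fm: "f \<in> borel_measurable M" using f by auto
  have "integrable (iid_seq M) (\<lambda>z. f (z 0))"
    using integrable_distr_eq[OF measurable_iid_seq_component fm, of 0] D f by simp
  moreover have "(\<integral>z. f (z 0) \<partial>iid_seq M) < l"
    using integral_distr[OF measurable_iid_seq_component fm, of 0] D l by simp
  ultimately show ?thesis
    using AE_eventually_block_sum_le[of "\<lambda>z. f (z 0)" 1 l]
    by (simp add: shift_seq_def)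
qed

end

section \<open>Exponential tilting of gamma vectors\<close>

lemma gamma_density_nonneg: "0 < a \<Longrightarrow> 0 \<le> gamma_density a x"
  using Gamma_real_pos[of a] by (simp add: gamma_density_def)

lemma measurable_gamma_density [measurable]: "gamma_density a \<in> borel_measurable borel"
  unfolding gamma_density_def[abs_def] by measurable

lemma sets_gamma_dist [simp, measurable_cong]: "sets (gamma_dist a) = sets borel"
  by (simp add: gamma_dist_def)

lemma space_gamma_dist [simp]: "space (gamma_dist a) = UNIV"
  by (simp add: gamma_dist_def)

lemma nn_integral_gamma_dist_pos:
  assumes "0 < a" and [measurable]: "f \<in> borel_measurable borel"
  shows "(\<integral>\<^sup>+y. f y \<partial>gamma_dist a) = (\<integral>\<^sup>+y. ennreal (gamma_density a y) * f y \<partial>lborel)"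
  using assms(1) unfolding gamma_dist_def by (simp add: nn_integral_density)

lemma emeasure_gamma_dist_pos:
  assumes a: "0 < a"
  shows "emeasure (gamma_dist a) UNIV = 1"
proof -
  have "((\<lambda>t. t powr (a - 1) / exp t) has_integral Gamma a) {0..}"
    using Gamma_integral_real[OF a] .
  then have *: "((\<lambda>t. t powr (a - 1) / exp t / Gamma a) has_integral Gamma a / Gamma a) {0..}"
    by (rule has_integral_divide)
  have G: "Gamma a > 0" using a by (rule Gamma_real_pos)
  have "(\<integral>\<^sup>+x. ennreal (indicator {0..} x * (x powr (a - 1) / exp x / Gamma a)) \<partial>lborel) = ennreal (Gamma a / Gamma a)"
    by (rule nn_integral_has_integral_lebesgue[OF _ *]) (use G in auto)
  moreover have "(\<integral>\<^sup>+x. ennreal (gamma_density a x) \<partial>lborel)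
      = (\<integral>\<^sup>+x. ennreal (indicator {0..} x * (x powr (a - 1) / exp x / Gamma a)) \<partial>lborel)"
    by (intro nn_integral_cong) (auto simp: gamma_density_def exp_minus indicator_def divide_simps)
  ultimately show ?thesis
    using nn_integral_gamma_dist_pos[OF a, of "\<lambda>_. 1"] G by simp
qed

lemma prob_space_gamma_dist: "0 \<le> a \<Longrightarrow> prob_space (gamma_dist a)"
proof (cases "a = 0")
  case True
  then show ?thesis by (simp add: gamma_dist_def prob_space_return)
qed (auto intro!: prob_spaceI emeasure_gamma_dist_pos)

lemma AE_gamma_dist_nonneg: "AE y in gamma_dist a. 0 \<le> y"
proof (cases "a = 0")
  case True
  have "gamma_dist a = return borel 0"
    using True by (simp add: gamma_dist_def)
  then show ?thesis
    by (simp only:) (rule AE_return[THEN iffD2], auto)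
next
  case False
  have "AE y in density lborel (\<lambda>x. ennreal (gamma_density a x)). 0 \<le> y"
    by (subst AE_density) (auto simp: gamma_density_def)
  moreover have "gamma_dist a = density lborel (\<lambda>x. ennreal (gamma_density a x))"
    using False by (simp add: gamma_dist_def)
  ultimately show ?thesis
    by (simp only:)
qed

text \<open>
  A gamma density multiplied by \<open>exp (- \<theta> * y)\<close> is again a gamma density of the same shape up to scale. The
  substitution \<open>y \<mapsto> y / (1 + \<theta>)\<close> produces the density and leaves the constant \<open>(1 + \<theta>) powr (- a)\<close>.
\<close>

lemma nn_integral_gamma_dist_tilt:
  assumes a: "0 \<le> a" and th: "-1 < \<theta>" and f[measurable]: "f \<in> borel_measurable borel"
  shows "(\<integral>\<^sup>+y. ennreal (exp (- \<theta> * y)) * f y \<partial>gamma_dist a)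
    = ennreal ((1 + \<theta>) powr (- a)) * (\<integral>\<^sup>+y. f (y / (1 + \<theta>)) \<partial>gamma_dist a)"
proof (cases "a = 0")
  case True
  then show ?thesis
    using th by (simp add: gamma_dist_def nn_integral_return)
next
  case False
  with a have a: "0 < a" by simp
  define r where "r = 1 + \<theta>"
  have r: "0 < r" using th by (simp add: r_def)
  have dens: "gamma_density a (y / r) = r powr (1 - a) * exp (\<theta> * (y / r)) * gamma_density a y" for y
  proof (cases "0 < y")
    case True
    have "- (y / r) = \<theta> * (y / r) - y"
      using r by (simp add: r_def field_simps)
    then have "exp (- (y / r)) = exp (\<theta> * (y / r)) * exp (- y)"
      by (simp add: exp_add[symmetric])
    moreover have "(y / r) powr (a - 1) = r powr (1 - a) * y powr (a - 1)"
      using True r powr_minus_divide[of r "a - 1"] by (simp add: powr_divide)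
    ultimately show ?thesis
      using True r by (simp add: gamma_density_def)
  qed (use r in \<open>simp add: gamma_density_def zero_less_divide_iff\<close>)
  have "(\<integral>\<^sup>+y. ennreal (exp (- \<theta> * y)) * f y \<partial>gamma_dist a)
      = (\<integral>\<^sup>+y. ennreal (gamma_density a y) * (ennreal (exp (- \<theta> * y)) * f y) \<partial>lborel)"
    by (rule nn_integral_gamma_dist_pos[OF a]) measurable
  also have "\<dots> = ennreal \<bar>1 / r\<bar> *
      (\<integral>\<^sup>+y. ennreal (gamma_density a (0 + 1 / r * y)) * (ennreal (exp (- \<theta> * (0 + 1 / r * y))) * f (0 + 1 / r * y)) \<partial>lborel)"
    using r by (intro nn_integral_real_affine) auto
  also have "\<dots> = ennreal (1 / r) * (\<integral>\<^sup>+y. ennreal (r powr (1 - a)) * (ennreal (gamma_density a y) * f (y / r)) \<partial>lborel)"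
  proof -
    have "ennreal (gamma_density a (0 + 1 / r * y)) * (ennreal (exp (- \<theta> * (0 + 1 / r * y))) * f (0 + 1 / r * y))
        = ennreal (r powr (1 - a)) * (ennreal (gamma_density a y) * f (y / r))" for y
    proof -
      have "ennreal (gamma_density a (y / r)) * ennreal (exp (- \<theta> * (y / r)))
          = ennreal (r powr (1 - a)) * ennreal (gamma_density a y)"
        using a by (simp add: dens ennreal_mult[symmetric] gamma_density_nonneg exp_add[symmetric] mult_ac)
      then show ?thesis
        by (simp add: mult.assoc[symmetric])
    qed
    then show ?thesis using r by simp
  qed
  also have "\<dots> = ennreal (1 / r) * (ennreal (r powr (1 - a)) * (\<integral>\<^sup>+y. ennreal (gamma_density a y) * f (y / r) \<partial>lborel))"
    by (subst nn_integral_cmult) auto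
  also have "\<dots> = ennreal (r powr (- a)) * (\<integral>\<^sup>+y. f (y / r) \<partial>gamma_dist a)"
    using r by (subst nn_integral_gamma_dist_pos[OF a])
      (auto simp: mult.assoc[symmetric] ennreal_mult[symmetric] powr_diff powr_minus divide_simps)
  finally show ?thesis by (simp add: r_def)
qed

text \<open>
  The rescaling by \<open>1 + \<theta>\<close> is common to all coordinates, whatever their shapes, so tilting by the total acts on
  the vector as a single dilation.
\<close>

lemma nn_integral_gamma_product_tilt:
  assumes "finite I" and a: "\<And>i. i \<in> I \<Longrightarrow> 0 \<le> a i" and th: "-1 < \<theta>"
    and "f \<in> borel_measurable (\<Pi>\<^sub>M i\<in>I. borel)"
  shows "(\<integral>\<^sup>+y. ennreal (exp (- \<theta> * (\<Sum>i\<in>I. y i))) * f y \<partial>(\<Pi>\<^sub>M i\<in>I. gamma_dist (a i)))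
    = ennreal ((1 + \<theta>) powr (- (\<Sum>i\<in>I. a i))) *
      (\<integral>\<^sup>+y. f (\<lambda>i\<in>I. y i / (1 + \<theta>)) \<partial>(\<Pi>\<^sub>M i\<in>I. gamma_dist (a i)))"
proof -
  \<comment> \<open>the induction needs a family of probability measures on the whole index type, hence shape \<open>0\<close> outside \<open>I\<close>\<close>
  define b where "b i = (if i \<in> I then a i else 0)" for i
  interpret product_sigma_finite "\<lambda>i. gamma_dist (b i)"
    by (intro product_sigma_finite.intro prob_space_imp_sigma_finite prob_space_gamma_dist) (simp add: b_def a)
  have b: "0 \<le> b i" for i by (simp add: b_def a)
  have sets_eq: "sets (\<Pi>\<^sub>M i\<in>J. gamma_dist (b i)) = sets (\<Pi>\<^sub>M i\<in>J. borel)" for J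
    by (intro sets_PiM_cong) auto
  have "(\<integral>\<^sup>+y. ennreal (exp (- \<theta> * (\<Sum>i\<in>J. y i))) * f y \<partial>(\<Pi>\<^sub>M i\<in>J. gamma_dist (b i)))
    = ennreal ((1 + \<theta>) powr (- (\<Sum>i\<in>J. b i))) *
      (\<integral>\<^sup>+y. f (\<lambda>i\<in>J. y i / (1 + \<theta>)) \<partial>(\<Pi>\<^sub>M i\<in>J. gamma_dist (b i)))"
    if "finite J" and "f \<in> borel_measurable (\<Pi>\<^sub>M i\<in>J. borel)" for J f
    using that
  proof (induction J arbitrary: f rule: finite_induct)
    case empty
    have "f (\<lambda>x. undefined) = f (\<lambda>i\<in>{}. (\<lambda>x. undefined) i / (1 + \<theta>))"
      by (intro arg_cong[where f = f]) auto
    then show ?case using th by (simp add: PiM_empty nn_integral_count_space_finite)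
  next
    case (insert j J)
    note f = insert.prems
    have fm[measurable]: "f \<in> borel_measurable (\<Pi>\<^sub>M i\<in>insert j J. gamma_dist (b i))"
      using f sets_eq[of "insert j J"] by (simp cong: measurable_cong_sets)
    let ?G = "\<lambda>J. \<Pi>\<^sub>M i\<in>J. gamma_dist (b i)"
    let ?P = "\<lambda>J. (1 + \<theta>) powr (- (\<Sum>i\<in>J. b i))"
    have upd[measurable]: "(\<lambda>p. (fst p)(j := snd p)) \<in> ?G J \<Otimes>\<^sub>M borel \<rightarrow>\<^sub>M ?G (insert j J)"
      using measurable_add_dim[of j J "\<lambda>i. gamma_dist (b i)"]
      by (simp add: split_def cong: measurable_cong_sets sets_pair_measure_cong)
    have fp: "(\<lambda>p. f ((fst p)(j := snd p))) \<in> borel_measurable (?G J \<Otimes>\<^sub>M borel)"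
      by measurable
    have f1: "(\<lambda>x. f (y(j := x))) \<in> borel_measurable borel" if "y \<in> space (?G J)" for y
      using measurable_compose[OF measurable_Pair1'[OF that] fp] by simp
    have sc: "(\<lambda>y. \<lambda>i\<in>insert j J. y i / (1 + \<theta>)) \<in> ?G (insert j J) \<rightarrow>\<^sub>M ?G (insert j J)"
      by (intro measurable_restrict) (simp add: measurable_component_singleton)
    have "(\<integral>\<^sup>+y. ennreal (exp (- \<theta> * (\<Sum>i\<in>insert j J. y i))) * f y \<partial>?G (insert j J))
      = (\<integral>\<^sup>+y. \<integral>\<^sup>+x. ennreal (exp (- \<theta> * (\<Sum>i\<in>insert j J. (y(j := x)) i))) * f (y(j := x)) \<partial>gamma_dist (b j) \<partial>?G J)"
      using insert.hyps by (intro product_nn_integral_insert) auto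
    also have "\<dots> = (\<integral>\<^sup>+y. ennreal (exp (- \<theta> * (\<Sum>i\<in>J. y i))) *
        (ennreal ((1 + \<theta>) powr (- b j)) * (\<integral>\<^sup>+x. f (y(j := x / (1 + \<theta>))) \<partial>gamma_dist (b j))) \<partial>?G J)"
    proof (intro nn_integral_cong)
      fix y assume y: "y \<in> space (?G J)"
      have "(\<Sum>i\<in>insert j J. (y(j := x)) i) = x + (\<Sum>i\<in>J. y i)" for x
        using insert.hyps by (simp add: sum.insert) (intro sum.cong, auto)
      moreover have exp_eq: "ennreal (exp (- \<theta> * (x + s))) = ennreal (exp (- \<theta> * s)) * ennreal (exp (- \<theta> * x))" for x s
        by (simp add: ennreal_mult[symmetric] exp_add[symmetric] algebra_simps)
      ultimately have "(\<integral>\<^sup>+x. ennreal (exp (- \<theta> * (\<Sum>i\<in>insert j J. (y(j := x)) i))) * f (y(j := x)) \<partial>gamma_dist (b j))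
        = (\<integral>\<^sup>+x. ennreal (exp (- \<theta> * (\<Sum>i\<in>J. y i))) * (ennreal (exp (- \<theta> * x)) * f (y(j := x))) \<partial>gamma_dist (b j))"
        by (simp only: exp_eq mult.assoc)
      also have "\<dots> = ennreal (exp (- \<theta> * (\<Sum>i\<in>J. y i))) * (\<integral>\<^sup>+x. ennreal (exp (- \<theta> * x)) * f (y(j := x)) \<partial>gamma_dist (b j))"
        using f1[OF y] by (intro nn_integral_cmult) auto
      also have "(\<integral>\<^sup>+x. ennreal (exp (- \<theta> * x)) * f (y(j := x)) \<partial>gamma_dist (b j))
          = ennreal ((1 + \<theta>) powr (- b j)) * (\<integral>\<^sup>+x. f (y(j := x / (1 + \<theta>))) \<partial>gamma_dist (b j))"
        by (rule nn_integral_gamma_dist_tilt[OF b th f1[OF y]])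
      finally show "(\<integral>\<^sup>+x. ennreal (exp (- \<theta> * (\<Sum>i\<in>insert j J. (y(j := x)) i))) * f (y(j := x)) \<partial>gamma_dist (b j))
        = ennreal (exp (- \<theta> * (\<Sum>i\<in>J. y i))) *
          (ennreal ((1 + \<theta>) powr (- b j)) * (\<integral>\<^sup>+x. f (y(j := x / (1 + \<theta>))) \<partial>gamma_dist (b j)))" .
    qed
    also have "\<dots> = ennreal (?P J) * (\<integral>\<^sup>+y. ennreal ((1 + \<theta>) powr (- b j)) *
        (\<integral>\<^sup>+x. f ((\<lambda>i\<in>J. y i / (1 + \<theta>))(j := x / (1 + \<theta>))) \<partial>gamma_dist (b j)) \<partial>?G J)"
    proof (rule insert.IH)
      have "(\<lambda>p. f ((fst p)(j := snd p / (1 + \<theta>)))) \<in> borel_measurable (?G J \<Otimes>\<^sub>M gamma_dist (b j))"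
        using measurable_compose[OF _ fp, of "\<lambda>p. (fst p, snd p / (1 + \<theta>))" "?G J \<Otimes>\<^sub>M gamma_dist (b j)"] by simp
      then have "(\<lambda>y. \<integral>\<^sup>+x. f (y(j := x / (1 + \<theta>))) \<partial>gamma_dist (b j)) \<in> borel_measurable (?G J)"
        using sigma_finite_measure.borel_measurable_nn_integral_fst[OF sigma_finite_measures] by fastforce
      then show "(\<lambda>y. ennreal ((1 + \<theta>) powr (- b j)) * (\<integral>\<^sup>+x. f (y(j := x / (1 + \<theta>))) \<partial>gamma_dist (b j)))
          \<in> borel_measurable (\<Pi>\<^sub>M i\<in>J. borel)"
        using sets_eq[of J] by (simp cong: measurable_cong_sets)
    qed
    also have "\<dots> = ennreal (?P J) * (ennreal ((1 + \<theta>) powr (- b j)) * (\<integral>\<^sup>+y.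
        (\<integral>\<^sup>+x. f ((\<lambda>i\<in>J. y i / (1 + \<theta>))(j := x / (1 + \<theta>))) \<partial>gamma_dist (b j)) \<partial>?G J))"
    proof (subst nn_integral_cmult)
      have "(\<lambda>p. f ((\<lambda>i\<in>J. fst p i / (1 + \<theta>))(j := snd p / (1 + \<theta>)))) \<in> borel_measurable (?G J \<Otimes>\<^sub>M gamma_dist (b j))"
      proof -
        have "(\<lambda>p. (\<lambda>i\<in>J. fst p i / (1 + \<theta>), snd p / (1 + \<theta>))) \<in> ?G J \<Otimes>\<^sub>M gamma_dist (b j) \<rightarrow>\<^sub>M ?G J \<Otimes>\<^sub>M borel"
          by (intro measurable_Pair measurable_restrict)
            (auto intro!: borel_measurable_divide measurable_compose[OF measurable_fst measurable_component_singleton])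
        from measurable_compose[OF this fp] show ?thesis by simp
      qed
      then show "(\<lambda>y. \<integral>\<^sup>+x. f ((\<lambda>i\<in>J. y i / (1 + \<theta>))(j := x / (1 + \<theta>))) \<partial>gamma_dist (b j)) \<in> borel_measurable (?G J)"
        using sigma_finite_measure.borel_measurable_nn_integral_fst[OF sigma_finite_measures] by fastforce
    qed (simp add: mult.assoc)
    also have "(\<integral>\<^sup>+y. (\<integral>\<^sup>+x. f ((\<lambda>i\<in>J. y i / (1 + \<theta>))(j := x / (1 + \<theta>))) \<partial>gamma_dist (b j)) \<partial>?G J)
      = (\<integral>\<^sup>+y. \<integral>\<^sup>+x. f (\<lambda>i\<in>insert j J. (y(j := x)) i / (1 + \<theta>)) \<partial>gamma_dist (b j) \<partial>?G J)"
    proof -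
      have "(\<lambda>i\<in>J. y i / (1 + \<theta>))(j := x / (1 + \<theta>)) = (\<lambda>i\<in>insert j J. (y(j := x)) i / (1 + \<theta>))" for x y
        using insert.hyps by (auto simp: fun_eq_iff restrict_def)
      then show ?thesis by simp
    qed
    also have "\<dots> = (\<integral>\<^sup>+y. f (\<lambda>i\<in>insert j J. y i / (1 + \<theta>)) \<partial>?G (insert j J))"
      using insert.hyps measurable_compose[OF sc fm]
      by (intro product_nn_integral_insert[symmetric]) auto
    also have "ennreal (?P J) * (ennreal ((1 + \<theta>) powr (- b j)) * X) = ennreal (?P (insert j J)) * X" for X
      using insert.hyps by (simp add: mult.assoc[symmetric] ennreal_mult[symmetric] powr_add[symmetric] add.commute)
    finally show ?case .
  qed
  note main = this[OF assms(1) assms(4)]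
  have "(\<Pi>\<^sub>M i\<in>I. gamma_dist (a i)) = (\<Pi>\<^sub>M i\<in>I. gamma_dist (b i))"
    by (intro PiM_cong) (auto simp: b_def)
  moreover have "(\<Sum>i\<in>I. a i) = (\<Sum>i\<in>I. b i)"
    by (intro sum.cong) (auto simp: b_def)
  ultimately show ?thesis using main by simp
qed

section \<open>Normalized gamma vectors\<close>

lemma tendsto_powr_difference_quotient:
  fixes p s :: real
  shows "((\<lambda>h. ((1 + h) powr p - 1) / h) \<longlongrightarrow> p) (at 0)"
proof -
  have "((\<lambda>x. x powr p) has_real_derivative p * 1 powr (p - 1)) (at 1)"
    by (intro has_real_derivative_powr) auto
  then show ?thesis
    by (simp add: DERIV_def)
qed

text \<open>
  The quotient is the product of the factors \<open>a / (a + j)\<close> for \<open>j < m\<close>, each of which falls short of \<open>1\<close> by at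
  most \<open>j / a\<close>. The crude bound \<open>2 ^ m\<close> for the sum of these \<open>j\<close> is convenient: in a power series it amounts to
  doubling the argument.
\<close>

lemma one_minus_power_div_pochhammer_le:
  fixes a :: real
  assumes a: "0 < a"
  shows "0 < pochhammer a m" "a ^ m / pochhammer a m \<le> 1" "1 - a ^ m / pochhammer a m \<le> 2 ^ m / a"
proof -
  have "0 < pochhammer a m \<and> a ^ m / pochhammer a m \<le> 1 \<and> 1 - a ^ m / pochhammer a m \<le> 2 ^ m / a"
  proof (induction m)
    case (Suc m)
    define r where "r = a ^ m / pochhammer a m"
    have r: "0 \<le> r" "r \<le> 1" "1 - r \<le> 2 ^ m / a"
      using Suc a unfolding r_def by auto
    have eq: "a ^ Suc m / pochhammer a (Suc m) = r * (a / (a + m))"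
      by (simp add: pochhammer_rec' r_def mult_ac)
    have q: "0 \<le> a / (a + m)" "a / (a + m) \<le> 1" "1 - a / (a + m) \<le> m / a"
      using a by (auto simp: field_simps)
    have "1 - r * (a / (a + m)) = (1 - r) + r * (1 - a / (a + m))"
      by (simp add: algebra_simps)
    also have "\<dots> \<le> 2 ^ m / a + 1 * (m / a)"
      using r q a by (intro add_mono mult_mono) auto
    also have "\<dots> = 2 ^ m / a + m / a" by simp
    also have "\<dots> \<le> 2 ^ m / a + 2 ^ m / a"
      using a of_nat_less_two_power[of m, where 'a = real] by (intro add_mono divide_right_mono) auto
    finally have "1 - r * (a / (a + m)) \<le> 2 ^ Suc m / a" by simp
    moreover have "r * (a / (a + m)) \<le> 1"
      using r q by (intro mult_le_one) auto
    moreover have "0 < pochhammer a (Suc m)"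
      using a by (rule pochhammer_pos)
    ultimately show ?case unfolding eq by blast
  qed (use a in auto)
  then show "0 < pochhammer a m" "a ^ m / pochhammer a m \<le> 1" "1 - a ^ m / pochhammer a m \<le> 2 ^ m / a"
    by auto
qed

lemma (in finite_measure) sums_integral_exp:
  fixes Y :: "'a \<Rightarrow> real"
  assumes [measurable]: "Y \<in> borel_measurable M" and i: "integrable M (\<lambda>x. exp \<bar>Y x\<bar>)"
  shows "(\<lambda>m. (\<integral>x. Y x ^ m \<partial>M) / fact m) sums (\<integral>x. exp (Y x) \<partial>M)"
    and "integrable M (\<lambda>x. Y x ^ m)"
proof -
  have part: "(\<Sum>m<n. \<bar>Y x\<bar> ^ m / fact m) \<le> exp \<bar>Y x\<bar>" for n x
    using sum_le_suminf[OF summable_exp[of "\<bar>Y x\<bar>"], of "{..<n}"]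
    by (simp add: exp_def divide_inverse_commute)
  have "\<bar>Y x\<bar> ^ m / fact m \<le> exp \<bar>Y x\<bar>" for m x
    using part[where n = "Suc m" and x = x] sum_nonneg[of "{..<m}" "\<lambda>m. \<bar>Y x\<bar> ^ m / fact m"] by simp
  then have im: "integrable M (\<lambda>x. Y x ^ m / fact m)" for m
    by (intro Bochner_Integration.integrable_bound[OF i]) (auto simp: power_abs)
  show "integrable M (\<lambda>x. Y x ^ m)" for m
    using integrable_mult_right[OF im[of m], of "fact m"] by simp
  have "(\<lambda>m. \<integral>x. Y x ^ m / fact m \<partial>M) sums (\<integral>x. (\<Sum>m. Y x ^ m / fact m) \<partial>M)"
  proof (rule sums_integral)
    show "AE x in M. summable (\<lambda>m. norm (Y x ^ m / fact m))"
    proof (rule AE_I2)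
      fix x
      show "summable (\<lambda>m. norm (Y x ^ m / fact m))"
        using summable_exp[of "\<bar>Y x\<bar>"] by (simp add: power_abs abs_mult divide_inverse_commute)
    qed
    show "summable (\<lambda>m. \<integral>x. norm (Y x ^ m / fact m) \<partial>M)"
    proof (rule summableI_nonneg_bounded)
      fix n
      have "(\<Sum>m<n. \<integral>x. norm (Y x ^ m / fact m) \<partial>M) = (\<integral>x. (\<Sum>m<n. norm (Y x ^ m / fact m)) \<partial>M)"
        by (intro Bochner_Integration.integral_sum[symmetric] integrable_norm im)
      also have "\<dots> \<le> (\<integral>x. exp \<bar>Y x\<bar> \<partial>M)"
      proof (rule integral_mono[OF _ i])
        show "integrable M (\<lambda>x. \<Sum>m<n. norm (Y x ^ m / fact m))"
          by (intro Bochner_Integration.integrable_sum integrable_norm im)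
      qed (use part in \<open>simp add: power_abs\<close>)
      finally show "(\<Sum>m<n. \<integral>x. norm (Y x ^ m / fact m) \<partial>M) \<le> (\<integral>x. exp \<bar>Y x\<bar> \<partial>M)" .
    qed simp
  qed (rule im)
  moreover have "(\<Sum>m. Y x ^ m / fact m) = exp (Y x)" for x
    by (simp add: exp_def divide_inverse_commute)
  ultimately show "(\<lambda>m. (\<integral>x. Y x ^ m \<partial>M) / fact m) sums (\<integral>x. exp (Y x) \<partial>M)"
    by simp
qed

locale gamma_vector =
  fixes k :: nat and a :: "nat \<Rightarrow> real"
  assumes a_nonneg: "\<And>i. i < k \<Longrightarrow> 0 \<le> a i" and a_pos: "0 < (\<Sum>i<k. a i)"
begin

definition "Gam = (\<Pi>\<^sub>M i\<in>{..<k}. gamma_dist (a i))"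
definition "tot = (\<Sum>i<k. a i)"

abbreviation S :: "(nat \<Rightarrow> real) \<Rightarrow> real" where "S y \<equiv> (\<Sum>i<k. y i)"

lemma tot_pos: "0 < tot" using a_pos by (simp add: tot_def)

lemma sets_Gam [measurable_cong, simp]: "sets Gam = sets (\<Pi>\<^sub>M i\<in>{..<k}. borel)"
  unfolding Gam_def by (intro sets_PiM_cong) auto

lemma prob_space_Gam: "prob_space Gam"
  unfolding Gam_def by (intro prob_space_PiM prob_space_gamma_dist a_nonneg) auto

lemma measurable_component_Gam: "i < k \<Longrightarrow> (\<lambda>y. y i) \<in> borel_measurable Gam"
  by simp

lemma measurable_linear_Gam [measurable]: "(\<lambda>y. \<Sum>i<k. c i * y i) \<in> borel_measurable Gam"
  using measurable_component_Gam by (intro borel_measurable_sum borel_measurable_times) auto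

lemma measurable_S [measurable]: "S \<in> borel_measurable Gam"
  using measurable_component_Gam by (intro borel_measurable_sum) auto

lemma AE_Gam_nonneg: "AE y in Gam. \<forall>i<k. 0 \<le> y i"
proof -
  have "AE y in Gam. 0 \<le> y i" if "i < k" for i
    unfolding Gam_def
    by (rule AE_PiM_component[of "{..<k}" "\<lambda>i. gamma_dist (a i)" i "\<lambda>x. 0 \<le> x"])
      (use that in \<open>auto intro: prob_space_gamma_dist a_nonneg AE_gamma_dist_nonneg\<close>)
  then show ?thesis by (simp add: AE_all_countable)
qed

text \<open>
  For \<open>F\<close> homogeneous of degree \<open>d\<close>, tilting gives \<open>E (exp (- \<theta> * S) * F) = (1 + \<theta>) powr (- (tot + d)) * E F\<close>, and
  the claim is the derivative of this identity at \<open>\<theta> = 0\<close>. Differentiation under the integral is replaced by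
  \<open>1 + x \<le> exp x\<close>, which yields the two inequalities as \<open>\<theta>\<close> tends to zero from either side.
\<close>

lemma nn_integral_total_mult_homogeneous:
  fixes F :: "(nat \<Rightarrow> real) \<Rightarrow> ennreal"
  assumes Fm[measurable]: "F \<in> borel_measurable Gam"
    and hom: "\<And>r y. 0 < r \<Longrightarrow> F (\<lambda>i\<in>{..<k}. y i / r) = ennreal (r powr (- real d)) * F y"
    and fin: "(\<integral>\<^sup>+y. F y \<partial>Gam) < \<infinity>"
  shows "(\<integral>\<^sup>+y. ennreal (S y) * F y \<partial>Gam) = ennreal (tot + d) * (\<integral>\<^sup>+y. F y \<partial>Gam)"
proof -
  define p where "p = tot + d"
  have p: "0 < p" using tot_pos by (simp add: p_def)
  define V where "V = enn2real (\<integral>\<^sup>+y. F y \<partial>Gam)"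
  have V: "(\<integral>\<^sup>+y. F y \<partial>Gam) = ennreal V" "0 \<le> V"
    using fin by (auto simp: V_def top.not_eq_extremum)
  have tilt: "(\<integral>\<^sup>+y. ennreal (exp (- \<theta> * S y)) * F y \<partial>Gam) = ennreal ((1 + \<theta>) powr (- p) * V)"
    if "-1 < \<theta>" for \<theta>
  proof -
    have "F \<in> borel_measurable (\<Pi>\<^sub>M i\<in>{..<k}. borel)"
      using Fm by (simp cong: measurable_cong_sets)
    then have "(\<integral>\<^sup>+y. ennreal (exp (- \<theta> * S y)) * F y \<partial>Gam)
        = ennreal ((1 + \<theta>) powr (- tot)) * (\<integral>\<^sup>+y. F (\<lambda>i\<in>{..<k}. y i / (1 + \<theta>)) \<partial>Gam)"
      unfolding Gam_def tot_def using that
      by (intro nn_integral_gamma_product_tilt) (auto simp: a_nonneg)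
    also have "(\<integral>\<^sup>+y. F (\<lambda>i\<in>{..<k}. y i / (1 + \<theta>)) \<partial>Gam) = ennreal ((1 + \<theta>) powr (- real d)) * ennreal V"
      using that by (simp add: hom nn_integral_cmult V(1))
    finally show ?thesis
      using V(2) by (simp add: ennreal_mult[symmetric] mult.assoc[symmetric] powr_add[symmetric] p_def)
  qed
  define I where "I = (\<integral>\<^sup>+y. ennreal (S y) * F y \<partial>Gam)"
  have AE_S: "AE y in Gam. 0 \<le> S y"
    using AE_Gam_nonneg by eventually_elim (auto intro: sum_nonneg)
  have up: "ennreal V + ennreal \<theta> * I \<le> ennreal ((1 - \<theta>) powr (- p) * V)" if th: "0 < \<theta>" "\<theta> < 1" for \<theta>
  proof -
    have "ennreal V + ennreal \<theta> * I = (\<integral>\<^sup>+y. F y + ennreal \<theta> * (ennreal (S y) * F y) \<partial>Gam)"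
      unfolding I_def V(1)[symmetric] by (subst nn_integral_add) (auto simp: nn_integral_cmult)
    also have "\<dots> \<le> (\<integral>\<^sup>+y. ennreal (exp (- (- \<theta>) * S y)) * F y \<partial>Gam)"
    proof (rule nn_integral_mono_AE, use AE_S in eventually_elim)
      fix y assume "0 \<le> S y"
      then have "F y + ennreal \<theta> * (ennreal (S y) * F y) = ennreal (1 + \<theta> * S y) * F y"
        using th by (subst ennreal_plus) (auto simp: ennreal_mult distrib_right mult.assoc)
      also have "\<dots> \<le> ennreal (exp (- (- \<theta>) * S y)) * F y"
        using exp_ge_add_one_self[of "\<theta> * S y"] by (intro mult_right_mono ennreal_leI) auto
      finally show "F y + ennreal \<theta> * (ennreal (S y) * F y) \<le> ennreal (exp (- (- \<theta>) * S y)) * F y" .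
    qed
    also have "\<dots> = ennreal ((1 - \<theta>) powr (- p) * V)"
      using tilt[of "- \<theta>"] th by simp
    finally show ?thesis .
  qed
  have low: "ennreal V \<le> ennreal ((1 + \<theta>) powr (- p) * V) + ennreal \<theta> * I" if th: "0 < \<theta>" for \<theta>
  proof -
    have "ennreal V \<le> (\<integral>\<^sup>+y. ennreal (exp (- \<theta> * S y)) * F y + ennreal \<theta> * (ennreal (S y) * F y) \<partial>Gam)"
      unfolding V(1)[symmetric]
    proof (rule nn_integral_mono_AE, use AE_S in eventually_elim)
      fix y assume "0 \<le> S y"
      then have "ennreal (exp (- \<theta> * S y)) * F y + ennreal \<theta> * (ennreal (S y) * F y)
          = ennreal (exp (- \<theta> * S y) + \<theta> * S y) * F y"
        using th by (subst ennreal_plus) (auto simp: ennreal_mult distrib_right mult.assoc)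
      moreover have "1 * F y \<le> ennreal (exp (- \<theta> * S y) + \<theta> * S y) * F y"
        using exp_ge_add_one_self[of "- \<theta> * S y"] by (intro mult_right_mono) auto
      ultimately show "F y \<le> ennreal (exp (- \<theta> * S y)) * F y + ennreal \<theta> * (ennreal (S y) * F y)"
        by simp
    qed
    also have "\<dots> = ennreal ((1 + \<theta>) powr (- p) * V) + ennreal \<theta> * I"
      using th tilt[of \<theta>] unfolding I_def by (subst nn_integral_add) (auto simp: nn_integral_cmult)
    finally show ?thesis .
  qed
  \<comment> \<open>finiteness of \<open>I\<close>, from the upper estimate at one fixed \<open>\<theta>\<close>\<close>
  have "ennreal (1/2) * I \<le> ennreal ((1 - 1/2) powr (- p) * V)"
    using up[of "1/2"] by (rule order_trans[rotated]) (auto intro: add_increasing)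
  then have "ennreal (1/2) * I < \<infinity>"
    by (rule order_le_less_trans) simp
  then have "I < \<infinity>"
    by (auto simp: ennreal_mult_less_top)
  then obtain J where J: "I = ennreal J" "0 \<le> J"
    by (cases I) auto
  have "J \<le> p * V"
  proof (rule tendsto_lowerbound)
    have "((\<lambda>h. ((1 + h) powr (- p) - 1) / h) \<longlongrightarrow> - p) (at_left 0)"
      using tendsto_powr_difference_quotient by (rule filterlim_mono) (auto intro: at_le)
    then show "((\<lambda>h. - (((1 + h) powr (- p) - 1) / h) * V) \<longlongrightarrow> p * V) (at_left 0)"
      by (intro tendsto_mult tendsto_const) (auto dest: tendsto_minus)
    have "\<forall>\<^sub>F h in at_left (0::real). h \<in> {-1<..<0}"
      by (rule eventually_at_leftI[of "-1"]) auto
    then show "\<forall>\<^sub>F h in at_left 0. J \<le> - (((1 + h) powr (- p) - 1) / h) * V"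
    proof eventually_elim
      case (elim h)
      have hJ: "0 \<le> (- h) * J"
        using elim J(2) by (intro mult_nonneg_nonneg) auto
      have "ennreal (V + (- h) * J) \<le> ennreal ((1 + h) powr (- p) * V)"
        using up[of "- h"] elim V(2) J ennreal_plus[OF V(2) hJ] ennreal_mult[of "- h" J] by simp
      then have "V + (- h) * J \<le> (1 + h) powr (- p) * V"
        using V(2) by (subst (asm) ennreal_le_iff) auto
      then show ?case using elim by (simp add: field_simps)
    qed
  qed simp
  moreover have "p * V \<le> J"
  proof (rule tendsto_upperbound)
    have "((\<lambda>h. ((1 + h) powr (- p) - 1) / h) \<longlongrightarrow> - p) (at_right 0)"
      using tendsto_powr_difference_quotient by (rule filterlim_mono) (auto intro: at_le)
    then show "((\<lambda>h. - (((1 + h) powr (- p) - 1) / h) * V) \<longlongrightarrow> p * V) (at_right 0)"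
      by (intro tendsto_mult tendsto_const) (auto dest: tendsto_minus)
    have "\<forall>\<^sub>F h in at_right (0::real). h \<in> {0<..<1}"
      by (rule eventually_at_rightI[of _ "1"]) auto
    then show "\<forall>\<^sub>F h in at_right 0. - (((1 + h) powr (- p) - 1) / h) * V \<le> J"
    proof eventually_elim
      case (elim h)
      then have "V \<le> (1 + h) powr (- p) * V + h * J"
        using low[of "h"] J V(2) by (simp add: ennreal_mult[symmetric] ennreal_plus[symmetric] del: ennreal_plus)
      then show ?case using elim by (simp add: field_simps)
    qed
  qed simp
  ultimately have "J = p * V" by simp
  then show ?thesis
    unfolding I_def[symmetric] J(1) V(1) using p V(2) by (simp add: ennreal_mult p_def)
qed

text \<open>
  Iterating the previous identity, since \<open>S ^ d * h\<close> is homogeneous of degree \<open>d\<close>. As \<open>pochhammer tot d\<close> is the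
  \<open>d\<close>-th moment of the total, this expresses the independence of the total and the normalized vector.
\<close>

lemma nn_integral_total_power_mult:
  fixes h :: "(nat \<Rightarrow> real) \<Rightarrow> ennreal"
  assumes hm[measurable]: "h \<in> borel_measurable Gam"
    and hom: "\<And>r y. 0 < r \<Longrightarrow> h (\<lambda>i\<in>{..<k}. y i / r) = h y"
    and fin: "(\<integral>\<^sup>+y. h y \<partial>Gam) < \<infinity>"
  shows "(\<integral>\<^sup>+y. ennreal (S y) ^ d * h y \<partial>Gam) = ennreal (pochhammer tot d) * (\<integral>\<^sup>+y. h y \<partial>Gam)"
proof (induction d)
  case (Suc d)
  have "(\<integral>\<^sup>+y. ennreal (S y) ^ Suc d * h y \<partial>Gam) = (\<integral>\<^sup>+y. ennreal (S y) * (ennreal (S y) ^ d * h y) \<partial>Gam)"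
    by (simp add: mult.assoc)
  also have "\<dots> = ennreal (tot + d) * (\<integral>\<^sup>+y. ennreal (S y) ^ d * h y \<partial>Gam)"
  proof (rule nn_integral_total_mult_homogeneous)
    show "(\<integral>\<^sup>+y. ennreal (S y) ^ d * h y \<partial>Gam) < \<infinity>"
      unfolding Suc using fin by (simp add: ennreal_mult_less_top)
    fix r :: real and y :: "nat \<Rightarrow> real" assume r: "0 < r"
    have "S (\<lambda>i\<in>{..<k}. y i / r) = (1 / r) * S y"
      by (simp add: sum_divide_distrib)
    then have "ennreal (S (\<lambda>i\<in>{..<k}. y i / r)) = ennreal (1 / r) * ennreal (S y)"
      using r ennreal_mult'[of "1 / r" "S y"] by simp
    then show "ennreal (S (\<lambda>i\<in>{..<k}. y i / r)) ^ d * h (\<lambda>i\<in>{..<k}. y i / r)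
        = ennreal (r powr (- real d)) * (ennreal (S y) ^ d * h y)"
      using r hom[OF r] by (simp add: power_mult_distrib ennreal_power powr_minus powr_realpow power_one_over
          inverse_eq_divide mult.assoc)
  qed measurable
  finally show ?case
    using tot_pos by (simp add: Suc pochhammer_rec' ennreal_mult pochhammer_nonneg mult.assoc)
qed simp

lemma integral_total_power_mult:
  fixes h :: "(nat \<Rightarrow> real) \<Rightarrow> real"
  assumes hm[measurable]: "h \<in> borel_measurable Gam"
    and hom: "\<And>r y. 0 < r \<Longrightarrow> h (\<lambda>i\<in>{..<k}. y i / r) = h y"
    and bd: "AE y in Gam. \<bar>h y\<bar> \<le> B"
  shows "integrable Gam (\<lambda>y. S y ^ d * h y)"
    and "(\<integral>y. S y ^ d * h y \<partial>Gam) = pochhammer tot d * (\<integral>y. h y \<partial>Gam)"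
proof -
  interpret G: prob_space Gam by (rule prob_space_Gam)
  have AE_S: "AE y in Gam. 0 \<le> S y"
    using AE_Gam_nonneg by eventually_elim (auto intro: sum_nonneg)
  have p: "0 \<le> pochhammer tot d" using tot_pos by (simp add: pochhammer_nonneg)
  have *: "has_bochner_integral Gam (\<lambda>y. S y ^ d * f y) (pochhammer tot d * (\<integral>y. f y \<partial>Gam))"
    if f[measurable]: "f \<in> borel_measurable Gam" and homf: "\<And>r y. 0 < r \<Longrightarrow> f (\<lambda>i\<in>{..<k}. y i / r) = f y"
      and bdf: "AE y in Gam. 0 \<le> f y \<and> f y \<le> 2 * B" for f
  proof (rule has_bochner_integral_nn_integral)
    have fi: "integrable Gam f"
      using bdf by (intro G.integrable_const_bound[where B = "2 * B"]) auto
    have f0: "AE y in Gam. 0 \<le> f y" using bdf by eventually_elim auto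
    have nn: "(\<integral>\<^sup>+y. ennreal (f y) \<partial>Gam) = ennreal (\<integral>y. f y \<partial>Gam)"
      by (rule nn_integral_eq_integral[OF fi f0])
    have "(\<integral>\<^sup>+y. ennreal (S y ^ d * f y) \<partial>Gam) = (\<integral>\<^sup>+y. ennreal (S y) ^ d * ennreal (f y) \<partial>Gam)"
      using AE_S f0 by (intro nn_integral_cong_AE, eventually_elim) (simp add: ennreal_mult ennreal_power)
    also have "\<dots> = ennreal (pochhammer tot d) * (\<integral>\<^sup>+y. ennreal (f y) \<partial>Gam)"
      using nn by (intro nn_integral_total_power_mult) (auto simp: homf)
    finally show "(\<integral>\<^sup>+y. ennreal (S y ^ d * f y) \<partial>Gam) = ennreal (pochhammer tot d * (\<integral>y. f y \<partial>Gam))"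
      using p integral_nonneg_AE[OF f0] by (simp add: nn ennreal_mult)
    show "AE y in Gam. 0 \<le> S y ^ d * f y"
      using AE_S f0 by eventually_elim simp
    show "0 \<le> pochhammer tot d * (\<integral>y. f y \<partial>Gam)"
      using p integral_nonneg_AE[OF f0] by simp
  qed measurable
  have B: "0 \<le> B"
  proof -
    from bd have "AE y in Gam. 0 \<le> B" by eventually_elim linarith
    then show ?thesis by simp
  qed
  have hi: "integrable Gam h"
    using bd by (intro G.integrable_const_bound[where B = B]) auto
  \<comment> \<open>constants are scale invariant, so \<open>h\<close> may be shifted to become nonnegative\<close>
  have "has_bochner_integral Gam (\<lambda>y. S y ^ d * (h y + B) - S y ^ d * B)
      (pochhammer tot d * (\<integral>y. h y + B \<partial>Gam) - pochhammer tot d * (\<integral>y. B \<partial>Gam))"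
    by (intro has_bochner_integral_diff *) (use bd B in \<open>auto simp: hom\<close>)
  moreover have "S y ^ d * (h y + B) - S y ^ d * B = S y ^ d * h y" for y
    by (simp add: algebra_simps)
  moreover have "pochhammer tot d * (\<integral>y. h y + B \<partial>Gam) - pochhammer tot d * (\<integral>y. B \<partial>Gam) = pochhammer tot d * (\<integral>y. h y \<partial>Gam)"
    using hi by (simp add: algebra_simps)
  ultimately have "has_bochner_integral Gam (\<lambda>y. S y ^ d * h y) (pochhammer tot d * (\<integral>y. h y \<partial>Gam))"
    by simp
  then show "integrable Gam (\<lambda>y. S y ^ d * h y)"
    and "(\<integral>y. S y ^ d * h y \<partial>Gam) = pochhammer tot d * (\<integral>y. h y \<partial>Gam)"
    by (auto simp: has_bochner_integral_iff)
qed

lemma has_bochner_integral_exp_linear: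
  assumes c: "\<And>i. i < k \<Longrightarrow> c i < 1"
  shows "has_bochner_integral Gam (\<lambda>y. exp (\<Sum>i<k. c i * y i)) (\<Prod>i<k. (1 - c i) powr (- a i))"
proof (rule has_bochner_integral_nn_integral)
  define b where "b i = (if i < k then a i else 0)" for i
  interpret product_sigma_finite "\<lambda>i. gamma_dist (b i)"
    by (intro product_sigma_finite.intro prob_space_imp_sigma_finite prob_space_gamma_dist) (simp add: b_def a_nonneg)
  have Gam: "Gam = (\<Pi>\<^sub>M i\<in>{..<k}. gamma_dist (b i))"
    unfolding Gam_def by (intro PiM_cong) (auto simp: b_def)
  have "(\<integral>\<^sup>+y. ennreal (exp (\<Sum>i<k. c i * y i)) \<partial>Gam) = (\<integral>\<^sup>+y. (\<Prod>i<k. ennreal (exp (c i * y i))) \<partial>Gam)"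
    by (simp add: exp_sum prod_ennreal)
  also have "\<dots> = (\<Prod>i<k. \<integral>\<^sup>+x. ennreal (exp (c i * x)) \<partial>gamma_dist (b i))"
    unfolding Gam by (rule product_nn_integral_prod) auto
  also have "\<dots> = (\<Prod>i<k. ennreal ((1 - c i) powr (- a i)))"
  proof (rule prod.cong[OF refl])
    fix i assume i: "i \<in> {..<k}"
    interpret g: prob_space "gamma_dist (a i)" using i by (intro prob_space_gamma_dist a_nonneg) simp
    have "(\<integral>\<^sup>+x. ennreal (exp (c i * x)) \<partial>gamma_dist (b i)) = (\<integral>\<^sup>+x. ennreal (exp (- (- c i) * x)) * 1 \<partial>gamma_dist (a i))"
      using i by (simp add: b_def)
    also have "\<dots> = ennreal ((1 + (- c i)) powr (- a i)) * (\<integral>\<^sup>+x. 1 \<partial>gamma_dist (a i))"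
      using i c[of i] by (intro nn_integral_gamma_dist_tilt a_nonneg) auto
    finally show "(\<integral>\<^sup>+x. ennreal (exp (c i * x)) \<partial>gamma_dist (b i)) = ennreal ((1 - c i) powr (- a i))"
      using g.emeasure_space_1 by simp
  qed
  also have "\<dots> = ennreal (\<Prod>i<k. (1 - c i) powr (- a i))"
    by (simp add: prod_ennreal)
  finally show "(\<integral>\<^sup>+y. ennreal (exp (\<Sum>i<k. c i * y i)) \<partial>Gam) = ennreal (\<Prod>i<k. (1 - c i) powr (- a i))" .
qed (auto intro!: prod_nonneg)

text \<open>
  With \<open>N\<close> the linear statistic of the gamma vector and \<open>X = N / S\<close> its normalized version, the \<open>m\<close>-th Taylor
  coefficients in \<open>u\<close> of \<open>E (exp (u * tot * X))\<close> and of \<open>\<Lambda> u = E (exp (u * N))\<close> have the quotient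
  \<open>tot ^ m / pochhammer tot m\<close>. The difference of the series is bounded by the series of \<open>E (exp (2 * \<bar>u * N\<bar>))\<close>
  divided by \<open>tot\<close>, and \<open>exp \<bar>x\<bar> \<le> exp x + exp (- x)\<close>.
\<close>

lemma abs_integral_exp_normalized_linear_minus_prod_le:
  fixes c :: "nat \<Rightarrow> real"
  defines "\<Lambda> \<equiv> \<lambda>v. \<Prod>i<k. (1 - v * c i) powr (- a i)"
  assumes c: "\<And>i. i < k \<Longrightarrow> 2 * \<bar>u * c i\<bar> < 1"
  shows "\<bar>(\<integral>y. exp (u * tot * (\<Sum>i<k. c i * (y i / S y))) \<partial>Gam) - \<Lambda> u\<bar> \<le> (\<Lambda> (2 * u) + \<Lambda> (- 2 * u)) / tot"
proof -
  interpret G: prob_space Gam by (rule prob_space_Gam)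
  define X where "X y = (\<Sum>i<k. c i * (y i / S y))" for y
  define N where "N y = (\<Sum>i<k. c i * y i)" for y
  define K where "K = (\<Sum>i<k. \<bar>c i\<bar>)"
  have [measurable]: "X \<in> borel_measurable Gam" "N \<in> borel_measurable Gam"
    unfolding X_def N_def using measurable_component_Gam
    by (auto intro!: borel_measurable_sum borel_measurable_times borel_measurable_divide)
  have XK: "AE y in Gam. \<bar>X y\<bar> \<le> K"
    using AE_Gam_nonneg
  proof eventually_elim
    case (elim y)
    have "\<bar>y i / S y\<bar> \<le> 1" if "i < k" for i
    proof -
      have "0 \<le> y i" "y i \<le> S y"
        using elim that by (auto intro: member_le_sum)
      then show ?thesis by (auto simp: divide_le_eq_1 less_le)
    qed
    then have "\<bar>c i * (y i / S y)\<bar> \<le> \<bar>c i\<bar>" if "i < k" for i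
      using that mult_left_mono[of "\<bar>y i / S y\<bar>" 1 "\<bar>c i\<bar>"] by (simp only: abs_mult) auto
    then show ?case
      unfolding X_def K_def by (intro order_trans[OF sum_abs] sum_mono) auto
  qed
  \<comment> \<open>where the total vanishes so do all coordinates, and \<open>N = 0 = S * X\<close> by the convention \<open>x / 0 = 0\<close>\<close>
  have NX: "AE y in Gam. N y ^ m = S y ^ m * X y ^ m" for m
    using AE_Gam_nonneg
  proof eventually_elim
    case (elim y)
    have "N y = S y * X y"
    proof (cases "S y = 0")
      case True
      then have "\<forall>i\<in>{..<k}. y i = 0"
        using elim by (subst (asm) sum_nonneg_eq_0_iff) auto
      then have "N y = 0"
        unfolding N_def by (intro sum.neutral) auto
      with True show ?thesis by simp
    next
      case False
      then show ?thesis by (simp add: N_def X_def sum_distrib_left)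
    qed
    then show ?case by (simp add: power_mult_distrib)
  qed
  have EN: "(\<integral>y. N y ^ m \<partial>Gam) = pochhammer tot m * (\<integral>y. X y ^ m \<partial>Gam)" for m
  proof -
    have "(\<integral>y. N y ^ m \<partial>Gam) = (\<integral>y. S y ^ m * X y ^ m \<partial>Gam)"
      using NX by (intro integral_cong_AE) auto
    also have "\<dots> = pochhammer tot m * (\<integral>y. X y ^ m \<partial>Gam)"
    proof (rule integral_total_power_mult(2))
      show "AE y in Gam. \<bar>X y ^ m\<bar> \<le> K ^ m"
        using XK by eventually_elim (simp add: power_abs power_mono)
      fix r :: real and y :: "nat \<Rightarrow> real" assume r: "0 < r"
      have "S (\<lambda>i\<in>{..<k}. y i / r) = S y / r"
        by (simp add: sum_divide_distrib)
      then have "X (\<lambda>i\<in>{..<k}. y i / r) = X y"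
        unfolding X_def using r by (intro sum.cong) auto
      then show "X (\<lambda>i\<in>{..<k}. y i / r) ^ m = X y ^ m" by simp
    qed measurable
    finally show ?thesis .
  qed
  have int: "has_bochner_integral Gam (\<lambda>y. exp (v * N y)) (\<Lambda> v)" if "\<bar>v\<bar> \<le> 2 * \<bar>u\<bar>" for v
  proof -
    have "v * c i < 1" if "i < k" for i
    proof -
      have "v * c i \<le> \<bar>v\<bar> * \<bar>c i\<bar>"
        by (metis abs_ge_self abs_mult)
      also have "\<dots> \<le> 2 * \<bar>u\<bar> * \<bar>c i\<bar>"
        using \<open>\<bar>v\<bar> \<le> 2 * \<bar>u\<bar>\<close> by (intro mult_right_mono) auto
      also have "\<dots> < 1" using c[OF that] by (simp add: abs_mult)
      finally show ?thesis .
    qed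
    then have "has_bochner_integral Gam (\<lambda>y. exp (\<Sum>i<k. v * c i * y i)) (\<Prod>i<k. (1 - v * c i) powr (- a i))"
      by (rule has_bochner_integral_exp_linear)
    then show ?thesis by (simp add: N_def \<Lambda>_def sum_distrib_left mult.assoc)
  qed
  have abs_le: "exp \<bar>x\<bar> \<le> exp x + exp (- x)" for x :: real
    by (cases "0 \<le> x") auto
  have i2: "integrable Gam (\<lambda>y. exp (2 * u * N y))" "integrable Gam (\<lambda>y. exp (- 2 * u * N y))"
    using int[of "2 * u"] int[of "- 2 * u"] by (auto simp: has_bochner_integral_iff)
  have iabs2: "integrable Gam (\<lambda>y. exp \<bar>2 * \<bar>u * N y\<bar>\<bar>)"
  proof (rule Bochner_Integration.integrable_bound[OF Bochner_Integration.integrable_add[OF i2]])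
    have "exp (2 * \<bar>u * N y\<bar>) \<le> exp (2 * u * N y) + exp (- 2 * u * N y)" for y
      using abs_le[of "2 * u * N y"] by (simp add: abs_mult mult.assoc)
    then show "AE y in Gam. norm (exp \<bar>2 * \<bar>u * N y\<bar>\<bar>) \<le> norm (exp (2 * u * N y) + exp (- 2 * u * N y))"
      by (intro AE_I2) (simp add: add_nonneg_nonneg)
  qed measurable
  have iabs: "integrable Gam (\<lambda>y. exp \<bar>u * N y\<bar>)"
    by (rule Bochner_Integration.integrable_bound[OF iabs2]) auto
  have iX: "integrable Gam (\<lambda>y. exp \<bar>u * tot * X y\<bar>)"
  proof (rule G.integrable_const_bound[where B = "exp (\<bar>u * tot\<bar> * K)"])
    show "AE y in Gam. norm (exp \<bar>u * tot * X y\<bar>) \<le> exp (\<bar>u * tot\<bar> * K)"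
      using XK by eventually_elim (auto simp: abs_mult intro!: mult_left_mono)
  qed measurable
  define A where "A m = (\<integral>y. (u * tot * X y) ^ m \<partial>Gam) / fact m" for m
  define B where "B m = (\<integral>y. (u * N y) ^ m \<partial>Gam) / fact m" for m
  define D where "D m = (\<integral>y. (2 * \<bar>u * N y\<bar>) ^ m \<partial>Gam) / fact m" for m
  have sA: "A sums (\<integral>y. exp (u * tot * X y) \<partial>Gam)"
    unfolding A_def by (rule G.sums_integral_exp[OF _ iX]) measurable
  have sB: "B sums \<Lambda> u"
    using G.sums_integral_exp(1)[OF _ iabs] int[of u] unfolding B_def by (auto simp: has_bochner_integral_iff)
  have sD: "D sums (\<integral>y. exp (2 * \<bar>u * N y\<bar>) \<partial>Gam)"
    unfolding D_def by (rule G.sums_integral_exp[OF _ iabs2]) measurable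
  \<comment> \<open>the factor \<open>2 ^ m\<close> of the Pochhammer estimate turns \<open>\<bar>u * N\<bar> ^ m\<close> into \<open>(2 * \<bar>u * N\<bar>) ^ m\<close>\<close>
  have term_bound: "\<bar>A m - B m\<bar> \<le> D m / tot" for m
  proof -
    define q where "q = tot ^ m / pochhammer tot m"
    note q = one_minus_power_div_pochhammer_le[OF tot_pos, of m, folded q_def]
    have "A m = q * B m"
      unfolding A_def B_def power_mult_distrib using EN[of m] q(1) by (simp add: q_def power_mult_distrib)
    then have "\<bar>A m - B m\<bar> = \<bar>1 - q\<bar> * \<bar>B m\<bar>"
      by (simp add: abs_mult[symmetric] algebra_simps abs_minus_commute)
    also have "\<dots> \<le> 2 ^ m / tot * ((\<integral>y. \<bar>u * N y\<bar> ^ m \<partial>Gam) / fact m)"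
    proof (intro mult_mono)
      have "\<bar>\<integral>y. (u * N y) ^ m \<partial>Gam\<bar> \<le> (\<integral>y. \<bar>u * N y\<bar> ^ m \<partial>Gam)"
        using integral_abs_bound[of Gam "\<lambda>y. (u * N y) ^ m"] by (simp only: power_abs)
      then show "\<bar>B m\<bar> \<le> (\<integral>y. \<bar>u * N y\<bar> ^ m \<partial>Gam) / fact m"
        unfolding B_def by (simp add: divide_right_mono)
    qed (use q tot_pos in auto)
    also have "\<dots> = D m / tot"
      by (simp add: D_def power_mult_distrib)
    finally show ?thesis .
  qed
  have "(\<lambda>m. A m - B m) sums ((\<integral>y. exp (u * tot * X y) \<partial>Gam) - \<Lambda> u)"
    using sA sB by (rule sums_diff)
  moreover have sD': "(\<lambda>m. D m / tot) sums ((\<integral>y. exp (2 * \<bar>u * N y\<bar>) \<partial>Gam) / tot)"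
    using sD by (rule sums_divide)
  moreover have "norm (\<Sum>m. A m - B m) \<le> (\<Sum>m. D m / tot)"
    using term_bound sD' by (intro norm_suminf_le) (auto simp: sums_iff)
  ultimately have "\<bar>(\<integral>y. exp (u * tot * X y) \<partial>Gam) - \<Lambda> u\<bar> \<le> (\<integral>y. exp (2 * \<bar>u * N y\<bar>) \<partial>Gam) / tot"
    by (simp add: sums_iff)
  also have "(\<integral>y. exp (2 * \<bar>u * N y\<bar>) \<partial>Gam) \<le> (\<integral>y. exp (2 * u * N y) + exp (- 2 * u * N y) \<partial>Gam)"
  proof (rule integral_mono)
    fix y
    show "exp (2 * \<bar>u * N y\<bar>) \<le> exp (2 * u * N y) + exp (- 2 * u * N y)"
      using abs_le[of "2 * u * N y"] by (simp add: abs_mult mult.assoc)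
  qed (use iabs2 i2 in auto)
  also have "\<dots> = \<Lambda> (2 * u) + \<Lambda> (- 2 * u)"
    using int[of "2 * u"] int[of "- 2 * u"] i2 by (auto simp: has_bochner_integral_iff)
  finally show ?thesis
    using tot_pos unfolding X_def by (simp add: divide_right_mono mult.assoc)
qed

lemma nn_integral_component:
  assumes i: "i < k"
  shows "(\<integral>\<^sup>+y. ennreal (y i) \<partial>Gam) = ennreal (a i)"
proof -
  define b where "b i = (if i < k then a i else 0)" for i
  interpret product_sigma_finite "\<lambda>i. gamma_dist (b i)"
    by (intro product_sigma_finite.intro prob_space_imp_sigma_finite prob_space_gamma_dist) (simp add: b_def a_nonneg)
  have Gam: "Gam = (\<Pi>\<^sub>M i\<in>{..<k}. gamma_dist (b i))"
    unfolding Gam_def by (intro PiM_cong) (auto simp: b_def)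
  have one: "(\<integral>\<^sup>+x. 1 \<partial>gamma_dist (b j)) = 1" for j
    using prob_space.emeasure_space_1[OF prob_space_gamma_dist[of "b j"]] by (simp add: b_def a_nonneg)
  have mean: "(\<integral>\<^sup>+x. ennreal x \<partial>gamma_dist (a i)) = ennreal (a i)"
  proof (cases "a i = 0")
    case True
    then show ?thesis by (simp add: gamma_dist_def nn_integral_return)
  next
    case False
    then have ai: "0 < a i" using a_nonneg[OF i] by simp
    \<comment> \<open>the mean of a single gamma variable is the first moment of the total of a vector of length one\<close>
    interpret one: gamma_vector "Suc 0" "\<lambda>_. a i"
      using ai by unfold_locales auto
    interpret one': prob_space one.Gam by (rule one.prob_space_Gam)
    have eq: "one.Gam = PiM {0} (\<lambda>_. gamma_dist (a i))"
    proof -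
      have "{..<Suc 0} = {0}" by auto
      then show ?thesis by (simp only: one.Gam_def)
    qed
    interpret ps: product_sigma_finite "\<lambda>_::nat. gamma_dist (a i)"
      by (intro product_sigma_finite.intro prob_space_imp_sigma_finite prob_space_gamma_dist) (simp add: ai less_imp_le)
    have total: "(\<integral>\<^sup>+y. 1 \<partial>one.Gam) = 1"
      using one'.emeasure_space_1 by simp
    have "(\<integral>\<^sup>+y. ennreal (\<Sum>i<Suc 0. y i) ^ 1 * 1 \<partial>one.Gam) = ennreal (pochhammer one.tot 1) * (\<integral>\<^sup>+y. 1 \<partial>one.Gam)"
      by (rule one.nn_integral_total_power_mult) (simp_all only: total, simp_all)
    then have "(\<integral>\<^sup>+y. ennreal (y 0) \<partial>one.Gam) = ennreal (a i)"
      by (simp add: one.tot_def total del: nn_integral_const)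
    then show ?thesis
      unfolding eq using ps.product_nn_integral_singleton[of ennreal 0] by simp
  qed
  have "(\<integral>\<^sup>+y. ennreal (y i) \<partial>Gam) = (\<integral>\<^sup>+y. (\<Prod>j<k. (if j = i then ennreal (y j) else 1)) \<partial>Gam)"
    using i by (simp add: prod.delta)
  also have "\<dots> = (\<Prod>j<k. \<integral>\<^sup>+x. (if j = i then ennreal x else 1) \<partial>gamma_dist (b j))"
    unfolding Gam by (rule product_nn_integral_prod) auto
  also have "\<dots> = (\<Prod>j<k. if j = i then ennreal (a i) else 1)"
  proof (rule prod.cong[OF refl])
    fix j assume "j \<in> {..<k}"
    show "(\<integral>\<^sup>+x. (if j = i then ennreal x else 1) \<partial>gamma_dist (b j)) = (if j = i then ennreal (a i) else 1)"
      using mean i one[of j] by (cases "j = i") (simp_all add: b_def)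
  qed
  also have "\<dots> = ennreal (a i)"
    using i by (simp add: prod.delta)
  finally show ?thesis .
qed

text \<open>
  The moment identity for the total, applied to the scale invariant function \<open>y i / S y\<close>.
\<close>

lemma integral_normalized_component:
  assumes i: "i < k"
  shows "(\<integral>y. y i / S y \<partial>Gam) = a i / tot"
proof -
  have ae: "AE y in Gam. 0 \<le> y i \<and> y i \<le> S y"
    using AE_Gam_nonneg by eventually_elim (use i in \<open>auto intro!: member_le_sum\<close>)
  have [measurable]: "(\<lambda>y. y i) \<in> borel_measurable Gam"
    using i by (rule measurable_component_Gam)
  have "(\<integral>y. S y ^ 1 * (y i / S y) \<partial>Gam) = pochhammer tot 1 * (\<integral>y. y i / S y \<partial>Gam)"
  proof (rule integral_total_power_mult(2))
    show "AE y in Gam. \<bar>y i / S y\<bar> \<le> 1"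
      using ae by eventually_elim (auto simp: divide_le_eq_1 less_le)
    fix r :: real and y :: "nat \<Rightarrow> real" assume r: "0 < r"
    have "S (\<lambda>i\<in>{..<k}. y i / r) = S y / r"
      by (simp add: sum_divide_distrib)
    then show "(\<lambda>i\<in>{..<k}. y i / r) i / S (\<lambda>i\<in>{..<k}. y i / r) = y i / S y"
      using r i by simp
  qed measurable
  moreover have "(\<integral>y. S y ^ 1 * (y i / S y) \<partial>Gam) = (\<integral>y. y i \<partial>Gam)"
  proof (rule integral_cong_AE)
    show "AE y in Gam. S y ^ 1 * (y i / S y) = y i"
      using ae by eventually_elim auto
  qed measurable
  moreover have "(\<integral>y. y i \<partial>Gam) = a i"
  proof -
    have "AE y in Gam. 0 \<le> y i" using ae by eventually_elim simp
    then show ?thesis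
      using nn_integral_component[OF i] a_nonneg[OF i] by (simp add: integral_eq_nn_integral)
  qed
  ultimately show ?thesis using tot_pos by (simp add: field_simps)
qed

end

section \<open>The Laplace transform of a Dirichlet process\<close>

text \<open>
  Jensen's inequality. A non-integrable \<open>h\<close> is admitted: its Bochner integral is zero, and the right-hand side is
  at least one.
\<close>

lemma exp_integral_le_nn_integral_exp:
  fixes h :: "'a \<Rightarrow> real"
  assumes "prob_space P" and [measurable]: "h \<in> borel_measurable P" and r: "0 \<le> r"
  shows "ennreal (exp (r * \<bar>\<integral>x. h x \<partial>P\<bar>)) \<le> (\<integral>\<^sup>+x. ennreal (exp (r * \<bar>h x\<bar>)) \<partial>P)"
proof -
  interpret prob_space P by fact
  show ?thesis
  proof (cases "integrable P (\<lambda>x. exp (r * \<bar>h x\<bar>))")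
    case False
    then have "(\<integral>\<^sup>+x. ennreal (exp (r * \<bar>h x\<bar>)) \<partial>P) = \<infinity>"
      by (intro nn_integral_nonneg_infinite) auto
    then show ?thesis by simp
  next
    case ei: True
    then have eq: "(\<integral>\<^sup>+x. ennreal (exp (r * \<bar>h x\<bar>)) \<partial>P) = ennreal (\<integral>x. exp (r * \<bar>h x\<bar>) \<partial>P)"
      by (intro nn_integral_eq_integral) auto
    show ?thesis
    proof (cases "integrable P h")
      case False
      have "(\<integral>x. 1 \<partial>P) \<le> (\<integral>x. exp (r * \<bar>h x\<bar>) \<partial>P)"
        using ei r by (intro integral_mono) auto
      then show ?thesis
        using False eq by (simp add: not_integrable_integral_eq prob_space)
    next
      case True
      define m where "m = r * (\<integral>x. \<bar>h x\<bar> \<partial>P)"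
      have "exp m = (\<integral>x. exp m * (1 + (r * \<bar>h x\<bar> - m)) \<partial>P)"
        using True by (simp add: prob_space m_def)
      also have "\<dots> \<le> (\<integral>x. exp (r * \<bar>h x\<bar>) \<partial>P)"
      proof (rule integral_mono[OF _ ei])
        fix x
        have "exp m * (1 + (r * \<bar>h x\<bar> - m)) \<le> exp m * exp (r * \<bar>h x\<bar> - m)"
          by (intro mult_left_mono exp_ge_add_one_self) auto
        then show "exp m * (1 + (r * \<bar>h x\<bar> - m)) \<le> exp (r * \<bar>h x\<bar>)"
          by (simp add: exp_diff)
      qed (use True in auto)
      finally have "exp m \<le> (\<integral>x. exp (r * \<bar>h x\<bar>) \<partial>P)" .
      moreover have "r * \<bar>\<integral>x. h x \<partial>P\<bar> \<le> m"
        unfolding m_def using r by (intro mult_left_mono) auto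
      then have "exp (r * \<bar>\<integral>x. h x \<partial>P\<bar>) \<le> exp m" by simp
      ultimately show ?thesis
        unfolding eq by (intro ennreal_leI) linarith
    qed
  qed
qed

lemma integral_finite_partition:
  fixes f :: "real \<Rightarrow> real" and k :: nat
  assumes Q: "finite_measure Q" and c: "inj_on c {..<k}" "c ` {..<k} = g ` space Q"
    and A: "\<And>i. A i = g -` {c i} \<inter> space Q" "\<And>i. i < k \<Longrightarrow> A i \<in> sets Q"
  shows "(\<integral>x. f (g x) \<partial>Q) = (\<Sum>i<k. f (c i) * measure Q (A i))"
proof -
  interpret finite_measure Q by fact
  have "(\<integral>x. f (g x) \<partial>Q) = (\<integral>x. (\<Sum>i<k. f (c i) * indicator (A i) x) \<partial>Q)"
  proof (rule Bochner_Integration.integral_cong[OF refl])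
    fix x assume x: "x \<in> space Q"
    then obtain j where j: "j < k" "g x = c j"
      using c(2) by (metis imageE imageI lessThan_iff)
    have "(\<Sum>i<k. f (c i) * indicator (A i) x) = (\<Sum>i<k. if i = j then f (c i) else 0)"
      using x j c(1) by (intro sum.cong) (auto simp: A(1) indicator_def inj_on_def)
    then show "f (g x) = (\<Sum>i<k. f (c i) * indicator (A i) x)"
      using j by simp
  qed
  also have "\<dots> = (\<Sum>i<k. \<integral>x. f (c i) * indicator (A i) x \<partial>Q)"
    using A(2) by (intro Bochner_Integration.integral_sum integrable_mult_right integrable_real_indicator)
      (auto simp: emeasure_eq_measure)
  also have "\<dots> = (\<Sum>i<k. f (c i) * measure Q (A i))"
    using A(2) by (intro sum.cong) auto
  finally show ?thesis .
qed

text \<open>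
  The assumption on the mass only excludes \<open>\<alpha> = 0\<close>, for which normalization of the gamma vectors makes no sense.
\<close>

locale dirichlet_law =
  fixes \<alpha> :: "'a measure" and D :: "'a measure measure"
  assumes fin: "finite_measure \<alpha>" and DP: "is_dirichlet_process \<alpha> D"
    and mass_pos: "0 < measure \<alpha> (space \<alpha>)"
begin

sublocale base: finite_measure \<alpha> by (rule fin)
sublocale law: prob_space D using DP by (simp add: is_dirichlet_process_def)

definition "mass = measure \<alpha> (space \<alpha>)"

lemma mass_gt_0: "0 < mass" using mass_pos by (simp add: mass_def)

lemma sets_D: "sets D = sets (prob_algebra \<alpha>)"
  using DP by (simp add: is_dirichlet_process_def)

lemma space_D: "P \<in> space D \<longleftrightarrow> sets P = sets \<alpha> \<and> prob_space P"
  using sets_eq_imp_space_eq[OF sets_D] by (simp add: space_prob_algebra)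

lemma measurable_D: "f \<in> measurable (subprob_algebra \<alpha>) N \<Longrightarrow> f \<in> measurable D N"
  unfolding measurable_cong_sets[OF sets_D refl] prob_algebra_def by (rule measurable_restrict_space1)

lemma borel_measurable_integral_D:
  fixes f :: "'a \<Rightarrow> real"
  shows "f \<in> borel_measurable \<alpha> \<Longrightarrow> (\<lambda>P. \<integral>x. f x \<partial>P) \<in> borel_measurable D"
  by (intro measurable_D integral_measurable_subprob_algebra)

lemma borel_measurable_nn_integral_D:
  "f \<in> borel_measurable \<alpha> \<Longrightarrow> (\<lambda>P. \<integral>\<^sup>+x. f x \<partial>P) \<in> borel_measurable D"
  by (intro measurable_D nn_integral_measurable_subprob_algebra)

lemma integral_finite_partition_law:
  fixes \<phi> :: "(nat \<Rightarrow> real) \<Rightarrow> real"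
  assumes A: "\<And>i. i < k \<Longrightarrow> A i \<in> sets \<alpha>" "disjoint_family_on A {..<k}" "(\<Union>i<k. A i) = space \<alpha>"
    and \<phi>[measurable]: "\<phi> \<in> borel_measurable (\<Pi>\<^sub>M i\<in>{..<k}. borel)"
  shows "gamma_vector k (\<lambda>i. measure \<alpha> (A i))" and "gamma_vector.tot k (\<lambda>i. measure \<alpha> (A i)) = mass"
    and "(\<integral>P. \<phi> (\<lambda>i\<in>{..<k}. measure P (A i)) \<partial>D) =
      (\<integral>y. \<phi> (\<lambda>i\<in>{..<k}. y i / (\<Sum>j<k. y j)) \<partial>gamma_vector.Gam k (\<lambda>i. measure \<alpha> (A i)))"
proof -
  have sum: "(\<Sum>i<k. measure \<alpha> (A i)) = mass"
    unfolding mass_def A(3)[symmetric]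
    using A by (intro base.finite_measure_finite_Union[symmetric]) auto
  then show G: "gamma_vector k (\<lambda>i. measure \<alpha> (A i))"
    using mass_gt_0 by unfold_locales auto
  then interpret gamma_vector k "\<lambda>i. measure \<alpha> (A i)" .
  show "tot = mass" by (simp add: tot_def sum)
  have fidi: "distr D (PiM {..<k} (\<lambda>_. borel)) (\<lambda>P. \<lambda>i\<in>{..<k}. measure P (A i))
      = dirichlet_dist k (\<lambda>i. measure \<alpha> (A i))"
    using DP A unfolding is_dirichlet_process_def by blast
  have m1: "(\<lambda>P. \<lambda>i\<in>{..<k}. measure P (A i)) \<in> D \<rightarrow>\<^sub>M (\<Pi>\<^sub>M i\<in>{..<k}. borel)"
    using A(1) by (intro measurable_restrict measurable_D measurable_measure_subprob_algebra) auto
  have m2: "(\<lambda>y. \<lambda>i\<in>{..<k}. y i / (\<Sum>j<k. y j)) \<in> Gam \<rightarrow>\<^sub>M (\<Pi>\<^sub>M i\<in>{..<k}. borel)"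
    using measurable_component_Gam by (intro measurable_restrict borel_measurable_divide borel_measurable_sum) auto
  have "(\<integral>P. \<phi> (\<lambda>i\<in>{..<k}. measure P (A i)) \<partial>D) = (\<integral>w. \<phi> w \<partial>dirichlet_dist k (\<lambda>i. measure \<alpha> (A i)))"
    using integral_distr[OF m1 \<phi>] unfolding fidi by simp
  also have "\<dots> = (\<integral>y. \<phi> (\<lambda>i\<in>{..<k}. y i / (\<Sum>j<k. y j)) \<partial>Gam)"
    using integral_distr[OF m2 \<phi>] unfolding dirichlet_dist_def Gam_def by simp
  finally show "(\<integral>P. \<phi> (\<lambda>i\<in>{..<k}. measure P (A i)) \<partial>D) = (\<integral>y. \<phi> (\<lambda>i\<in>{..<k}. y i / (\<Sum>j<k. y j)) \<partial>Gam)" .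
qed

text \<open>
  The partition into \<open>A\<close> and its complement has a Dirichlet distribution with two parameters, whose mean is
  known from the gamma representation.
\<close>

lemma nn_integral_emeasure_D:
  assumes A: "A \<in> sets \<alpha>"
  shows "(\<integral>\<^sup>+P. emeasure P A \<partial>D) = ennreal (1 / mass) * emeasure \<alpha> A"
proof -
  define B where "B i = (if i = 0 then A else space \<alpha> - A)" for i :: nat
  have "(\<Union>i<2. B i) = space \<alpha>"
    using sets.sets_into_space[OF A] by (auto simp: B_def lessThan_nat_numeral)
  moreover have "disjoint_family_on B {..<2}"
    by (auto simp: B_def disjoint_family_on_def)
  moreover have "B i \<in> sets \<alpha>" for i
    using A by (auto simp: B_def)
  ultimately have B: "\<And>i. i < 2 \<Longrightarrow> B i \<in> sets \<alpha>" "disjoint_family_on B {..<2}" "(\<Union>i<2. B i) = space \<alpha>"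
    by auto
  have m: "(\<lambda>y. y 0) \<in> borel_measurable (\<Pi>\<^sub>M i\<in>{..<2::nat}. borel)"
    by simp
  note * = integral_finite_partition_law[OF B m]
  interpret gamma_vector 2 "\<lambda>i. measure \<alpha> (B i)" by (rule *(1))
  have "(\<integral>P. measure P A \<partial>D) = measure \<alpha> A / mass"
    using *(2,3) integral_normalized_component[of 0] by (simp add: B_def)
  moreover have "(\<lambda>P. measure P A) \<in> borel_measurable D"
    using A by (intro measurable_D measurable_measure_subprob_algebra)
  then have "integrable D (\<lambda>P. measure P A)"
    by (rule law.integrable_const_bound[where B = 1, rotated])
      (auto intro!: AE_I2 prob_space.prob_le_1 simp: space_D)
  then have "(\<integral>\<^sup>+P. ennreal (measure P A) \<partial>D) = ennreal (\<integral>P. measure P A \<partial>D)"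
    by (intro nn_integral_eq_integral) auto
  moreover have "(\<integral>\<^sup>+P. emeasure P A \<partial>D) = (\<integral>\<^sup>+P. ennreal (measure P A) \<partial>D)"
    by (intro nn_integral_cong finite_measure.emeasure_eq_measure) (auto simp: space_D prob_space_def)
  ultimately show ?thesis
    using mass_gt_0 by (simp add: base.emeasure_eq_measure ennreal_mult[symmetric])
qed

text \<open>
  The mean measure of the process, which is the join of \<open>D\<close> in the Giry monad, is the normalized base measure.
\<close>

lemma nn_integral_nn_integral_D:
  assumes f: "f \<in> borel_measurable \<alpha>"
  shows "(\<integral>\<^sup>+P. (\<integral>\<^sup>+x. f x \<partial>P) \<partial>D) = ennreal (1 / mass) * (\<integral>\<^sup>+x. f x \<partial>\<alpha>)"
proof -
  define D' where "D' = distr D (subprob_algebra \<alpha>) (\<lambda>P. P)"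
  have id: "(\<lambda>P. P) \<in> D \<rightarrow>\<^sub>M subprob_algebra \<alpha>"
    by (rule measurable_D) simp
  have sD': "sets D' = sets (subprob_algebra \<alpha>)"
    by (simp add: D'_def)
  have nn: "(\<integral>\<^sup>+P. \<phi> P \<partial>D') = (\<integral>\<^sup>+P. \<phi> P \<partial>D)" if "\<phi> \<in> borel_measurable (subprob_algebra \<alpha>)" for \<phi>
    unfolding D'_def using id that by (subst nn_integral_distr) auto
  have "join D' = scale_measure (ennreal (1 / mass)) \<alpha>"
  proof (rule measure_eqI)
    show "sets (join D') = sets (scale_measure (ennreal (1 / mass)) \<alpha>)"
      using sD' by simp
    fix A assume "A \<in> sets (join D')"
    then have A: "A \<in> sets \<alpha>"
      using sD' by simp
    show "emeasure (join D') A = emeasure (scale_measure (ennreal (1 / mass)) \<alpha>) A"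
      using A by (simp add: emeasure_join[OF sD'] nn nn_integral_emeasure_D)
  qed
  then have "(\<integral>\<^sup>+x. f x \<partial>join D') = ennreal (1 / mass) * (\<integral>\<^sup>+x. f x \<partial>\<alpha>)"
    using f by (simp add: nn_integral_scale_measure)
  then show ?thesis
    using f by (simp add: nn_integral_join[OF f sD'] nn)
qed

text \<open>
  The logarithm of the Laplace transform at \<open>v\<close> of the integral of \<open>g\<close> against a gamma process with base measure
  \<open>\<alpha>\<close>.
\<close>

definition log_laplace :: "('a \<Rightarrow> real) \<Rightarrow> real \<Rightarrow> real" where
  "log_laplace g v = - (\<integral>x. ln (1 - v * g x) \<partial>\<alpha>)"

text \<open>
  The level sets of \<open>g\<close> form a finite partition, on which the process has a Dirichlet distribution; the gamma
  product of the previous estimate is then \<open>exp (log_laplace g v)\<close>.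
\<close>

lemma laplace_simple:
  assumes g: "simple_function \<alpha> g" and K: "\<And>x. x \<in> space \<alpha> \<Longrightarrow> \<bar>g x\<bar> \<le> K"
    and s: "2 * \<bar>s\<bar> * K < mass"
  shows "\<bar>(\<integral>P. exp (s * (\<integral>x. g x \<partial>P)) \<partial>D) - exp (log_laplace g (s / mass))\<bar>
    \<le> (exp (log_laplace g (2 * s / mass)) + exp (log_laplace g (- 2 * s / mass))) / mass"
proof -
  have fin_range: "finite (g ` space \<alpha>)" using g by (rule simple_functionD)
  define k where "k = card (g ` space \<alpha>)"
  obtain c where "bij_betw c {..<k} (g ` space \<alpha>)"
    using ex_bij_betw_nat_finite[OF fin_range] unfolding k_def atLeast0LessThan by blast
  then have c: "inj_on c {..<k}" "c ` {..<k} = g ` space \<alpha>"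
    by (auto simp: bij_betw_def)
  define A where "A i = g -` {c i} \<inter> space \<alpha>" for i
  have A: "\<And>i. i < k \<Longrightarrow> A i \<in> sets \<alpha>" "disjoint_family_on A {..<k}" "(\<Union>i<k. A i) = space \<alpha>"
  proof -
    show "A i \<in> sets \<alpha>" if "i < k" for i
      unfolding A_def using g by (rule simple_functionD)
    show "disjoint_family_on A {..<k}"
      using c(1) by (auto simp: A_def disjoint_family_on_def inj_on_def)
    show "(\<Union>i<k. A i) = space \<alpha>"
    proof (intro set_eqI iffI)
      fix x assume "x \<in> space \<alpha>"
      then obtain j where "j < k" "g x = c j"
        using c(2) by (metis imageE imageI lessThan_iff)
      with \<open>x \<in> space \<alpha>\<close> show "x \<in> (\<Union>i<k. A i)" by (auto simp: A_def)
    qed (auto simp: A_def)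
  qed
  define \<phi> where "\<phi> y = exp (s * (\<Sum>i<k. c i * y i))" for y :: "nat \<Rightarrow> real"
  have \<phi>[measurable]: "\<phi> \<in> borel_measurable (\<Pi>\<^sub>M i\<in>{..<k}. borel)"
    unfolding \<phi>_def by measurable
  note law = integral_finite_partition_law[OF A \<phi>]
  interpret gamma_vector k "\<lambda>i. measure \<alpha> (A i)" by (rule law(1))
  have cK: "\<bar>c i\<bar> \<le> K" if "i < k" for i
  proof -
    have "c i \<in> g ` space \<alpha>" using c(2) that by blast
    then show ?thesis using K by auto
  qed
  have cs: "2 * \<bar>s / mass * c i\<bar> < 1" if "i < k" for i
  proof -
    have "2 * \<bar>s\<bar> * \<bar>c i\<bar> \<le> 2 * \<bar>s\<bar> * K"
      using cK[OF that] by (intro mult_left_mono) auto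
    then have "2 * \<bar>s\<bar> * \<bar>c i\<bar> < mass" using s by linarith
    then show ?thesis using mass_gt_0 by (simp add: abs_mult)
  qed
  have L: "exp (log_laplace g v) = (\<Prod>i<k. (1 - v * c i) powr (- measure \<alpha> (A i)))"
    if v: "\<And>i. i < k \<Longrightarrow> v * c i < 1" for v
  proof -
    have "(\<integral>x. ln (1 - v * g x) \<partial>\<alpha>) = (\<Sum>i<k. ln (1 - v * c i) * measure \<alpha> (A i))"
      using A(1) by (intro integral_finite_partition[where f = "\<lambda>y. ln (1 - v * y)", OF fin c A_def])
    then have "exp (log_laplace g v) = (\<Prod>i<k. exp (- (ln (1 - v * c i) * measure \<alpha> (A i))))"
      unfolding log_laplace_def by (simp add: exp_sum sum_negf[symmetric])
    also have "\<dots> = (\<Prod>i<k. (1 - v * c i) powr (- measure \<alpha> (A i)))"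
    proof (rule prod.cong[OF refl])
      fix i assume "i \<in> {..<k}"
      then have "v * c i < 1" using v by simp
      then show "exp (- (ln (1 - v * c i) * measure \<alpha> (A i))) = (1 - v * c i) powr (- measure \<alpha> (A i))"
        by (simp add: powr_def mult.commute)
    qed
    finally show ?thesis .
  qed
  have "(\<integral>P. exp (s * (\<integral>x. g x \<partial>P)) \<partial>D) = (\<integral>P. \<phi> (\<lambda>i\<in>{..<k}. measure P (A i)) \<partial>D)"
  proof (rule Bochner_Integration.integral_cong[OF refl])
    fix P assume P: "P \<in> space D"
    then have sP: "sets P = sets \<alpha>" "space P = space \<alpha>" and "prob_space P"
      by (auto simp: space_D dest: sets_eq_imp_space_eq)
    then have "(\<integral>x. g x \<partial>P) = (\<Sum>i<k. c i * measure P (A i))"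
      using A(1) c by (intro integral_finite_partition[where f = "\<lambda>y. y"]) (auto simp: A_def prob_space_def)
    then show "exp (s * (\<integral>x. g x \<partial>P)) = \<phi> (\<lambda>i\<in>{..<k}. measure P (A i))"
      by (simp add: \<phi>_def)
  qed
  also have "\<dots> = (\<integral>y. exp (s / mass * tot * (\<Sum>i<k. c i * (y i / S y))) \<partial>Gam)"
    using law(2,3) mass_gt_0 by (simp add: \<phi>_def)
  finally have E: "(\<integral>P. exp (s * (\<integral>x. g x \<partial>P)) \<partial>D) = (\<integral>y. exp (s / mass * tot * (\<Sum>i<k. c i * (y i / S y))) \<partial>Gam)" .
  have lt: "s / mass * c i < 1 \<and> 2 * s / mass * c i < 1 \<and> - 2 * s / mass * c i < 1" if "i < k" for i
    using cs[OF that] by (auto simp: abs_if split: if_splits)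
  have "\<bar>(\<integral>P. exp (s * (\<integral>x. g x \<partial>P)) \<partial>D) - (\<Prod>i<k. (1 - s / mass * c i) powr (- measure \<alpha> (A i)))\<bar>
    \<le> ((\<Prod>i<k. (1 - 2 * (s / mass) * c i) powr (- measure \<alpha> (A i)))
      + (\<Prod>i<k. (1 - (- 2 * (s / mass)) * c i) powr (- measure \<alpha> (A i)))) / tot"
    unfolding E using cs by (rule abs_integral_exp_normalized_linear_minus_prod_le)
  then show ?thesis
    using lt by (simp add: L law(2))
qed

lemma abs_integral_le_D:
  fixes g :: "'a \<Rightarrow> real" and K :: real
  assumes P: "P \<in> space D" and g: "\<And>x. x \<in> space \<alpha> \<Longrightarrow> \<bar>g x\<bar> \<le> K"
    and [measurable]: "g \<in> borel_measurable \<alpha>"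
  shows "integrable P g" "\<bar>\<integral>x. g x \<partial>P\<bar> \<le> K"
proof -
  have [measurable_cong]: "sets P = sets \<alpha>" and "space P = space \<alpha>" and "prob_space P"
    using P by (auto simp: space_D dest: sets_eq_imp_space_eq)
  interpret P: prob_space P by fact
  show i: "integrable P g"
    using g \<open>space P = space \<alpha>\<close> by (intro P.integrable_const_bound[where B = K]) auto
  have "\<bar>\<integral>x. g x \<partial>P\<bar> \<le> (\<integral>x. \<bar>g x\<bar> \<partial>P)"
    by (rule integral_abs_bound)
  also have "\<dots> \<le> (\<integral>x. K \<partial>P)"
    using i g \<open>space P = space \<alpha>\<close> by (intro integral_mono) auto
  finally show "\<bar>\<integral>x. g x \<partial>P\<bar> \<le> K"
    by (simp add: P.prob_space)
qed

lemma log_laplace_tendsto: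
  assumes F: "\<And>i. F i \<in> borel_measurable \<alpha>" "\<And>x. x \<in> space \<alpha> \<Longrightarrow> (\<lambda>i. F i x) \<longlonglongrightarrow> g x"
    and g[measurable]: "g \<in> borel_measurable \<alpha>"
    and bd: "\<And>i x. x \<in> space \<alpha> \<Longrightarrow> \<bar>F i x\<bar> \<le> K" and v: "2 * (\<bar>v\<bar> * K) \<le> 1"
  shows "(\<lambda>i. log_laplace (F i) v) \<longlonglongrightarrow> log_laplace g v"
  unfolding log_laplace_def
proof (intro tendsto_minus integral_dominated_convergence[where w = "\<lambda>_. ln 2"])
  note F(1)[measurable]
  have small: "\<bar>v * y\<bar> \<le> 1 / 2" if "\<bar>y\<bar> \<le> K" for y
    using mult_left_mono[OF that, of "\<bar>v\<bar>"] v by (simp add: abs_mult)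
  show "AE x in \<alpha>. (\<lambda>i. ln (1 - v * F i x)) \<longlonglongrightarrow> ln (1 - v * g x)"
  proof (rule AE_I2)
    fix x assume x: "x \<in> space \<alpha>"
    have "\<bar>g x\<bar> \<le> K"
      using tendsto_rabs[OF F(2)[OF x]] bd[OF x] by (intro LIMSEQ_le_const2) auto
    then have "1 - v * g x \<noteq> 0" using small[of "g x"] by (auto simp: abs_le_iff)
    then show "(\<lambda>i. ln (1 - v * F i x)) \<longlonglongrightarrow> ln (1 - v * g x)"
      by (intro tendsto_intros F(2) x) auto
  qed
  show "AE x in \<alpha>. norm (ln (1 - v * F i x)) \<le> ln 2" for i
  proof (rule AE_I2)
    fix x assume x: "x \<in> space \<alpha>"
    have s: "\<bar>v * F i x\<bar> \<le> 1 / 2" using small[OF bd[OF x]] .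
    then have r: "1 / 2 \<le> 1 - v * F i x" "1 - v * F i x \<le> 2" by (auto simp: abs_le_iff)
    have "ln (1 / 2) \<le> ln (1 - v * F i x)" "ln (1 - v * F i x) \<le> ln 2"
      using r by auto
    then show "norm (ln (1 - v * F i x)) \<le> ln 2"
      by (simp add: ln_div)
  qed
qed (use F(1) in measurable)

text \<open>
  Approximation by simple functions bounded by \<open>2 * \<bar>g\<bar>\<close>. The factor \<open>8\<close> pays for this \<open>2\<close>, for the doubled
  argument on the right-hand side, and for keeping \<open>1 - v * y\<close> at distance \<open>1 / 2\<close> from zero, which provides the
  bound needed for dominated convergence.
\<close>

lemma laplace_bounded:
  assumes g[measurable]: "g \<in> borel_measurable \<alpha>" and K: "\<And>x. x \<in> space \<alpha> \<Longrightarrow> \<bar>g x\<bar> \<le> K"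
    and s: "8 * (\<bar>s\<bar> * K) \<le> mass"
  shows "\<bar>(\<integral>P. exp (s * (\<integral>x. g x \<partial>P)) \<partial>D) - exp (log_laplace g (s / mass))\<bar>
    \<le> (exp (log_laplace g (2 * s / mass)) + exp (log_laplace g (- 2 * s / mass))) / mass"
proof -
  obtain F where F: "\<And>i. simple_function \<alpha> (F i)" "\<And>x. x \<in> space \<alpha> \<Longrightarrow> (\<lambda>i. F i x) \<longlonglongrightarrow> g x"
      "\<And>i x. x \<in> space \<alpha> \<Longrightarrow> norm (F i x) \<le> 2 * norm (g x)"
    using borel_measurable_implies_sequence_metric[OF g, of 0] unfolding norm_conv_dist by metis
  have Fm[measurable]: "F i \<in> borel_measurable \<alpha>" for i
    using F(1) by (rule borel_measurable_simple_function)
  have FK: "\<bar>F i x\<bar> \<le> 2 * K" if "x \<in> space \<alpha>" for i x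
    using F(3)[OF that, of i] K[OF that] by simp
  have "space \<alpha> \<noteq> {}" using mass_pos by (auto)
  then obtain x0 where "x0 \<in> space \<alpha>" by blast
  then have K0: "0 \<le> K" using K[of x0] by simp
  have scale: "2 * (\<bar>r * s / mass\<bar> * (2 * K)) \<le> 1" if "\<bar>r\<bar> \<le> 2" for r
  proof -
    have "4 * (\<bar>r\<bar> * (\<bar>s\<bar> * K)) \<le> 4 * (2 * (\<bar>s\<bar> * K))"
      using that K0 by (intro mult_left_mono mult_right_mono) auto
    also have "\<dots> \<le> mass" using s by simp
    finally show ?thesis
      using mass_gt_0 by (simp add: abs_mult field_simps)
  qed
  have tend: "(\<lambda>i. exp (log_laplace (F i) (r * s / mass))) \<longlonglongrightarrow> exp (log_laplace g (r * s / mass))"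
    if "\<bar>r\<bar> \<le> 2" for r
    by (intro tendsto_exp log_laplace_tendsto[where K = "2 * K"] F(2) Fm g FK scale[OF that])
  have tendE: "(\<lambda>i. \<integral>P. exp (s * (\<integral>x. F i x \<partial>P)) \<partial>D) \<longlonglongrightarrow> (\<integral>P. exp (s * (\<integral>x. g x \<partial>P)) \<partial>D)"
  proof (rule integral_dominated_convergence[where w = "\<lambda>_. exp (\<bar>s\<bar> * (2 * K))"])
    show "(\<lambda>P. exp (s * (\<integral>x. g x \<partial>P))) \<in> borel_measurable D"
      using borel_measurable_integral_D[OF g] by measurable
    show "(\<lambda>P. exp (s * (\<integral>x. F i x \<partial>P))) \<in> borel_measurable D" for i
      using borel_measurable_integral_D[OF Fm] by measurable
    show "AE P in D. (\<lambda>i. exp (s * (\<integral>x. F i x \<partial>P))) \<longlonglongrightarrow> exp (s * (\<integral>x. g x \<partial>P))"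
    proof (intro AE_I2 tendsto_exp tendsto_mult tendsto_const)
      fix P assume P: "P \<in> space D"
      have [measurable_cong]: "sets P = sets \<alpha>" and sp: "space P = space \<alpha>" and "prob_space P"
        using P by (auto simp: space_D dest: sets_eq_imp_space_eq)
      interpret P: prob_space P by fact
      show "(\<lambda>i. \<integral>x. F i x \<partial>P) \<longlonglongrightarrow> (\<integral>x. g x \<partial>P)"
        by (rule integral_dominated_convergence[where w = "\<lambda>_. 2 * K"])
          (use F(2) FK sp in \<open>auto intro!: AE_I2\<close>)
    qed
    show "AE P in D. norm (exp (s * (\<integral>x. F i x \<partial>P))) \<le> exp (\<bar>s\<bar> * (2 * K))" for i
    proof (rule AE_I2)
      fix P assume P: "P \<in> space D"
      have "\<bar>\<integral>x. F i x \<partial>P\<bar> \<le> 2 * K"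
        by (rule abs_integral_le_D(2)[OF P FK Fm])
      then have "\<bar>s * (\<integral>x. F i x \<partial>P)\<bar> \<le> \<bar>s\<bar> * (2 * K)"
        by (simp only: abs_mult) (intro mult_left_mono, auto)
      then show "norm (exp (s * (\<integral>x. F i x \<partial>P))) \<le> exp (\<bar>s\<bar> * (2 * K))" by (simp add: abs_le_iff)
    qed
  qed simp
  show ?thesis
  proof (rule LIMSEQ_le)
    show "(\<lambda>i. \<bar>(\<integral>P. exp (s * (\<integral>x. F i x \<partial>P)) \<partial>D) - exp (log_laplace (F i) (s / mass))\<bar>)
        \<longlonglongrightarrow> \<bar>(\<integral>P. exp (s * (\<integral>x. g x \<partial>P)) \<partial>D) - exp (log_laplace g (s / mass))\<bar>"
      using tend[of 1] by (intro tendsto_rabs tendsto_diff tendE) simp_all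
    show "(\<lambda>i. (exp (log_laplace (F i) (2 * s / mass)) + exp (log_laplace (F i) (- 2 * s / mass))) / mass)
        \<longlonglongrightarrow> (exp (log_laplace g (2 * s / mass)) + exp (log_laplace g (- 2 * s / mass))) / mass"
      using mass_gt_0 tend[of 2] tend[of "-2"] by (intro tendsto_divide tendsto_add tendsto_const) simp_all
    have "2 * \<bar>s\<bar> * (2 * K) < mass"
    proof (cases "\<bar>s\<bar> * K = 0")
      case True then show ?thesis using mass_gt_0 by auto
    next
      case False
      then have "0 < \<bar>s\<bar> * K" using K0 by (simp add: less_le)
      with s show ?thesis by linarith
    qed
    then show "\<exists>N. \<forall>i\<ge>N. \<bar>(\<integral>P. exp (s * (\<integral>x. F i x \<partial>P)) \<partial>D) - exp (log_laplace (F i) (s / mass))\<bar>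
      \<le> (exp (log_laplace (F i) (2 * s / mass)) + exp (log_laplace (F i) (- 2 * s / mass))) / mass"
      using laplace_simple[OF F(1) FK] by blast
  qed
qed

section \<open>Unbounded integrands\<close>

text \<open>
  A crude bound, by Jensen's inequality under every realization \<open>P\<close> and the formula for the mean measure.
\<close>

lemma nn_integral_exp_le:
  assumes [measurable]: "g \<in> borel_measurable \<alpha>" "G \<in> borel_measurable \<alpha>"
    and gG: "\<And>x. x \<in> space \<alpha> \<Longrightarrow> \<bar>g x\<bar> \<le> G x"
  shows "(\<integral>\<^sup>+P. ennreal (exp (s * ((\<integral>x. g x \<partial>P) - m))) \<partial>D)
    \<le> ennreal (exp (\<bar>s\<bar> * \<bar>m\<bar>) / mass) * (\<integral>\<^sup>+x. ennreal (exp (\<bar>s\<bar> * G x)) \<partial>\<alpha>)"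
proof -
  have "(\<integral>\<^sup>+P. ennreal (exp (s * ((\<integral>x. g x \<partial>P) - m))) \<partial>D)
      \<le> (\<integral>\<^sup>+P. ennreal (exp (\<bar>s\<bar> * \<bar>m\<bar>)) * (\<integral>\<^sup>+x. ennreal (exp (\<bar>s\<bar> * G x)) \<partial>P) \<partial>D)"
  proof (rule nn_integral_mono)
    fix P assume P: "P \<in> space D"
    have sP[measurable_cong]: "sets P = sets \<alpha>" and sp: "space P = space \<alpha>" and pP: "prob_space P"
      using P by (auto simp: space_D dest: sets_eq_imp_space_eq)
    define X where "X = (\<integral>x. g x \<partial>P)"
    have "s * (X - m) \<le> \<bar>s\<bar> * \<bar>X - m\<bar>"
      by (metis abs_ge_self abs_mult)
    also have "\<dots> \<le> \<bar>s\<bar> * \<bar>m\<bar> + \<bar>s\<bar> * \<bar>X\<bar>"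
      unfolding distrib_left[symmetric] by (intro mult_left_mono) auto
    finally have "ennreal (exp (s * (X - m))) \<le> ennreal (exp (\<bar>s\<bar> * \<bar>m\<bar> + \<bar>s\<bar> * \<bar>X\<bar>))"
      by (intro ennreal_leI) simp
    also have "\<dots> = ennreal (exp (\<bar>s\<bar> * \<bar>m\<bar>)) * ennreal (exp (\<bar>s\<bar> * \<bar>X\<bar>))"
      by (simp add: exp_add ennreal_mult)
    also have "ennreal (exp (\<bar>s\<bar> * \<bar>X\<bar>)) \<le> (\<integral>\<^sup>+x. ennreal (exp (\<bar>s\<bar> * \<bar>g x\<bar>)) \<partial>P)"
      unfolding X_def by (intro exp_integral_le_nn_integral_exp pP) auto
    also have "\<dots> \<le> (\<integral>\<^sup>+x. ennreal (exp (\<bar>s\<bar> * G x)) \<partial>P)"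
      using gG by (intro nn_integral_mono ennreal_leI) (auto simp: sp intro!: mult_left_mono)
    finally show "ennreal (exp (s * ((\<integral>x. g x \<partial>P) - m)))
        \<le> ennreal (exp (\<bar>s\<bar> * \<bar>m\<bar>)) * (\<integral>\<^sup>+x. ennreal (exp (\<bar>s\<bar> * G x)) \<partial>P)"
      unfolding X_def by (simp add: mult_left_mono)
  qed
  also have "\<dots> = ennreal (exp (\<bar>s\<bar> * \<bar>m\<bar>)) * (ennreal (1 / mass) * (\<integral>\<^sup>+x. ennreal (exp (\<bar>s\<bar> * G x)) \<partial>\<alpha>))"
    by (subst nn_integral_cmult) (auto intro!: borel_measurable_nn_integral_D simp: nn_integral_nn_integral_D)
  finally show ?thesis
    using mass_gt_0 by (simp add: mult.assoc[symmetric] ennreal_mult[symmetric])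
qed

text \<open>
  The exponents with and without truncation differ by at most \<open>\<bar>s\<bar> * P h\<close>, where \<open>h\<close> is the part of \<open>G\<close> above \<open>K\<close>.
  Thus the exponentials differ by at most the truncated one times \<open>exp (\<bar>s\<bar> * P h) - 1\<close>. Young's inequality
  separates the two factors; the square of the second is at most \<open>exp (2 * \<bar>s\<bar> * P h) - 1\<close>, whose mean Jensen's
  inequality reduces to an exponential moment of \<open>h\<close> under the base measure.
\<close>

lemma exp_truncation_error:
  assumes [measurable]: "g \<in> borel_measurable \<alpha>" "G \<in> borel_measurable \<alpha>"
    and gG: "\<And>x. x \<in> space \<alpha> \<Longrightarrow> \<bar>g x\<bar> \<le> G x" and K: "0 \<le> K" and \<eta>: "0 < \<eta>"
    and J: "(\<integral>\<^sup>+x. ennreal (exp (2 * \<bar>s\<bar> * G x)) * indicator {x. K < G x} x \<partial>\<alpha>) \<le> ennreal J" "0 \<le> J"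
    and B: "(\<integral>P. exp (2 * s * (\<integral>x. max (- K) (min K (g x)) - m \<partial>P)) \<partial>D) \<le> B"
  shows "\<bar>(\<integral>P. exp (s * ((\<integral>x. g x \<partial>P) - m)) \<partial>D) - (\<integral>P. exp (s * (\<integral>x. max (- K) (min K (g x)) - m \<partial>P)) \<partial>D)\<bar>
    \<le> (\<eta> * B + J / (\<eta> * mass)) / 2"
proof (cases "s = 0")
  case True
  have "0 \<le> B" using B by (auto intro: order_trans[rotated])
  then show ?thesis using True \<eta> J(2) mass_gt_0 by (simp add: add_nonneg_nonneg)
next
  case s: False
  have B0: "0 \<le> B"
    by (rule order_trans[OF Bochner_Integration.integral_nonneg B]) simp
  define k where "k x = max (- K) (min K (g x))" for x
  define h where "h x = G x * indicator {x. K < G x} x" for x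
  have [measurable]: "k \<in> borel_measurable \<alpha>" "h \<in> borel_measurable \<alpha>"
    unfolding k_def h_def by measurable
  have G0: "0 \<le> G x" if "x \<in> space \<alpha>" for x using gG[OF that] by linarith
  have h0: "0 \<le> h x" if "x \<in> space \<alpha>" for x using G0[OF that] by (simp add: h_def)
  have gk: "\<bar>g x - k x\<bar> \<le> h x" if "x \<in> space \<alpha>" for x
    using gG[OF that] K by (auto simp: k_def h_def indicator_def max_def min_def abs_le_iff)
  have kK: "\<bar>k x\<bar> \<le> K" for x using K by (auto simp: k_def)
  define W where "W P = (\<integral>\<^sup>+x. ennreal (exp (2 * \<bar>s\<bar> * h x) - 1) \<partial>P)" for P
  have Wm[measurable]: "W \<in> borel_measurable D"
    unfolding W_def by (intro borel_measurable_nn_integral_D) measurable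
  have intW: "(\<integral>\<^sup>+P. W P \<partial>D) \<le> ennreal (J / mass)"
  proof -
    have "(\<integral>\<^sup>+x. ennreal (exp (2 * \<bar>s\<bar> * h x) - 1) \<partial>\<alpha>) \<le> ennreal J"
      by (rule order_trans[OF nn_integral_mono J(1)]) (auto simp: h_def indicator_def intro!: ennreal_leI)
    then have "ennreal (1 / mass) * (\<integral>\<^sup>+x. ennreal (exp (2 * \<bar>s\<bar> * h x) - 1) \<partial>\<alpha>) \<le> ennreal (1 / mass) * ennreal J"
      by (rule mult_left_mono) simp
    then show ?thesis
      unfolding W_def using mass_gt_0 J(2) by (simp add: nn_integral_nn_integral_D ennreal_mult[symmetric])
  qed
  then have finW: "AE P in D. W P \<noteq> \<infinity>"
    by (intro nn_integral_PInf_AE) (auto simp: top_unique)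
  define E where "E P = exp (s * ((\<integral>x. g x \<partial>P) - m))" for P
  define E' where "E' P = exp (s * (\<integral>x. k x - m \<partial>P))" for P
  have [measurable]: "E \<in> borel_measurable D" "E' \<in> borel_measurable D"
    unfolding E_def E'_def using borel_measurable_integral_D[of g] borel_measurable_integral_D[of "\<lambda>x. k x - m"]
    by measurable
  have bd: "\<bar>\<integral>x. k x - m \<partial>P\<bar> \<le> K + \<bar>m\<bar>" if "P \<in> space D" for P
    using kK by (intro abs_integral_le_D(2)[OF that]) (auto intro: order_trans[OF abs_triangle_ineq4] add_mono)
  have iE': "integrable D (\<lambda>P. E' P ^ n)" for n :: nat
  proof (rule law.integrable_const_bound[where B = "exp (\<bar>s\<bar> * (K + \<bar>m\<bar>)) ^ n"])
    show "AE P in D. norm (E' P ^ n) \<le> exp (\<bar>s\<bar> * (K + \<bar>m\<bar>)) ^ n"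
    proof (rule AE_I2)
      fix P assume "P \<in> space D"
      then have "\<bar>s * (\<integral>x. k x - m \<partial>P)\<bar> \<le> \<bar>s\<bar> * (K + \<bar>m\<bar>)"
        unfolding abs_mult by (intro mult_left_mono bd) auto
      then have "E' P \<le> exp (\<bar>s\<bar> * (K + \<bar>m\<bar>))"
        by (simp add: E'_def abs_le_iff)
      then show "norm (E' P ^ n) \<le> exp (\<bar>s\<bar> * (K + \<bar>m\<bar>)) ^ n"
        by (simp add: E'_def power_mono)
    qed
  qed measurable
  have E'2: "E' P ^ 2 = exp (2 * s * (\<integral>x. k x - m \<partial>P))" for P
    by (simp add: E'_def exp_double[symmetric] mult.assoc)
  have main: "AE P in D. ennreal \<bar>E P - E' P\<bar> \<le> ennreal (\<eta> / 2 * E' P ^ 2) + ennreal (1 / (2 * \<eta>)) * W P"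
    using finW AE_space
  proof eventually_elim
    case (elim P)
    have sP[measurable_cong]: "sets P = sets \<alpha>" and sp: "space P = space \<alpha>" and pP: "prob_space P"
      using elim(2) by (auto simp: space_D dest: sets_eq_imp_space_eq)
    interpret P: prob_space P by fact
    have ih1: "integrable P (\<lambda>x. exp (2 * \<bar>s\<bar> * h x) - 1)"
      using elim(1) h0 by (intro integrableI_nonneg) (auto simp: W_def sp top.not_eq_extremum intro!: AE_I2)
    \<comment> \<open>\<open>g\<close> need not be integrable under every \<open>P\<close>, but it is wherever \<open>W P\<close> is finite\<close>
    have ih: "integrable P h"
    proof (rule Bochner_Integration.integrable_bound[OF integrable_mult_right[OF ih1, of "1 / (2 * \<bar>s\<bar>)"]])
      show "AE x in P. norm (h x) \<le> norm (1 / (2 * \<bar>s\<bar>) * (exp (2 * \<bar>s\<bar> * h x) - 1))"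
      proof (rule AE_I2)
        fix x assume "x \<in> space P"
        then have hx: "0 \<le> h x" using h0 by (simp add: sp)
        have "2 * \<bar>s\<bar> * h x \<le> exp (2 * \<bar>s\<bar> * h x) - 1"
          using exp_ge_add_one_self[of "2 * \<bar>s\<bar> * h x"] by linarith
        then have "h x \<le> 1 / (2 * \<bar>s\<bar>) * (exp (2 * \<bar>s\<bar> * h x) - 1)"
          using s by (simp add: field_simps)
        with hx show "norm (h x) \<le> norm (1 / (2 * \<bar>s\<bar>) * (exp (2 * \<bar>s\<bar> * h x) - 1))"
          by simp
      qed
    qed measurable
    have ik: "integrable P k"
      by (rule P.integrable_const_bound[where B = K]) (use kK in auto)
    have ig: "integrable P g"
    proof (rule Bochner_Integration.integrable_bound[OF Bochner_Integration.integrable_add[OF ih integrable_abs[OF ik]]])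
      show "AE x in P. norm (g x) \<le> norm (h x + \<bar>k x\<bar>)"
      proof (rule AE_I2)
        fix x assume "x \<in> space P"
        then have "\<bar>g x - k x\<bar> \<le> h x" using gk by (simp add: sp)
        then show "norm (g x) \<le> norm (h x + \<bar>k x\<bar>)"
          by (auto simp: abs_le_iff abs_if split: if_splits)
      qed
    qed measurable
    define R where "R = (\<integral>x. h x \<partial>P)"
    have R0: "0 \<le> R" unfolding R_def using h0 by (intro integral_nonneg_AE AE_I2) (simp add: sp)
    have eq: "(\<integral>x. k x - m \<partial>P) = (\<integral>x. k x \<partial>P) - m"
      using ik by (simp add: P.prob_space)
    have "\<bar>(\<integral>x. g x \<partial>P) - (\<integral>x. k x \<partial>P)\<bar> = \<bar>\<integral>x. g x - k x \<partial>P\<bar>"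
      using ig ik by simp
    also have "\<dots> \<le> (\<integral>x. \<bar>g x - k x\<bar> \<partial>P)" by (rule integral_abs_bound)
    also have "\<dots> \<le> R"
      unfolding R_def using ig ik ih gk by (intro integral_mono) (auto simp: sp)
    finally have diff: "\<bar>s * ((\<integral>x. g x \<partial>P) - m) - s * (\<integral>x. k x - m \<partial>P)\<bar> \<le> \<bar>s\<bar> * R"
      unfolding eq right_diff_distrib[symmetric] abs_mult by (intro mult_left_mono) auto
    have expd: "\<bar>exp a - exp b\<bar> \<le> exp b * (exp d - 1)" if "\<bar>a - b\<bar> \<le> d" for a b d :: real
    proof -
      have "exp a \<le> exp (b + d)" "exp b \<le> exp b * exp d" using that by auto
      moreover have "exp b * (2 - exp d) \<le> exp b * exp (- d)"
      proof (intro mult_left_mono)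
        have "2 \<le> exp d + exp (- d)"
          using cosh_real_ge_1[of d] by (simp add: cosh_def)
        then show "2 - exp d \<le> exp (- d)" by simp
      qed simp
      moreover have "exp b * exp (- d) \<le> exp a"
        unfolding exp_add[symmetric] using that by simp
      ultimately show ?thesis
        by (simp add: exp_add algebra_simps abs_le_iff)
    qed
    have young: "x * y \<le> \<eta> / 2 * x ^ 2 + 1 / (2 * \<eta>) * y ^ 2" for x y :: real
    proof -
      have "2 * \<eta> * (x * y) \<le> \<eta> ^ 2 * x ^ 2 + y ^ 2"
        using zero_le_power2[of "\<eta> * x - y"] by (simp add: power2_diff power_mult_distrib)
      then show ?thesis using \<eta> by (simp add: field_simps power2_eq_square)
    qed
    have "\<bar>E P - E' P\<bar> \<le> E' P * (exp (\<bar>s\<bar> * R) - 1)"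
      unfolding E_def E'_def by (rule expd[OF diff])
    also have "\<dots> \<le> \<eta> / 2 * E' P ^ 2 + 1 / (2 * \<eta>) * (exp (\<bar>s\<bar> * R) - 1) ^ 2"
      by (rule young)
    also have "(exp (\<bar>s\<bar> * R) - 1) ^ 2 \<le> exp (2 * \<bar>s\<bar> * \<bar>R\<bar>) - 1"
    proof -
      have "1 \<le> exp (\<bar>s\<bar> * R)" using R0 by simp
      moreover have "exp (2 * \<bar>s\<bar> * \<bar>R\<bar>) = exp (\<bar>s\<bar> * R) ^ 2"
        using R0 by (simp add: exp_double[symmetric] mult.assoc)
      ultimately show ?thesis by (simp add: power2_diff)
    qed
    finally have "\<bar>E P - E' P\<bar> \<le> \<eta> / 2 * E' P ^ 2 + 1 / (2 * \<eta>) * (exp (2 * \<bar>s\<bar> * \<bar>R\<bar>) - 1)"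
      using \<eta> by (simp add: divide_right_mono)
    then have pointwise: "ennreal \<bar>E P - E' P\<bar> \<le> ennreal (\<eta> / 2 * E' P ^ 2) + ennreal (1 / (2 * \<eta>)) * ennreal (exp (2 * \<bar>s\<bar> * \<bar>R\<bar>) - 1)"
      using \<eta> by (simp add: ennreal_mult[symmetric] ennreal_plus[symmetric] ennreal_leI del: ennreal_plus)
    have "ennreal (exp (2 * \<bar>s\<bar> * \<bar>R\<bar>) - 1) \<le> W P"
    proof -
      have W: "W P = ennreal (\<integral>x. exp (2 * \<bar>s\<bar> * h x) - 1 \<partial>P)"
        unfolding W_def using h0 by (intro nn_integral_eq_integral ih1) (auto simp: sp intro!: AE_I2)
      have ie: "integrable P (\<lambda>x. exp (2 * \<bar>s\<bar> * h x))"
        using Bochner_Integration.integrable_add[OF ih1 P.integrable_const[of 1]] by simp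
      have "ennreal (exp (2 * \<bar>s\<bar> * \<bar>R\<bar>)) \<le> (\<integral>\<^sup>+x. ennreal (exp (2 * \<bar>s\<bar> * \<bar>h x\<bar>)) \<partial>P)"
        unfolding R_def by (rule exp_integral_le_nn_integral_exp[OF pP]) auto
      also have "\<dots> = (\<integral>\<^sup>+x. ennreal (exp (2 * \<bar>s\<bar> * h x)) \<partial>P)"
        using h0 by (intro nn_integral_cong) (simp add: sp)
      also have "\<dots> = ennreal (\<integral>x. exp (2 * \<bar>s\<bar> * h x) \<partial>P)"
        by (intro nn_integral_eq_integral ie) auto
      finally have "exp (2 * \<bar>s\<bar> * \<bar>R\<bar>) \<le> (\<integral>x. exp (2 * \<bar>s\<bar> * h x) \<partial>P)"
        by (subst (asm) ennreal_le_iff) auto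
      then show ?thesis
        unfolding W using ie by (intro ennreal_leI) (simp add: P.prob_space)
    qed
    then show ?case
      by (intro order_trans[OF pointwise] add_left_mono mult_left_mono) auto
  qed
  have nnd: "(\<integral>\<^sup>+P. ennreal \<bar>E P - E' P\<bar> \<partial>D) \<le> ennreal ((\<eta> * B + J / (\<eta> * mass)) / 2)"
  proof -
    have "(\<integral>\<^sup>+P. ennreal \<bar>E P - E' P\<bar> \<partial>D) \<le> (\<integral>\<^sup>+P. ennreal (\<eta> / 2 * E' P ^ 2) + ennreal (1 / (2 * \<eta>)) * W P \<partial>D)"
      by (rule nn_integral_mono_AE[OF main])
    also have "\<dots> = (\<integral>\<^sup>+P. ennreal (\<eta> / 2 * E' P ^ 2) \<partial>D) + ennreal (1 / (2 * \<eta>)) * (\<integral>\<^sup>+P. W P \<partial>D)"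
      by (subst nn_integral_add) (auto simp: nn_integral_cmult)
    also have "(\<integral>\<^sup>+P. ennreal (\<eta> / 2 * E' P ^ 2) \<partial>D) = ennreal (\<integral>P. \<eta> / 2 * E' P ^ 2 \<partial>D)"
      using iE'[of 2] \<eta> by (intro nn_integral_eq_integral) auto
    also have "(\<integral>P. \<eta> / 2 * E' P ^ 2 \<partial>D) = \<eta> / 2 * (\<integral>P. exp (2 * s * (\<integral>x. k x - m \<partial>P)) \<partial>D)"
      by (simp add: E'2)
    also have "ennreal (\<eta> / 2 * (\<integral>P. exp (2 * s * (\<integral>x. k x - m \<partial>P)) \<partial>D)) + ennreal (1 / (2 * \<eta>)) * (\<integral>\<^sup>+P. W P \<partial>D)
        \<le> ennreal (\<eta> / 2 * B) + ennreal (1 / (2 * \<eta>)) * ennreal (J / mass)"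
      using B \<eta> intW by (intro add_mono mult_left_mono ennreal_leI) (auto simp: k_def)
    also have "\<dots> = ennreal (\<eta> / 2 * B + 1 / (2 * \<eta>) * (J / mass))"
    proof -
      show ?thesis using B0 \<eta> J(2) mass_gt_0 by (simp add: ennreal_mult[symmetric])
    qed
    also have "\<eta> / 2 * B + 1 / (2 * \<eta>) * (J / mass) = (\<eta> * B + J / (\<eta> * mass)) / 2"
      using \<eta> mass_gt_0 by (simp add: field_simps)
    finally show ?thesis .
  qed
  have id: "integrable D (\<lambda>P. E P - E' P)"
    using nnd by (intro integrableI_bounded) (auto intro: order_le_less_trans)
  have iE: "integrable D E"
    using Bochner_Integration.integrable_add[OF id iE'[of 1]] by simp
  have nonneg: "0 \<le> (\<eta> * B + J / (\<eta> * mass)) / 2"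
    using B0 \<eta> J(2) mass_gt_0 by simp
  have "ennreal (\<integral>P. \<bar>E P - E' P\<bar> \<partial>D) = (\<integral>\<^sup>+P. ennreal \<bar>E P - E' P\<bar> \<partial>D)"
    using id by (intro nn_integral_eq_integral[symmetric]) auto
  also note nnd
  finally have "(\<integral>P. \<bar>E P - E' P\<bar> \<partial>D) \<le> (\<eta> * B + J / (\<eta> * mass)) / 2"
    using nonneg by (simp only: ennreal_le_iff)
  moreover have "\<bar>(\<integral>P. E P \<partial>D) - (\<integral>P. E' P \<partial>D)\<bar> \<le> (\<integral>P. \<bar>E P - E' P\<bar> \<partial>D)"
    using iE iE'[of 1] integral_abs_bound[of D "\<lambda>P. E P - E' P"] by simp
  ultimately show ?thesis
    unfolding E_def E'_def k_def by linarith
qed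

end

section \<open>Contraction of random signs by measurable majorants\<close>

lemma ennreal_add_le: "ennreal (a + b) \<le> ennreal a + ennreal b"
proof (cases "0 \<le> a \<and> 0 \<le> b")
  case False
  then consider "a < 0" | "b < 0" by linarith
  then show ?thesis
  proof cases
    case 1
    then have "ennreal (a + b) \<le> ennreal b" by (intro ennreal_leI) simp
    with 1 show ?thesis by (simp add: ennreal_neg)
  next
    case 2
    then have "ennreal (a + b) \<le> ennreal a" by (intro ennreal_leI) simp
    with 2 show ?thesis by (simp add: ennreal_neg)
  qed
qed simp

lemma ennreal_integral_le_nn_integral:
  fixes f :: "'a \<Rightarrow> real"
  assumes f: "integrable M f"
  shows "ennreal (\<integral>x. f x \<partial>M) \<le> (\<integral>\<^sup>+x. ennreal (f x) \<partial>M)"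
proof -
  have i: "integrable M (\<lambda>x. max 0 (f x))" using f by auto
  have "ennreal (\<integral>x. f x \<partial>M) \<le> ennreal (\<integral>x. max 0 (f x) \<partial>M)"
    using f i by (intro ennreal_leI integral_mono) auto
  also have "\<dots> = (\<integral>\<^sup>+x. ennreal (max 0 (f x)) \<partial>M)"
    using i by (intro nn_integral_eq_integral[symmetric]) auto
  also have "\<dots> = (\<integral>\<^sup>+x. ennreal (f x) \<partial>M)"
    by (intro nn_integral_cong) (auto simp: max_def ennreal_neg)
  finally show ?thesis .
qed

lemma sum_Pow_Suc:
  fixes h :: "nat set \<Rightarrow> 'b::comm_monoid_add"
  shows "(\<Sum>J\<in>Pow {..<Suc n}. h J) = (\<Sum>J\<in>Pow {..<n}. h (insert n J) + h J)"
proof -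
  have "Pow {..<Suc n} = Pow {..<n} \<union> insert n ` Pow {..<n}"
    by (simp add: lessThan_Suc Pow_insert)
  moreover have "Pow {..<n} \<inter> insert n ` Pow {..<n} = {}" by auto
  moreover have "inj_on (insert n) (Pow {..<n})"
    by (auto simp: inj_on_def)
  ultimately have "(\<Sum>J\<in>Pow {..<Suc n}. h J) = (\<Sum>J\<in>Pow {..<n}. h J) + (\<Sum>J\<in>Pow {..<n}. h (insert n J))"
    by (simp add: sum.union_disjoint sum.reindex)
  then show ?thesis by (simp add: sum.distrib add.commute)
qed

text \<open>
  The second moment of a sum of \<open>n\<close> independent random signs, \<open>J\<close> being the set of positive ones; the next lemma
  deduces the bound \<open>sqrt n\<close> for the first absolute moment.
\<close>

lemma sum_signed_card_squared: "(\<Sum>J\<in>Pow {..<n}. (2 * real (card J) - real n)\<^sup>2) = real n * 2 ^ n"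
proof (induction n)
  case (Suc n)
  have "(2 * real (card (insert n J)) - real (Suc n))\<^sup>2 + (2 * real (card J) - real (Suc n))\<^sup>2
      = 2 * (2 * real (card J) - real n)\<^sup>2 + 2" if "J \<in> Pow {..<n}" for J
  proof -
    have "finite J" "n \<notin> J" using that finite_subset by auto
    then have "card (insert n J) = Suc (card J)" by simp
    then show ?thesis by (simp add: power2_eq_square algebra_simps)
  qed
  then have "(\<Sum>J\<in>Pow {..<Suc n}. (2 * real (card J) - real (Suc n))\<^sup>2)
      = (\<Sum>J\<in>Pow {..<n}. 2 * (2 * real (card J) - real n)\<^sup>2 + 2)"
    unfolding sum_Pow_Suc by (intro sum.cong) auto
  also have "\<dots> = 2 * (real n * 2 ^ n) + 2 * 2 ^ n"
    using Suc by (simp add: sum.distrib sum_distrib_left[symmetric] card_Pow)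
  finally show ?case by (simp add: algebra_simps)
qed simp

lemma sum_abs_signed_card_le:
  assumes "1 \<le> n"
  shows "(\<Sum>J\<in>Pow {..<n}. \<bar>2 * real (card J) - real n\<bar>) \<le> 2 ^ n * sqrt n"
proof -
  have n: "0 < sqrt n" using assms by simp
  have "\<bar>x\<bar> \<le> (x\<^sup>2 / sqrt n + sqrt n) / 2" for x
  proof -
    have "0 \<le> (\<bar>x\<bar> - sqrt n)\<^sup>2" by simp
    then have "2 * \<bar>x\<bar> * sqrt n \<le> x\<^sup>2 + n"
      using n by (simp add: power2_diff)
    then show ?thesis using n by (simp add: field_simps power2_eq_square)
  qed
  then have "(\<Sum>J\<in>Pow {..<n}. \<bar>2 * real (card J) - real n\<bar>)
      \<le> (\<Sum>J\<in>Pow {..<n}. ((2 * real (card J) - real n)\<^sup>2 / sqrt n + sqrt n) / 2)"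
    by (intro sum_mono)
  also have "\<dots> = ((\<Sum>J\<in>Pow {..<n}. (2 * real (card J) - real n)\<^sup>2) / sqrt n + 2 ^ n * sqrt n) / 2"
    by (simp add: sum.distrib sum_divide_distrib[symmetric] card_Pow)
  also have "\<dots> = (real n / sqrt n * 2 ^ n + 2 ^ n * sqrt n) / 2"
    unfolding sum_signed_card_squared by simp
  also have "\<dots> = 2 ^ n * sqrt n"
    by (simp add: real_div_sqrt)
  finally show ?thesis .
qed

text \<open>
  Extended to an injection of all indices, an enumeration of \<open>J\<close> reindexes an i.i.d. sequence into an i.i.d. sequence
  that begins with the observations in \<open>J\<close>.
\<close>

lemma obtain_injective_enumeration:
  fixes J :: "nat set"
  assumes "J \<subseteq> {..<n}"
  obtains s where "inj s" "bij_betw s {..<card J} J"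
proof -
  have "finite J" using assms finite_subset by auto
  then obtain h where h: "bij_betw h {0..<card J} J"
    using ex_bij_betw_nat_finite by blast
  define s where "s i = (if i < card J then h i else n + i)" for i
  have hJ: "h i \<in> J" "h i < n" if "i < card J" for i
    using h that assms by (auto simp: bij_betw_def)
  have "inj s"
  proof (rule injI)
    fix x y assume "s x = s y"
    then show "x = y"
      using h hJ[of x] hJ[of y] by (auto simp: s_def bij_betw_def inj_on_def split: if_splits)
  qed
  moreover have "bij_betw s {..<card J} J"
    using h by (subst bij_betw_cong[of _ _ h]) (auto simp: s_def atLeast0LessThan)
  ultimately show ?thesis by (rule that)
qed

context prob_space
begin

text \<open>
  The centred value \<open>u + w z - \<integral> w\<close> is the average of \<open>u + 2 * w z\<close> and of the mean of \<open>u - 2 * w\<close>, and each of the two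
  has a majorant that does not refer to \<open>w\<close>.
\<close>

lemma centering_step:
  fixes w :: "'a \<Rightarrow> real"
  assumes w: "integrable M w"
    and A: "ennreal (u + 2 * w z) \<le> a" and B: "\<And>x. x \<in> space M \<Longrightarrow> ennreal (u - 2 * w x) \<le> B x"
  shows "ennreal (u + (w z - (\<integral>x. w x \<partial>M))) \<le> ennreal (1 / 2) * a + ennreal (1 / 2) * (\<integral>\<^sup>+x. B x \<partial>M)"
proof -
  have "ennreal (u + (w z - (\<integral>x. w x \<partial>M))) = ennreal (1 / 2 * (u + 2 * w z) + 1 / 2 * (u - 2 * (\<integral>x. w x \<partial>M)))"
    by (simp add: algebra_simps)
  also have "\<dots> \<le> ennreal (1 / 2 * (u + 2 * w z)) + ennreal (1 / 2 * (u - 2 * (\<integral>x. w x \<partial>M)))"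
    by (rule ennreal_add_le)
  also have "\<dots> = ennreal (1 / 2) * ennreal (u + 2 * w z) + ennreal (1 / 2) * ennreal (\<integral>x. u - 2 * w x \<partial>M)"
    using w by (simp only: ennreal_mult'[of "1 / 2"]) (simp add: prob_space)
  also have "\<dots> \<le> ennreal (1 / 2) * a + ennreal (1 / 2) * (\<integral>\<^sup>+x. B x \<partial>M)"
  proof (intro add_mono mult_left_mono A)
    have "ennreal (\<integral>x. u - 2 * w x \<partial>M) \<le> (\<integral>\<^sup>+x. ennreal (u - 2 * w x) \<partial>M)"
      using w by (intro ennreal_integral_le_nn_integral) auto
    also have "\<dots> \<le> (\<integral>\<^sup>+x. B x \<partial>M)"
      by (intro nn_integral_mono B)
    finally show "ennreal (\<integral>x. u - 2 * w x \<partial>M) \<le> (\<integral>\<^sup>+x. B x \<partial>M)" .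
  qed auto
  finally show ?thesis .
qed

text \<open>
  Contraction by the absolute value, for majorants instead of suprema. Suppose that for every choice of signs the
  signed sums \<open>\<Sum>i<n. \<plusminus> 2 * f (z i)\<close> have, over \<open>f \<in> F\<close>, the measurable majorant \<open>A J\<close>. One coordinate is treated at a
  time: if \<open>u + 2 * f \<le> U\<close> and \<open>u - 2 * f \<le> V\<close>, then \<open>u + 2 * \<bar>f\<bar> \<le> max U V\<close> and \<open>u - 2 * \<bar>f\<bar> \<le> min U V\<close>, and the
  centring step passes to \<open>u + (\<bar>f\<bar> - \<integral> \<bar>f\<bar>)\<close> by averaging the value of the one and the mean of the other. Since
  \<open>max U V + min U V = U + V\<close>, the mean of the majorant is unchanged. With \<open>s = - 1\<close> the two bounds are exchanged.

  The induction removes the last coordinate; the terms already centred are collected in \<open>off\<close>, which may depend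
  only on coordinates from \<open>n\<close> on, so that redrawing an earlier coordinate leaves it fixed.
\<close>

lemma sign_average_majorant:
  fixes F :: "('a \<Rightarrow> real) set" and A :: "nat set \<Rightarrow> (nat \<Rightarrow> 'a) \<Rightarrow> ennreal"
    and off :: "('a \<Rightarrow> real) \<Rightarrow> (nat \<Rightarrow> 'a) \<Rightarrow> real" and s :: real
  assumes s: "s = 1 \<or> s = - 1" and F: "\<And>f. f \<in> F \<Longrightarrow> integrable M f"
    and "\<And>J. J \<subseteq> {..<n} \<Longrightarrow> A J \<in> borel_measurable (iid_seq M)"
    and "\<And>f z z'. f \<in> F \<Longrightarrow> (\<And>i. n \<le> i \<Longrightarrow> z i = z' i) \<Longrightarrow> off f z = off f z'"
    and "\<And>J f z. J \<subseteq> {..<n} \<Longrightarrow> f \<in> F \<Longrightarrow> z \<in> space (iid_seq M) \<Longrightarrow>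
      ennreal (off f z + (\<Sum>i<n. (if i \<in> J then 2 else - 2) * f (z i))) \<le> A J z"
  shows "\<exists>W\<in>borel_measurable (iid_seq M).
    (\<forall>f\<in>F. \<forall>z\<in>space (iid_seq M). ennreal (off f z + (\<Sum>i<n. s * (\<bar>f (z i)\<bar> - (\<integral>x. \<bar>f x\<bar> \<partial>M)))) \<le> W z) \<and>
    (\<integral>\<^sup>+z. W z \<partial>iid_seq M) = ennreal (1 / 2 ^ n) * (\<Sum>J\<in>Pow {..<n}. \<integral>\<^sup>+z. A J z \<partial>iid_seq M)"
  using assms(3-5)
proof (induction n arbitrary: A off)
  case 0
  show ?case
    by (rule bexI[of _ "A {}"]) (use 0 in auto)
next
  case (Suc n)
  \<comment> \<open>\<open>X\<close> is evaluated at the observation, \<open>Y\<close> is integrated over it\<close>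
  define hi where "hi J z = max (A (insert n J) z) (A J z)" for J z
  define lo where "lo J z = min (A (insert n J) z) (A J z)" for J z
  define X where "X J = (if s = 1 then hi J else lo J)" for J
  define Y where "Y J = (if s = 1 then lo J else hi J)" for J
  define A' where "A' J z = ennreal (1 / 2) * X J z + ennreal (1 / 2) * (\<integral>\<^sup>+x. Y J (z(n := x)) \<partial>M)" for J z
  define off' where "off' f z = off f z + s * (\<bar>f (z n)\<bar> - (\<integral>x. \<bar>f x\<bar> \<partial>M))" for f z
  have meas: "X J \<in> borel_measurable (iid_seq M)" "Y J \<in> borel_measurable (iid_seq M)" if "J \<subseteq> {..<n}" for J
  proof -
    have [measurable]: "A (insert n J) \<in> borel_measurable (iid_seq M)" "A J \<in> borel_measurable (iid_seq M)"
      using that by (intro Suc.prems(1); auto)+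
    show "X J \<in> borel_measurable (iid_seq M)" "Y J \<in> borel_measurable (iid_seq M)"
      unfolding X_def Y_def hi_def lo_def by (cases "s = 1"; simp)+
  qed
  have measY: "(\<lambda>z. \<integral>\<^sup>+x. Y J (z(n := x)) \<partial>M) \<in> borel_measurable (iid_seq M)" if "J \<subseteq> {..<n}" for J
    using meas(2)[OF that] by (rule borel_measurable_nn_integral_iid_seq_upd)
  have IH: "\<exists>W\<in>borel_measurable (iid_seq M).
    (\<forall>f\<in>F. \<forall>z\<in>space (iid_seq M). ennreal (off' f z + (\<Sum>i<n. s * (\<bar>f (z i)\<bar> - (\<integral>x. \<bar>f x\<bar> \<partial>M)))) \<le> W z) \<and>
    (\<integral>\<^sup>+z. W z \<partial>iid_seq M) = ennreal (1 / 2 ^ n) * (\<Sum>J\<in>Pow {..<n}. \<integral>\<^sup>+z. A' J z \<partial>iid_seq M)"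
  proof (rule Suc.IH)
    show "A' J \<in> borel_measurable (iid_seq M)" if "J \<subseteq> {..<n}" for J
      unfolding A'_def using meas(1)[OF that] measY[OF that] by measurable
    show "off' f z = off' f z'" if "f \<in> F" "\<And>i. n \<le> i \<Longrightarrow> z i = z' i" for f z z'
      unfolding off'_def using that by (simp add: Suc.prems(2)[OF that(1), of z z'])
    fix J f z assume J: "J \<subseteq> {..<n}" and f: "f \<in> F" and z: "z \<in> space (iid_seq M)"
    define u where "u = off f z + (\<Sum>i<n. (if i \<in> J then 2 else - 2) * f (z i))"
    have bound: "ennreal (u + 2 * f x) \<le> A (insert n J) (z(n := x)) \<and> ennreal (u - 2 * f x) \<le> A J (z(n := x))"
      if x: "x \<in> space M" for x
    proof -
      have zx: "z(n := x) \<in> space (iid_seq M)"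
        using z x by (auto simp: space_iid_seq)
      have off: "off f (z(n := x)) = off f z"
        by (rule Suc.prems(2)[OF f]) auto
      have nJ: "n \<notin> J" using J by auto
      have s1: "(\<Sum>i<Suc n. (if i \<in> insert n J then 2 else - 2) * f ((z(n := x)) i))
            = (\<Sum>i<n. (if i \<in> J then 2 else - 2) * f (z i)) + 2 * f x"
        and s2: "(\<Sum>i<Suc n. (if i \<in> J then 2 else - 2) * f ((z(n := x)) i))
            = (\<Sum>i<n. (if i \<in> J then 2 else - 2) * f (z i)) - 2 * f x"
        using nJ by (auto intro!: sum.cong)
      have J': "insert n J \<subseteq> {..<Suc n}" "J \<subseteq> {..<Suc n}" using J by auto
      show ?thesis
        using Suc.prems(3)[OF J'(1) f zx] Suc.prems(3)[OF J'(2) f zx]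
        unfolding s1 s2 off u_def by (simp only: add.assoc add_diff_eq simp_thms)
    qed
    have w: "integrable M (\<lambda>x. s * \<bar>f x\<bar>)" using F[OF f] by auto
    have hi_bound: "ennreal (u + 2 * \<bar>f x\<bar>) \<le> hi J (z(n := x))" if "x \<in> space M" for x
      using bound[OF that] by (cases "0 \<le> f x") (auto simp: hi_def le_max_iff_disj)
    have lo_bound: "ennreal (u - 2 * \<bar>f x\<bar>) \<le> lo J (z(n := x))" if "x \<in> space M" for x
    proof -
      have "ennreal (u - 2 * \<bar>f x\<bar>) \<le> ennreal (u + 2 * f x)" "ennreal (u - 2 * \<bar>f x\<bar>) \<le> ennreal (u - 2 * f x)"
        by (intro ennreal_leI; simp)+
      then show ?thesis using bound[OF that] by (auto simp: lo_def intro: order_trans)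
    qed
    have zn: "z n \<in> space M" using z by (simp add: space_iid_seq)
    have "ennreal (u + (s * \<bar>f (z n)\<bar> - (\<integral>x. s * \<bar>f x\<bar> \<partial>M))) \<le> A' J z"
      unfolding A'_def
    proof (rule centering_step[OF w])
      show "ennreal (u + 2 * (s * \<bar>f (z n)\<bar>)) \<le> X J z"
        using s hi_bound[OF zn] lo_bound[OF zn] by (auto simp: X_def)
      show "ennreal (u - 2 * (s * \<bar>f x\<bar>)) \<le> Y J (z(n := x))" if "x \<in> space M" for x
        using s hi_bound[OF that] lo_bound[OF that] by (auto simp: Y_def)
    qed
    moreover have "off' f z + (\<Sum>i<n. (if i \<in> J then 2 else - 2) * f (z i))
        = u + (s * \<bar>f (z n)\<bar> - (\<integral>x. s * \<bar>f x\<bar> \<partial>M))"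
      by (simp add: off'_def u_def algebra_simps)
    ultimately show "ennreal (off' f z + (\<Sum>i<n. (if i \<in> J then 2 else - 2) * f (z i))) \<le> A' J z"
      by simp
  qed
  have intA': "(\<integral>\<^sup>+z. A' J z \<partial>iid_seq M)
      = ennreal (1 / 2) * ((\<integral>\<^sup>+z. A (insert n J) z \<partial>iid_seq M) + (\<integral>\<^sup>+z. A J z \<partial>iid_seq M))"
    if J: "J \<subseteq> {..<n}" for J
  proof -
    have [measurable]: "A (insert n J) \<in> borel_measurable (iid_seq M)" "A J \<in> borel_measurable (iid_seq M)"
      using J by (intro Suc.prems(1); auto)+
    note [measurable] = meas[OF J] measY[OF J]
    have "(\<integral>\<^sup>+z. A' J z \<partial>iid_seq M) = ennreal (1 / 2) * (\<integral>\<^sup>+z. X J z \<partial>iid_seq M)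
        + ennreal (1 / 2) * (\<integral>\<^sup>+z. \<integral>\<^sup>+x. Y J (z(n := x)) \<partial>M \<partial>iid_seq M)"
      unfolding A'_def by (simp add: nn_integral_add nn_integral_cmult)
    also have "(\<integral>\<^sup>+z. \<integral>\<^sup>+x. Y J (z(n := x)) \<partial>M \<partial>iid_seq M) = (\<integral>\<^sup>+z. Y J z \<partial>iid_seq M)"
      by (rule nn_integral_iid_seq_upd[OF meas(2)[OF J]])
    also have "ennreal (1 / 2) * (\<integral>\<^sup>+z. X J z \<partial>iid_seq M) + ennreal (1 / 2) * (\<integral>\<^sup>+z. Y J z \<partial>iid_seq M)
        = ennreal (1 / 2) * (\<integral>\<^sup>+z. X J z + Y J z \<partial>iid_seq M)"
      by (simp add: nn_integral_add distrib_left)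
    also have "(\<lambda>z. X J z + Y J z) = (\<lambda>z. A (insert n J) z + A J z)"
      by (auto simp: X_def Y_def hi_def lo_def fun_eq_iff max_def min_def add.commute)
    finally show ?thesis
      by (simp add: nn_integral_add)
  qed
  have "ennreal (1 / 2 ^ n) * (\<Sum>J\<in>Pow {..<n}. \<integral>\<^sup>+z. A' J z \<partial>iid_seq M)
      = ennreal (1 / 2 ^ Suc n) * (\<Sum>J\<in>Pow {..<Suc n}. \<integral>\<^sup>+z. A J z \<partial>iid_seq M)"
  proof -
    have "(\<Sum>J\<in>Pow {..<n}. \<integral>\<^sup>+z. A' J z \<partial>iid_seq M)
        = ennreal (1 / 2) * (\<Sum>J\<in>Pow {..<Suc n}. \<integral>\<^sup>+z. A J z \<partial>iid_seq M)"
      unfolding sum_Pow_Suc sum_distrib_left by (intro sum.cong intA') auto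
    moreover have "ennreal (1 / 2 ^ Suc n) = ennreal (1 / 2 ^ n) * ennreal (1 / 2)"
      by (subst ennreal_mult[symmetric]) auto
    ultimately show ?thesis by (simp only: mult.assoc)
  qed
  with IH show ?case
    by (simp add: off'_def add_ac)
qed

end

section \<open>Deviations of absolute values\<close>

locale envelope_class = prob_space M for M :: "'a measure" +
  fixes \<G> :: "('a \<Rightarrow> real) set" and G :: "'a \<Rightarrow> real"
  assumes measurable_class: "\<And>g. g \<in> \<G> \<Longrightarrow> g \<in> borel_measurable M"
    and measurable_envelope [measurable]: "G \<in> borel_measurable M"
    and envelope: "\<And>g x. g \<in> \<G> \<Longrightarrow> x \<in> space M \<Longrightarrow> \<bar>g x\<bar> \<le> G x"
    and envelope_nonneg: "\<And>x. x \<in> space M \<Longrightarrow> 0 \<le> G x"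
    and envelope_square: "integrable M (\<lambda>x. (G x)\<^sup>2)"
begin

lemma integrable_envelope: "integrable M G"
proof (rule Bochner_Integration.integrable_bound[OF Bochner_Integration.integrable_add[OF integrable_const[of 1] envelope_square]])
  have "\<bar>y\<bar> \<le> \<bar>1 + y\<^sup>2\<bar>" for y :: real
  proof -
    have "0 \<le> (1 - \<bar>y\<bar>)\<^sup>2" by simp
    then show ?thesis by (simp add: power2_diff)
  qed
  then show "AE x in M. norm (G x) \<le> norm (1 + (G x)\<^sup>2)" by simp
qed measurable

lemma integrable_class: "g \<in> \<G> \<Longrightarrow> integrable M g"
  using envelope by (intro Bochner_Integration.integrable_bound[OF integrable_envelope])
    (auto simp: measurable_class intro!: AE_I2 order_trans[OF envelope])

lemma square_le_envelope: "g \<in> \<G> \<Longrightarrow> x \<in> space M \<Longrightarrow> (g x)\<^sup>2 \<le> (G x)\<^sup>2"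
  using envelope[of g x] by (simp add: abs_le_square_iff[symmetric])

lemma integrable_class_square: "g \<in> \<G> \<Longrightarrow> integrable M (\<lambda>x. (g x)\<^sup>2)"
  using measurable_class[of g]
  by (intro Bochner_Integration.integrable_bound[OF envelope_square])
    (auto intro!: AE_I2 square_le_envelope)

lemma abs_integral_class_le: "g \<in> \<G> \<Longrightarrow> \<bar>\<integral>x. g x \<partial>M\<bar> \<le> (\<integral>x. G x \<partial>M)"
  using integrable_class[of g] integrable_envelope envelope
  by (intro order_trans[OF integral_abs_bound] integral_mono) auto

lemma integral_class_square_le: "g \<in> \<G> \<Longrightarrow> (\<integral>x. (g x)\<^sup>2 \<partial>M) \<le> (\<integral>x. (G x)\<^sup>2 \<partial>M)"
  by (intro integral_mono integrable_class_square envelope_square square_le_envelope)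

definition square_tail :: "real \<Rightarrow> 'a \<Rightarrow> real" where
  "square_tail K x = (G x)\<^sup>2 * indicator {x. K < G x} x"

lemma square_tail_nonneg: "0 \<le> square_tail K x" by (simp add: square_tail_def)

lemma measurable_square_tail [measurable]: "square_tail K \<in> borel_measurable M"
  unfolding square_tail_def by measurable

lemma integrable_square_tail: "integrable M (square_tail K)"
  by (rule Bochner_Integration.integrable_bound[OF envelope_square]) (auto simp: square_tail_def indicator_def)

lemma square_tail_integral_tendsto: "(\<lambda>k. \<integral>x. square_tail (real k) x \<partial>M) \<longlonglongrightarrow> 0"
proof -
  have "(\<lambda>k. \<integral>x. square_tail (real k) x \<partial>M) \<longlonglongrightarrow> (\<integral>x. 0 \<partial>M)"
  proof (rule integral_dominated_convergence[where w = "\<lambda>x. (G x)\<^sup>2"])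
    show "AE x in M. (\<lambda>k. square_tail (real k) x) \<longlonglongrightarrow> 0"
    proof (rule AE_I2, rule tendsto_eventually)
      fix x
      obtain k0 :: nat where "G x \<le> real k0" using real_arch_simple by blast
      then show "\<forall>\<^sub>F k in sequentially. square_tail (real k) x = 0"
        unfolding eventually_sequentially by (intro exI[of _ k0]) (auto simp: square_tail_def indicator_def)
    qed
  qed (auto simp: square_tail_def indicator_def envelope_square)
  then show ?thesis by simp
qed

lemma obtain_small_tail:
  assumes "0 < \<eta>"
  obtains k :: nat where "(\<integral>x. square_tail (real k) x \<partial>M) < \<eta>"
  using order_tendstoD(2)[OF square_tail_integral_tendsto assms] by (auto simp: eventually_sequentially)

lemma square_le_tail: "0 \<le> K \<Longrightarrow> x \<in> space M \<Longrightarrow> (G x)\<^sup>2 \<le> K\<^sup>2 + square_tail K x"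
  using envelope_nonneg[of x] by (auto simp: square_tail_def indicator_def intro: power_mono)

end

lemma ennreal_twice_sum:
  "0 \<le> a \<Longrightarrow> 0 \<le> b \<Longrightarrow> 0 \<le> c \<Longrightarrow> ennreal (2 * (a + b + c)) = 2 * (ennreal a + ennreal b + ennreal c)"
  by (subst ennreal_mult) auto

lemma integral_empirical_measure:
  fixes g :: "'a \<Rightarrow> real"
  assumes "1 \<le> n" "\<And>i. z i \<in> space M" and [measurable]: "g \<in> borel_measurable M"
  shows "(\<integral>x. g x \<partial>empirical_measure M n z) = (\<Sum>i<n. g (z i)) / n"
proof -
  have z: "z \<in> uniform_count_measure {..<n} \<rightarrow>\<^sub>M M"
    using assms(2) by (auto simp: measurable_def sets_uniform_count_measure space_uniform_count_measure)
  show ?thesis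
    unfolding empirical_measure_def
    by (subst integral_distr[OF z]) (auto simp: integral_uniform_count_measure)
qed

context envelope_class
begin

text \<open>
  The deviation is not divided by \<open>n\<close>, which makes it additive over disjoint sets of indices.
\<close>

definition dev :: "nat \<Rightarrow> (nat \<Rightarrow> 'a) \<Rightarrow> ('a \<Rightarrow> real) \<Rightarrow> real" where
  "dev n z f = (\<Sum>i<n. f (z i)) - real n * (\<integral>x. f x \<partial>M)"

lemma dev_eq: "dev n z f = (\<Sum>i<n. f (z i) - (\<integral>x. f x \<partial>M))"
  by (simp add: dev_def sum_subtractf)

text \<open>
  For the functions \<open>f = g - c\<close>, a signed sum over \<open>{..<n}\<close> is the difference of the deviations of \<open>g\<close> over the
  positive and the negative indices, plus the mean of \<open>f\<close> times the excess of positive signs. Along an injective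
  enumeration of each index set the deviations have the majorants \<open>D\<close>; the excess is at most \<open>sqrt n\<close> on average. The
  sum of the majorants for \<open>\<bar>f\<bar>\<close> and \<open>- \<bar>f\<bar>\<close> covers the absolute deviation.
\<close>

lemma abs_deviation_majorant:
  fixes d :: "nat \<Rightarrow> real" and K \<eta> :: real
  assumes Dm: "\<And>k. 1 \<le> k \<Longrightarrow> D k \<in> borel_measurable (iid_seq M)"
    and D: "\<And>k g z. 1 \<le> k \<Longrightarrow> g \<in> \<G> \<Longrightarrow> z \<in> space (iid_seq M) \<Longrightarrow> ennreal \<bar>dev k z g\<bar> \<le> ennreal k * D k z"
    and d: "\<And>k. 1 \<le> k \<Longrightarrow> (\<integral>\<^sup>+z. D k z \<partial>iid_seq M) \<le> ennreal (d k)" "\<And>k. 0 \<le> d k" "d \<longlonglongrightarrow> 0"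
    and K: "0 \<le> K" and \<eta>: "0 < \<eta>"
  shows "\<forall>\<^sub>F n in sequentially. \<exists>W\<in>borel_measurable (iid_seq M).
    (\<forall>g\<in>\<G>. \<forall>c. \<bar>c\<bar> \<le> K \<longrightarrow> (\<forall>z\<in>space (iid_seq M). ennreal \<bar>dev n z (\<lambda>x. \<bar>g x - c\<bar>)\<bar> \<le> W z)) \<and>
    (\<integral>\<^sup>+z. W z \<partial>iid_seq M) \<le> ennreal (\<eta> * n)"
proof -
  define B where "B = (\<integral>x. G x \<partial>M) + K"
  have B0: "0 \<le> B" using K envelope_nonneg by (auto simp: B_def intro!: add_nonneg_nonneg integral_nonneg_AE AE_I2)
  obtain N0 where N0: "\<And>k. N0 \<le> k \<Longrightarrow> d k < \<eta> / 16"
    using order_tendstoD(2)[OF d(3), of "\<eta> / 16"] \<eta> by (auto simp: eventually_sequentially)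
  \<comment> \<open>subsamples may be small; \<open>C\<close> accounts for the finitely many sizes at which \<open>d\<close> is not yet below \<open>\<eta> / 16\<close>\<close>
  define C where "C = (\<Sum>k<N0. real k * d k)"
  have C0: "0 \<le> C" unfolding C_def using d(2) by (intro sum_nonneg) auto
  have kd: "real k * d k \<le> \<eta> / 16 * k + C" for k
  proof (cases "N0 \<le> k")
    case True
    then have "real k * d k \<le> real k * (\<eta> / 16)" using N0[OF True] by (intro mult_left_mono) auto
    then show ?thesis using C0 by (simp add: mult.commute)
  next
    case False
    then have "real k * d k \<le> C" unfolding C_def using d(2) by (intro member_le_sum) auto
    then show ?thesis using \<eta> by (simp add: add_increasing)
  qed
  have step: "\<exists>W\<in>borel_measurable (iid_seq M).
    (\<forall>g\<in>\<G>. \<forall>c. \<bar>c\<bar> \<le> K \<longrightarrow> (\<forall>z\<in>space (iid_seq M). ennreal \<bar>dev n z (\<lambda>x. \<bar>g x - c\<bar>)\<bar> \<le> W z)) \<and>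
    (\<integral>\<^sup>+z. W z \<partial>iid_seq M) \<le> ennreal (4 * (\<eta> / 16 * n + 2 * C) + 4 * B * sqrt n)" if n: "1 \<le> n" for n
  proof -
    have "\<exists>s. inj s \<and> bij_betw s {..<card J} J" if "J \<subseteq> {..<n}" for J
      using obtain_injective_enumeration[OF that] by blast
    then obtain \<sigma> where \<sigma>: "\<And>J. J \<subseteq> {..<n} \<Longrightarrow> inj (\<sigma> J)" "\<And>J. J \<subseteq> {..<n} \<Longrightarrow> bij_betw (\<sigma> J) {..<card J} J"
      by metis
    \<comment> \<open>majorant of the deviation over the index set \<open>J\<close>\<close>
    define E where "E J z = (if J = {} then 0 else ennreal (card J) * D (card J) (\<lambda>i. z (\<sigma> J i)))" for J z
    have Em: "E J \<in> borel_measurable (iid_seq M)" and intE: "(\<integral>\<^sup>+z. E J z \<partial>iid_seq M) \<le> ennreal (real (card J) * d (card J))"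
      and Emaj: "\<And>g z. g \<in> \<G> \<Longrightarrow> z \<in> space (iid_seq M) \<Longrightarrow> ennreal \<bar>\<Sum>i\<in>J. g (z i) - (\<integral>x. g x \<partial>M)\<bar> \<le> E J z"
      if J: "J \<subseteq> {..<n}" for J
    proof -
      have finJ: "finite J" using J finite_subset by auto
      have "E J \<in> borel_measurable (iid_seq M) \<and> (\<integral>\<^sup>+z. E J z \<partial>iid_seq M) \<le> ennreal (real (card J) * d (card J))"
      proof (cases "J = {}")
        case True
        then have "E J = (\<lambda>_. 0)" by (simp add: E_def fun_eq_iff)
        then show ?thesis by simp
      next
        case False
        then have c1: "1 \<le> card J" using finJ by (simp add: Suc_le_eq card_gt_0_iff)
        have m: "(\<lambda>z i. z (\<sigma> J i)) \<in> iid_seq M \<rightarrow>\<^sub>M iid_seq M"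
          unfolding iid_seq_def by (rule measurable_PiM_single') (auto simp: space_PiM)
        have Dm': "(\<lambda>z. D (card J) (\<lambda>i. z (\<sigma> J i))) \<in> borel_measurable (iid_seq M)"
          by (rule measurable_compose[OF m Dm[OF c1]])
        have "(\<integral>\<^sup>+z. E J z \<partial>iid_seq M) = ennreal (card J) * (\<integral>\<^sup>+z. D (card J) z \<partial>iid_seq M)"
          using False Dm' by (simp add: E_def nn_integral_cmult nn_integral_iid_seq_reindex[OF \<sigma>(1)[OF J] Dm[OF c1]])
        also have "\<dots> \<le> ennreal (card J) * ennreal (d (card J))"
          by (intro mult_left_mono d(1) c1) auto
        finally show ?thesis using False Dm' d(2) by (simp add: E_def[abs_def] ennreal_mult)
      qed
      then show "E J \<in> borel_measurable (iid_seq M)" "(\<integral>\<^sup>+z. E J z \<partial>iid_seq M) \<le> ennreal (real (card J) * d (card J))"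
        by auto
      fix g z assume g: "g \<in> \<G>" and z: "z \<in> space (iid_seq M)"
      show "ennreal \<bar>\<Sum>i\<in>J. g (z i) - (\<integral>x. g x \<partial>M)\<bar> \<le> E J z"
      proof (cases "J = {}")
        case False
        then have c1: "1 \<le> card J" using finJ by (simp add: Suc_le_eq card_gt_0_iff)
        have z': "(\<lambda>i. z (\<sigma> J i)) \<in> space (iid_seq M)" using z by (simp add: space_iid_seq)
        have "(\<Sum>i\<in>J. g (z i) - (\<integral>x. g x \<partial>M)) = dev (card J) (\<lambda>i. z (\<sigma> J i)) g"
          unfolding dev_eq by (rule sum.reindex_bij_betw[OF \<sigma>(2)[OF J], symmetric])
        then show ?thesis using D[OF c1 g z'] False by (simp add: E_def)
      qed simp
    qed
    define A where "A J z = 2 * (E J z + E ({..<n} - J) z + ennreal (B * \<bar>2 * real (card J) - n\<bar>))" for J z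
    define F where "F = {\<lambda>x. g x - c | g c. g \<in> \<G> \<and> \<bar>c\<bar> \<le> K}"
    have F: "integrable M f" if "f \<in> F" for f
      using that integrable_class by (auto simp: F_def)
    have Am: "A J \<in> borel_measurable (iid_seq M)" if "J \<subseteq> {..<n}" for J
      unfolding A_def using Em[OF that] Em[of "{..<n} - J"] by measurable
    have maj: "ennreal (0 + (\<Sum>i<n. (if i \<in> J then 2 else - 2) * f (z i))) \<le> A J z"
      if J: "J \<subseteq> {..<n}" and f: "f \<in> F" and z: "z \<in> space (iid_seq M)" for J f z
    proof -
      obtain g c where g: "g \<in> \<G>" and c: "\<bar>c\<bar> \<le> K" and f_eq: "f = (\<lambda>x. g x - c)"
        using f by (auto simp: F_def)
      define \<mu> where "\<mu> = (\<integral>x. g x \<partial>M)"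
      define J' where "J' = {..<n} - J"
      define X where "X I = (\<Sum>i\<in>I. g (z i) - \<mu>)" for I
      have finJ: "finite J" using J finite_subset by auto
      have card: "real (card J') = real n - real (card J)"
        using J finJ card_mono[OF _ J] by (simp add: J'_def card_Diff_subset of_nat_diff)
      have "(\<Sum>i<n. (if i \<in> J then 2 else - 2) * f (z i)) = (\<Sum>i\<in>J. 2 * f (z i)) + (\<Sum>i\<in>J'. - 2 * f (z i))"
      proof -
        let ?h = "\<lambda>i. (if i \<in> J then 2 else - 2) * f (z i)"
        have "(\<Sum>i<n. ?h i) = (\<Sum>i\<in>J'. ?h i) + (\<Sum>i\<in>J. ?h i)"
          unfolding J'_def by (rule sum.subset_diff[OF J]) simp
        moreover have "(\<Sum>i\<in>J'. ?h i) = (\<Sum>i\<in>J'. - 2 * f (z i))" "(\<Sum>i\<in>J. ?h i) = (\<Sum>i\<in>J. 2 * f (z i))"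
          by (intro sum.cong; auto simp: J'_def)+
        ultimately show ?thesis by linarith
      qed
      also have "\<dots> = 2 * (X J - X J' + (2 * real (card J) - n) * (\<mu> - c))"
        by (simp add: f_eq X_def sum_subtractf sum_distrib_left[symmetric] sum_negf card algebra_simps)
      also have "\<dots> \<le> 2 * (\<bar>X J\<bar> + \<bar>X J'\<bar> + B * \<bar>2 * real (card J) - n\<bar>)"
      proof -
        have "\<bar>\<mu> - c\<bar> \<le> B"
          using abs_integral_class_le[OF g] c by (simp add: B_def \<mu>_def)
        then have "\<bar>2 * real (card J) - n\<bar> * \<bar>\<mu> - c\<bar> \<le> \<bar>2 * real (card J) - n\<bar> * B"
          by (rule mult_left_mono) simp
        then have "(2 * real (card J) - n) * (\<mu> - c) \<le> B * \<bar>2 * real (card J) - n\<bar>"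
          using abs_ge_self[of "(2 * real (card J) - n) * (\<mu> - c)"] unfolding abs_mult by (simp add: mult.commute)
        moreover have "2 * (X J - X J' + p) \<le> 2 * (\<bar>X J\<bar> + \<bar>X J'\<bar> + q)" if "p \<le> q" for p q :: real
          using that abs_ge_self[of "X J"] abs_ge_minus_self[of "X J'"] by argo
        ultimately show ?thesis by blast
      qed
      finally have "ennreal (0 + (\<Sum>i<n. (if i \<in> J then 2 else - 2) * f (z i)))
          \<le> ennreal (2 * (\<bar>X J\<bar> + \<bar>X J'\<bar> + B * \<bar>2 * real (card J) - n\<bar>))"
        by (intro ennreal_leI) simp
      also have "\<dots> = 2 * (ennreal \<bar>X J\<bar> + ennreal \<bar>X J'\<bar> + ennreal (B * \<bar>2 * real (card J) - n\<bar>))"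
        using B0 by (intro ennreal_twice_sum) auto
      also have "\<dots> \<le> A J z"
        unfolding A_def X_def \<mu>_def J'_def using J
        by (intro mult_left_mono add_mono Emaj g z) auto
      finally show ?thesis .
    qed
    have "\<exists>W\<in>borel_measurable (iid_seq M).
      (\<forall>f\<in>F. \<forall>z\<in>space (iid_seq M). ennreal (0 + (\<Sum>i<n. s * (\<bar>f (z i)\<bar> - (\<integral>x. \<bar>f x\<bar> \<partial>M)))) \<le> W z) \<and>
      (\<integral>\<^sup>+z. W z \<partial>iid_seq M) = ennreal (1 / 2 ^ n) * (\<Sum>J\<in>Pow {..<n}. \<integral>\<^sup>+z. A J z \<partial>iid_seq M)"
      if "s = 1 \<or> s = -1" for s :: real
      by (rule sign_average_majorant[where off = "\<lambda>_ _. 0", OF that F Am _ maj]) auto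
    from this[of 1] this[of "-1"] obtain W1 W2 where
      W1: "W1 \<in> borel_measurable (iid_seq M)"
        "\<And>f z. f \<in> F \<Longrightarrow> z \<in> space (iid_seq M) \<Longrightarrow> ennreal (\<Sum>i<n. \<bar>f (z i)\<bar> - (\<integral>x. \<bar>f x\<bar> \<partial>M)) \<le> W1 z"
        "(\<integral>\<^sup>+z. W1 z \<partial>iid_seq M) = ennreal (1 / 2 ^ n) * (\<Sum>J\<in>Pow {..<n}. \<integral>\<^sup>+z. A J z \<partial>iid_seq M)" and
      W2: "W2 \<in> borel_measurable (iid_seq M)"
        "\<And>f z. f \<in> F \<Longrightarrow> z \<in> space (iid_seq M) \<Longrightarrow> ennreal (\<Sum>i<n. - (\<bar>f (z i)\<bar> - (\<integral>x. \<bar>f x\<bar> \<partial>M))) \<le> W2 z"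
        "(\<integral>\<^sup>+z. W2 z \<partial>iid_seq M) = ennreal (1 / 2 ^ n) * (\<Sum>J\<in>Pow {..<n}. \<integral>\<^sup>+z. A J z \<partial>iid_seq M)"
      by auto
    have intA: "(\<integral>\<^sup>+z. A J z \<partial>iid_seq M)
        \<le> ennreal (2 * (\<eta> / 16 * n + 2 * C) + 2 * B * \<bar>2 * real (card J) - n\<bar>)" if J: "J \<in> Pow {..<n}" for J
    proof -
      have J: "J \<subseteq> {..<n}" and J': "{..<n} - J \<subseteq> {..<n}" using J by auto
      have finJ: "finite J" using J finite_subset by auto
      have card: "real (card ({..<n} - J)) = real n - real (card J)"
        using J finJ card_mono[OF _ J] by (simp add: card_Diff_subset of_nat_diff)
      note [measurable] = Em[OF J] Em[OF J']
      interpret S: prob_space "iid_seq M" by (rule prob_space_iid_seq)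
      have "(\<integral>\<^sup>+z. A J z \<partial>iid_seq M) = 2 * ((\<integral>\<^sup>+z. E J z \<partial>iid_seq M) + (\<integral>\<^sup>+z. E ({..<n} - J) z \<partial>iid_seq M)
          + ennreal (B * \<bar>2 * real (card J) - n\<bar>))"
        unfolding A_def by (simp add: nn_integral_cmult nn_integral_add S.emeasure_space_1)
      also have "\<dots> \<le> 2 * (ennreal (real (card J) * d (card J)) + ennreal (real (card ({..<n} - J)) * d (card ({..<n} - J)))
          + ennreal (B * \<bar>2 * real (card J) - n\<bar>))"
        by (intro mult_left_mono add_mono intE J J') auto
      also have "\<dots> \<le> 2 * (ennreal (\<eta> / 16 * card J + C) + ennreal (\<eta> / 16 * card ({..<n} - J) + C)
          + ennreal (B * \<bar>2 * real (card J) - n\<bar>))"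
        by (intro mult_left_mono add_mono ennreal_leI kd) (auto simp: B0)
      also have "\<dots> = ennreal (2 * ((\<eta> / 16 * card J + C) + (\<eta> / 16 * card ({..<n} - J) + C)
          + B * \<bar>2 * real (card J) - n\<bar>))"
        using \<eta> C0 B0 by (intro ennreal_twice_sum[symmetric]) auto
      also have "2 * ((\<eta> / 16 * card J + C) + (\<eta> / 16 * card ({..<n} - J) + C) + B * \<bar>2 * real (card J) - n\<bar>)
          = 2 * (\<eta> / 16 * n + 2 * C) + 2 * B * \<bar>2 * real (card J) - n\<bar>"
        unfolding card by (simp add: field_simps)
      finally show ?thesis .
    qed
    have "ennreal (1 / 2 ^ n) * (\<Sum>J\<in>Pow {..<n}. \<integral>\<^sup>+z. A J z \<partial>iid_seq M)
        \<le> ennreal (1 / 2 ^ n) * (\<Sum>J\<in>Pow {..<n}. ennreal (2 * (\<eta> / 16 * n + 2 * C) + 2 * B * \<bar>2 * real (card J) - n\<bar>))"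
      by (intro mult_left_mono sum_mono intA) auto
    also have "\<dots> = ennreal (1 / 2 ^ n * (\<Sum>J\<in>Pow {..<n}. 2 * (\<eta> / 16 * n + 2 * C) + 2 * B * \<bar>2 * real (card J) - n\<bar>))"
    proof -
      define h where "h J = 2 * (\<eta> / 16 * n + 2 * C) + 2 * B * \<bar>2 * real (card J) - n\<bar>" for J :: "nat set"
      have h0: "0 \<le> h J" for J
        using \<eta> C0 B0 by (simp add: h_def)
      have "(\<Sum>J\<in>Pow {..<n}. ennreal (h J)) = ennreal (\<Sum>J\<in>Pow {..<n}. h J)"
        by (rule sum_ennreal) (rule h0)
      moreover have "ennreal (1 / 2 ^ n * (\<Sum>J\<in>Pow {..<n}. h J)) = ennreal (1 / 2 ^ n) * ennreal (\<Sum>J\<in>Pow {..<n}. h J)"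
        by (rule ennreal_mult) (simp_all add: sum_nonneg h0)
      ultimately show ?thesis
        unfolding h_def by simp
    qed
    also have "\<dots> \<le> ennreal (2 * (\<eta> / 16 * n + 2 * C) + 2 * B * sqrt n)"
    proof (rule ennreal_leI)
      have "(\<Sum>J\<in>Pow {..<n}. 2 * (\<eta> / 16 * n + 2 * C) + 2 * B * \<bar>2 * real (card J) - n\<bar>)
          = 2 ^ n * (2 * (\<eta> / 16 * n + 2 * C)) + 2 * B * (\<Sum>J\<in>Pow {..<n}. \<bar>2 * real (card J) - n\<bar>)"
        by (simp add: sum.distrib sum_distrib_left card_Pow)
      also have "\<dots> \<le> 2 ^ n * (2 * (\<eta> / 16 * n + 2 * C)) + 2 * B * (2 ^ n * sqrt n)"
        using B0 by (intro add_left_mono mult_left_mono sum_abs_signed_card_le n) auto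
      finally show "1 / 2 ^ n * (\<Sum>J\<in>Pow {..<n}. 2 * (\<eta> / 16 * n + 2 * C) + 2 * B * \<bar>2 * real (card J) - n\<bar>)
          \<le> 2 * (\<eta> / 16 * n + 2 * C) + 2 * B * sqrt n"
        by (simp add: field_simps)
    qed
    finally have bound: "ennreal (1 / 2 ^ n) * (\<Sum>J\<in>Pow {..<n}. \<integral>\<^sup>+z. A J z \<partial>iid_seq M)
        \<le> ennreal (2 * (\<eta> / 16 * n + 2 * C) + 2 * B * sqrt n)" .
    show ?thesis
    proof (intro bexI[of _ "\<lambda>z. W1 z + W2 z"] conjI ballI allI impI)
      fix g c z assume g: "g \<in> \<G>" and c: "\<bar>c\<bar> \<le> K" and z: "z \<in> space (iid_seq M)"
      then have f: "(\<lambda>x. g x - c) \<in> F" by (auto simp: F_def)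
      have eq: "(\<Sum>i<n. - (\<bar>g (z i) - c\<bar> - (\<integral>x. \<bar>g x - c\<bar> \<partial>M))) = - dev n z (\<lambda>x. \<bar>g x - c\<bar>)"
        unfolding dev_eq by (rule sum_negf)
      have "ennreal \<bar>dev n z (\<lambda>x. \<bar>g x - c\<bar>)\<bar> = ennreal (dev n z (\<lambda>x. \<bar>g x - c\<bar>)) + ennreal (- dev n z (\<lambda>x. \<bar>g x - c\<bar>))"
        by (cases "0 \<le> dev n z (\<lambda>x. \<bar>g x - c\<bar>)") (auto simp: ennreal_neg)
      also have "\<dots> \<le> W1 z + W2 z"
        using W1(2)[OF f z] W2(2)[OF f z] unfolding eq by (intro add_mono) (auto simp: dev_eq)
      finally show "ennreal \<bar>dev n z (\<lambda>x. \<bar>g x - c\<bar>)\<bar> \<le> W1 z + W2 z" .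
    next
      have "(\<integral>\<^sup>+z. W1 z + W2 z \<partial>iid_seq M) = (\<integral>\<^sup>+z. W1 z \<partial>iid_seq M) + (\<integral>\<^sup>+z. W2 z \<partial>iid_seq M)"
        using W1(1) W2(1) by (rule nn_integral_add)
      also have "\<dots> \<le> ennreal (2 * (\<eta> / 16 * n + 2 * C) + 2 * B * sqrt n) + ennreal (2 * (\<eta> / 16 * n + 2 * C) + 2 * B * sqrt n)"
        unfolding W1(3) W2(3) by (intro add_mono bound)
      also have "\<dots> = ennreal (4 * (\<eta> / 16 * n + 2 * C) + 4 * B * sqrt n)"
        using \<eta> C0 B0 by (subst ennreal_plus[symmetric]) auto
      finally show "(\<integral>\<^sup>+z. W1 z + W2 z \<partial>iid_seq M) \<le> ennreal (4 * (\<eta> / 16 * n + 2 * C) + 4 * B * sqrt n)" .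
    qed (use W1(1) W2(1) in measurable)
  qed
  have lim: "(\<lambda>n. 8 * C / real n + 4 * B * (1 / sqrt (real n))) \<longlonglongrightarrow> 8 * C * 0 + 4 * B * 0"
  proof (intro tendsto_add tendsto_mult tendsto_const)
    show "(\<lambda>n. 8 * C / real n) \<longlonglongrightarrow> 8 * C * 0"
      using lim_const_over_n[of "8 * C"] by simp
    show "(\<lambda>n. 1 / sqrt (real n)) \<longlonglongrightarrow> 0"
      using tendsto_inverse_0_at_top[OF filterlim_compose[OF sqrt_at_top filterlim_real_sequentially]]
      by (simp add: inverse_eq_divide)
  qed
  have "\<forall>\<^sub>F n in sequentially. 8 * C / real n + 4 * B * (1 / sqrt (real n)) < \<eta> / 2"
    using order_tendstoD(2)[OF lim, of "\<eta> / 2"] \<eta> by simp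
  with eventually_ge_at_top[of 1] show ?thesis
  proof eventually_elim
    case (elim n)
    have n: "0 < real n" using elim by simp
    have "real n / sqrt n = sqrt n" by (rule real_div_sqrt) simp
    then have "8 * C + 4 * B * sqrt n = (8 * C / real n + 4 * B * (1 / sqrt (real n))) * real n"
      using n by (simp add: field_simps)
    also have "\<dots> \<le> \<eta> / 2 * n"
      using elim n by (intro mult_right_mono) auto
    finally have "4 * (\<eta> / 16 * n + 2 * C) + 4 * B * sqrt n \<le> \<eta> * n"
      using mult_pos_pos[OF \<eta> n] by (simp add: distrib_left)
    then have "ennreal (4 * (\<eta> / 16 * n + 2 * C) + 4 * B * sqrt n) \<le> ennreal (\<eta> * n)"
      by (rule ennreal_leI)
    with step[OF elim(1)] show ?case by (meson order_trans)
  qed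
qed

end

section \<open>Squares as mixtures of absolute values\<close>

text \<open>
  An antiderivative of the absolute value that is valid across zero.
\<close>

lemma DERIV_mult_abs: "((\<lambda>x::real. x * \<bar>x\<bar> / 2) has_real_derivative \<bar>x\<bar>) (at x)"
proof -
  consider "0 < x" | "x < 0" | "x = 0" by linarith
  then show ?thesis
  proof cases
    case 1
    have "((\<lambda>x::real. x * x / 2) has_real_derivative x) (at x)"
      by (auto intro!: derivative_eq_intros)
    then have "((\<lambda>x::real. x * \<bar>x\<bar> / 2) has_real_derivative x) (at x)"
      by (rule has_field_derivative_transform_within_open[of _ _ _ "{0<..}"]) (use 1 in auto)
    with 1 show ?thesis by simp
  next
    case 2
    have "((\<lambda>x::real. - (x * x / 2)) has_real_derivative - x) (at x)"
      by (auto intro!: derivative_eq_intros)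
    then have "((\<lambda>x::real. x * \<bar>x\<bar> / 2) has_real_derivative - x) (at x)"
      by (rule has_field_derivative_transform_within_open[of _ _ _ "{..<0}"]) (use 2 in auto)
    with 2 show ?thesis by simp
  next
    case 3
    have "(\<lambda>h::real. \<bar>h\<bar> / 2) \<midarrow>0\<rightarrow> \<bar>0\<bar> / 2"
      by (intro tendsto_intros) auto
    moreover have "(\<lambda>h::real. \<bar>h\<bar> / 2) \<midarrow>0\<rightarrow> 0 \<longleftrightarrow> (\<lambda>h::real. h * \<bar>h\<bar> / 2 / h) \<midarrow>0\<rightarrow> 0"
      by (rule LIM_equal) simp
    ultimately show ?thesis using 3 by (simp add: DERIV_def)
  qed
qed

text \<open>
  The Huber function: it equals \<open>y\<^sup>2\<close> on \<open>[-K, K]\<close> and continues linearly with slope \<open>\<plusminus> 2 * K\<close>. This form shows it as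
  the integral of \<open>\<bar>y - c\<bar>\<close> over \<open>c \<in> [-K, K]\<close>, minus \<open>K\<^sup>2\<close>.
\<close>

definition huber :: "real \<Rightarrow> real \<Rightarrow> real" where
  "huber K y = ((K - y) * \<bar>K - y\<bar> + (K + y) * \<bar>K + y\<bar>) / 2 - K\<^sup>2"

lemma has_bochner_integral_abs_diff:
  assumes "0 \<le> K"
  shows "has_bochner_integral lborel (\<lambda>c. indicator {-K..K} c * \<bar>y - c\<bar>) (huber K y + K\<^sup>2)"
proof -
  have "has_bochner_integral lborel (\<lambda>c. indicator {-K..K} c *\<^sub>R \<bar>c - y\<bar>)
      ((K - y) * \<bar>K - y\<bar> / 2 - (- K - y) * \<bar>- K - y\<bar> / 2)"
  proof (rule has_bochner_integral_FTC_Icc)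
    fix c
    have "((\<lambda>c. (c - y) * \<bar>c - y\<bar> / 2) has_real_derivative \<bar>c - y\<bar> * 1) (at c within {-K..K})"
      by (rule DERIV_chain2[OF DERIV_mult_abs]) (auto intro!: derivative_eq_intros)
    then show "((\<lambda>c. (c - y) * \<bar>c - y\<bar> / 2) has_vector_derivative \<bar>c - y\<bar>) (at c within {-K..K})"
      by (simp add: has_real_derivative_iff_has_vector_derivative)
  qed (use assms in \<open>auto intro!: continuous_intros\<close>)
  moreover have "(K - y) * \<bar>K - y\<bar> / 2 - (- K - y) * \<bar>- K - y\<bar> / 2 = huber K y + K\<^sup>2"
  proof -
    have "\<bar>- K - y\<bar> = \<bar>K + y\<bar>" by (simp add: abs_if)
    then show ?thesis by (simp add: huber_def field_simps)
  qed
  ultimately show ?thesis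
    by (simp add: abs_minus_commute)
qed

lemma huber_bounds:
  assumes K: "0 \<le> K"
  shows "0 \<le> huber K y" "huber K y \<le> y\<^sup>2" "\<bar>y\<bar> \<le> K \<Longrightarrow> huber K y = y\<^sup>2"
proof -
  have "0 \<le> huber K y \<and> huber K y \<le> y\<^sup>2 \<and> (\<bar>y\<bar> \<le> K \<longrightarrow> huber K y = y\<^sup>2)"
  proof (cases "\<bar>y\<bar> \<le> K")
    case True
    then have "\<bar>K - y\<bar> = K - y" "\<bar>K + y\<bar> = K + y" by auto
    then have "huber K y = y\<^sup>2"
      by (simp add: huber_def power2_eq_square algebra_simps)
    then show ?thesis by simp
  next
    case False
    have "huber K y = K * \<bar>y\<bar> * 2 - K\<^sup>2"
    proof (cases "0 \<le> y")
      case True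
      with False have "\<bar>K - y\<bar> = y - K" "\<bar>K + y\<bar> = K + y" using K by auto
      then show ?thesis using True by (simp add: huber_def power2_eq_square algebra_simps)
    next
      case neg: False
      with False have "\<bar>K - y\<bar> = K - y" "\<bar>K + y\<bar> = - y - K" using K by auto
      then show ?thesis using neg by (simp add: huber_def power2_eq_square algebra_simps)
    qed
    moreover have "K * K \<le> K * \<bar>y\<bar>" using K False by (intro mult_left_mono) auto
    moreover have "0 \<le> K * \<bar>y\<bar>" using K by simp
    moreover have "0 \<le> (\<bar>y\<bar> - K)\<^sup>2" by simp
    then have "K * \<bar>y\<bar> * 2 \<le> y\<^sup>2 + K\<^sup>2" by (simp add: power2_diff algebra_simps)
    ultimately show ?thesis
      using False unfolding power2_eq_square by (intro conjI impI) linarith+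
  qed
  then show "0 \<le> huber K y" "huber K y \<le> y\<^sup>2" "\<bar>y\<bar> \<le> K \<Longrightarrow> huber K y = y\<^sup>2"
    by auto
qed

lemma abs_square_minus_huber_le:
  assumes "0 \<le> K"
  shows "\<bar>y\<^sup>2 - huber K y\<bar> \<le> y\<^sup>2 * indicator {y. K < \<bar>y\<bar>} y"
  using huber_bounds[OF assms, of y] by (cases "\<bar>y\<bar> \<le> K") (auto simp: indicator_def)

lemma measurable_huber [measurable]: "huber K \<in> borel_measurable borel"
  unfolding huber_def[abs_def] by measurable

context envelope_class
begin

text \<open>
  By Fubini's theorem the deviation of the Huber function of \<open>g\<close> is the integral over \<open>c\<close> of the deviations of
  \<open>\<bar>g - c\<bar>\<close>; the constant \<open>K\<^sup>2\<close> has no deviation.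
\<close>

lemma abs_dev_huber_le:
  assumes g: "g \<in> \<G>" and K: "0 \<le> K"
    and w: "\<And>c. \<bar>c\<bar> \<le> K \<Longrightarrow> \<bar>dev n z (\<lambda>x. \<bar>g x - c\<bar>)\<bar> \<le> w"
  shows "integrable M (\<lambda>x. huber K (g x))" and "\<bar>dev n z (\<lambda>x. huber K (g x))\<bar> \<le> 2 * K * w"
proof -
  have [measurable]: "g \<in> borel_measurable M" using g by (rule measurable_class)
  have gi: "integrable M g" using g by (rule integrable_class)
  interpret P: pair_sigma_finite M lborel by unfold_locales
  let ?f = "\<lambda>x c. indicator {-K..K} c * \<bar>g x - c\<bar>"
  note hb = has_bochner_integral_abs_diff[OF K]
  have inner: "integrable lborel (\<lambda>c. ?f x c)" "(\<integral>c. ?f x c \<partial>lborel) = huber K (g x) + K\<^sup>2" for x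
    using hb[of "g x"] by (auto simp: has_bochner_integral_iff)
  show hi: "integrable M (\<lambda>x. huber K (g x))"
  proof (rule Bochner_Integration.integrable_bound[OF envelope_square], measurable, rule AE_I2)
    fix x assume x: "x \<in> space M"
    show "norm (huber K (g x)) \<le> norm ((G x)\<^sup>2)"
      using square_le_envelope[OF g x] huber_bounds[OF K, of "g x"] by simp
  qed
  have pair: "integrable (M \<Otimes>\<^sub>M lborel) (\<lambda>(x, c). ?f x c)"
  proof (rule P.Fubini_integrable)
    show "integrable M (\<lambda>x. \<integral>c. norm (case (x, c) of (x, c) \<Rightarrow> ?f x c) \<partial>lborel)"
      using hi inner(2) by (simp add: abs_mult)
    show "AE x in M. integrable lborel (\<lambda>c. case (x, c) of (x, c) \<Rightarrow> ?f x c)"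
      using inner(1) by simp
  qed measurable
  have ic: "integrable lborel (\<lambda>c. \<integral>x. ?f x c \<partial>M)"
    using P.integrable_snd[OF pair] .
  have swap: "(\<integral>c. (\<integral>x. ?f x c \<partial>M) \<partial>lborel) = (\<integral>x. huber K (g x) + K\<^sup>2 \<partial>M)"
    using P.Fubini_integral[OF pair] inner(2) by simp
  have "dev n z (\<lambda>x. huber K (g x)) = (\<Sum>i<n. huber K (g (z i)) + K\<^sup>2) - n * (\<integral>x. huber K (g x) + K\<^sup>2 \<partial>M)"
    using hi by (simp add: dev_def sum.distrib prob_space algebra_simps)
  also have "\<dots> = (\<Sum>i<n. \<integral>c. ?f (z i) c \<partial>lborel) - n * (\<integral>c. (\<integral>x. ?f x c \<partial>M) \<partial>lborel)"
    by (simp only: inner(2) swap)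
  also have "\<dots> = (\<integral>c. (\<Sum>i<n. ?f (z i) c) - n * (\<integral>x. ?f x c \<partial>M) \<partial>lborel)"
  proof -
    have "(\<integral>c. (\<Sum>i<n. ?f (z i) c) - n * (\<integral>x. ?f x c \<partial>M) \<partial>lborel)
        = (\<integral>c. (\<Sum>i<n. ?f (z i) c) \<partial>lborel) - (\<integral>c. n * (\<integral>x. ?f x c \<partial>M) \<partial>lborel)"
      by (intro Bochner_Integration.integral_diff Bochner_Integration.integrable_sum inner(1) integrable_mult_right ic)
    also have "(\<integral>c. (\<Sum>i<n. ?f (z i) c) \<partial>lborel) = (\<Sum>i<n. \<integral>c. ?f (z i) c \<partial>lborel)"
      by (intro Bochner_Integration.integral_sum inner(1))
    also have "(\<integral>c. n * (\<integral>x. ?f x c \<partial>M) \<partial>lborel) = n * (\<integral>c. (\<integral>x. ?f x c \<partial>M) \<partial>lborel)"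
      by (rule integral_mult_right_zero)
    finally show ?thesis ..
  qed
  also have "\<dots> = (\<integral>c. indicator {-K..K} c * dev n z (\<lambda>x. \<bar>g x - c\<bar>) \<partial>lborel)"
    by (simp add: dev_def sum_distrib_left right_diff_distrib mult_ac)
  finally have eq: "dev n z (\<lambda>x. huber K (g x)) = (\<integral>c. indicator {-K..K} c * dev n z (\<lambda>x. \<bar>g x - c\<bar>) \<partial>lborel)" .
  have iw: "integrable lborel (\<lambda>c. indicator {-K..K} c * w)"
    using K by (intro integrable_mult_left integrable_real_indicator) (auto simp: emeasure_lborel_Icc)
  have id: "integrable lborel (\<lambda>c. indicator {-K..K} c * dev n z (\<lambda>x. \<bar>g x - c\<bar>))"
  proof -
    have "integrable lborel (\<lambda>c. (\<Sum>i<n. ?f (z i) c) - n * (\<integral>x. ?f x c \<partial>M))"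
      by (intro Bochner_Integration.integrable_diff Bochner_Integration.integrable_sum inner(1) integrable_mult_right ic)
    then show ?thesis
      by (simp add: dev_def sum_distrib_left right_diff_distrib mult_ac)
  qed
  have "\<bar>dev n z (\<lambda>x. huber K (g x))\<bar> \<le> (\<integral>c. \<bar>indicator {-K..K} c * dev n z (\<lambda>x. \<bar>g x - c\<bar>)\<bar> \<partial>lborel)"
    unfolding eq by (rule integral_abs_bound)
  also have "\<dots> \<le> (\<integral>c. indicator {-K..K} c * w \<partial>lborel)"
    using id iw w by (intro integral_mono integrable_abs) (auto simp: indicator_def)
  also have "\<dots> = 2 * K * w" using K by simp
  finally show "\<bar>dev n z (\<lambda>x. huber K (g x))\<bar> \<le> 2 * K * w" .
qed

lemma abs_dev_square_le:
  assumes g: "g \<in> \<G>" and K: "0 \<le> K" and z: "z \<in> space (iid_seq M)"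
    and w: "\<And>c. \<bar>c\<bar> \<le> K \<Longrightarrow> \<bar>dev n z (\<lambda>x. \<bar>g x - c\<bar>)\<bar> \<le> w"
  shows "\<bar>dev n z (\<lambda>x. (g x)\<^sup>2)\<bar> \<le> 2 * K * w + ((\<Sum>i<n. square_tail K (z i)) + n * (\<integral>x. square_tail K x \<partial>M))"
proof -
  have [measurable]: "g \<in> borel_measurable M" using g by (rule measurable_class)
  define r where "r x = (g x)\<^sup>2 - huber K (g x)" for x
  note hub = abs_dev_huber_le[OF g K w]
  have rt: "\<bar>r x\<bar> \<le> square_tail K x" if "x \<in> space M" for x
  proof -
    have "(g x)\<^sup>2 * indicator {y. K < \<bar>y\<bar>} (g x) \<le> square_tail K x"
      using envelope[OF g that] square_le_envelope[OF g that] by (auto simp: square_tail_def indicator_def)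
    then show ?thesis
      unfolding r_def using abs_square_minus_huber_le[OF K, of "g x"] by linarith
  qed
  have ri: "integrable M r"
    unfolding r_def using integrable_class_square[OF g] hub(1) by auto
  have "dev n z (\<lambda>x. (g x)\<^sup>2) = dev n z (\<lambda>x. huber K (g x)) + ((\<Sum>i<n. r (z i)) - n * (\<integral>x. r x \<partial>M))"
    unfolding dev_def r_def using integrable_class_square[OF g] hub(1)
    by (simp add: sum_subtractf algebra_simps)
  moreover have "\<bar>\<Sum>i<n. r (z i)\<bar> \<le> (\<Sum>i<n. square_tail K (z i))"
    using z by (intro order_trans[OF sum_abs] sum_mono rt) (simp add: space_iid_seq)
  moreover have "\<bar>\<integral>x. r x \<partial>M\<bar> \<le> (\<integral>x. square_tail K x \<partial>M)"
    by (intro order_trans[OF integral_abs_bound] integral_mono integrable_abs ri integrable_square_tail rt)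
  then have "\<bar>real n * (\<integral>x. r x \<partial>M)\<bar> \<le> n * (\<integral>x. square_tail K x \<partial>M)"
    by (simp add: abs_mult mult_left_mono)
  ultimately show ?thesis using hub(2) by linarith
qed

text \<open>
  First the truncation level \<open>K\<close> is chosen to make the tail of \<open>G\<^sup>2\<close> small, then the block length \<open>m\<close> according to \<open>K\<close>.
\<close>

lemma square_deviation_majorant:
  fixes d :: "nat \<Rightarrow> real" and \<eta> :: real
  assumes Dm: "\<And>k. 1 \<le> k \<Longrightarrow> D k \<in> borel_measurable (iid_seq M)"
    and D: "\<And>k g z. 1 \<le> k \<Longrightarrow> g \<in> \<G> \<Longrightarrow> z \<in> space (iid_seq M) \<Longrightarrow> ennreal \<bar>dev k z g\<bar> \<le> ennreal k * D k z"
    and d: "\<And>k. 1 \<le> k \<Longrightarrow> (\<integral>\<^sup>+z. D k z \<partial>iid_seq M) \<le> ennreal (d k)" "\<And>k. 0 \<le> d k" "d \<longlonglongrightarrow> 0"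
    and \<eta>: "0 < \<eta>"
  shows "\<exists>m\<ge>1. \<exists>Q\<in>borel_measurable (iid_seq M).
    (\<forall>g\<in>\<G>. \<forall>z\<in>space (iid_seq M). ennreal \<bar>dev m z (\<lambda>x. (g x)\<^sup>2)\<bar> \<le> Q z) \<and>
    (\<integral>\<^sup>+z. Q z \<partial>iid_seq M) \<le> ennreal (\<eta> * m)"
proof -
  obtain k :: nat where k: "(\<integral>x. square_tail (real k) x \<partial>M) < \<eta> / 4"
    using obtain_small_tail[of "\<eta> / 4"] \<eta> by auto
  \<comment> \<open>positive, since it divides the accuracy required of the absolute deviations\<close>
  define K where "K = real k + 1"
  have K: "0 < K" by (simp add: K_def)
  have tK: "(\<integral>x. square_tail K x \<partial>M) \<le> \<eta> / 4"
  proof -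
    have "square_tail K x \<le> square_tail (real k) x" for x
      by (auto simp: square_tail_def indicator_def K_def)
    then have "(\<integral>x. square_tail K x \<partial>M) \<le> (\<integral>x. square_tail (real k) x \<partial>M)"
      by (intro integral_mono integrable_square_tail)
    with k show ?thesis by linarith
  qed
  have t0: "0 \<le> (\<integral>x. square_tail K x \<partial>M)" by (simp add: square_tail_nonneg)
  have "\<forall>\<^sub>F n in sequentially. \<exists>W\<in>borel_measurable (iid_seq M).
    (\<forall>g\<in>\<G>. \<forall>c. \<bar>c\<bar> \<le> K \<longrightarrow> (\<forall>z\<in>space (iid_seq M). ennreal \<bar>dev n z (\<lambda>x. \<bar>g x - c\<bar>)\<bar> \<le> W z)) \<and>
    (\<integral>\<^sup>+z. W z \<partial>iid_seq M) \<le> ennreal (\<eta> / (4 * K) * n)"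
    using K \<eta> by (intro abs_deviation_majorant[OF Dm D d]) auto
  then obtain N where N: "\<And>n. N \<le> n \<Longrightarrow> \<exists>W\<in>borel_measurable (iid_seq M).
    (\<forall>g\<in>\<G>. \<forall>c. \<bar>c\<bar> \<le> K \<longrightarrow> (\<forall>z\<in>space (iid_seq M). ennreal \<bar>dev n z (\<lambda>x. \<bar>g x - c\<bar>)\<bar> \<le> W z)) \<and>
    (\<integral>\<^sup>+z. W z \<partial>iid_seq M) \<le> ennreal (\<eta> / (4 * K) * n)"
    unfolding eventually_sequentially by blast
  define m where "m = max 1 N"
  obtain W where Wm[measurable]: "W \<in> borel_measurable (iid_seq M)"
    and W: "\<And>g c z. g \<in> \<G> \<Longrightarrow> \<bar>c\<bar> \<le> K \<Longrightarrow> z \<in> space (iid_seq M) \<Longrightarrow> ennreal \<bar>dev m z (\<lambda>x. \<bar>g x - c\<bar>)\<bar> \<le> W z"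
    and intW: "(\<integral>\<^sup>+z. W z \<partial>iid_seq M) \<le> ennreal (\<eta> / (4 * K) * m)"
    using N[of m] by (auto simp: m_def)
  define T where "T z = (\<Sum>i<m. ennreal (square_tail K (z i)))" for z
  define Q where "Q z = ennreal (2 * K) * W z + (T z + ennreal (m * (\<integral>x. square_tail K x \<partial>M)))" for z
  have tm: "(\<lambda>z. ennreal (square_tail K (z i))) \<in> borel_measurable (iid_seq M)" for i
    using measurable_compose[OF measurable_iid_seq_component, of "\<lambda>x. ennreal (square_tail K x)" M borel i] by simp
  have Tm[measurable]: "T \<in> borel_measurable (iid_seq M)"
    unfolding T_def using tm by (intro borel_measurable_sum) auto
  have intT: "(\<integral>\<^sup>+z. T z \<partial>iid_seq M) = ennreal (m * (\<integral>x. square_tail K x \<partial>M))"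
  proof -
    have "(\<integral>\<^sup>+z. ennreal (square_tail K (z i)) \<partial>iid_seq M) = ennreal (\<integral>x. square_tail K x \<partial>M)" for i
    proof -
      have "(\<integral>\<^sup>+z. ennreal (square_tail K (z i)) \<partial>iid_seq M) = (\<integral>\<^sup>+x. ennreal (square_tail K x) \<partial>M)"
        by (rule nn_integral_distr_eq[OF measurable_iid_seq_component distr_iid_seq_component, symmetric]) simp
      then show ?thesis
        by (simp add: nn_integral_eq_integral integrable_square_tail square_tail_nonneg)
    qed
    then show ?thesis
      unfolding T_def using tm t0 by (subst nn_integral_sum) (auto simp: ennreal_of_nat_eq_real_of_nat ennreal_mult)
  qed
  interpret S: prob_space "iid_seq M" by (rule prob_space_iid_seq)
  have "(\<integral>\<^sup>+z. Q z \<partial>iid_seq M) = ennreal (2 * K) * (\<integral>\<^sup>+z. W z \<partial>iid_seq M)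
      + ((\<integral>\<^sup>+z. T z \<partial>iid_seq M) + ennreal (m * (\<integral>x. square_tail K x \<partial>M)))"
    unfolding Q_def by (simp add: nn_integral_add nn_integral_cmult S.emeasure_space_1)
  also have "\<dots> \<le> ennreal (2 * K) * ennreal (\<eta> / (4 * K) * m) + (ennreal (m * (\<integral>x. square_tail K x \<partial>M)) + ennreal (m * (\<integral>x. square_tail K x \<partial>M)))"
    unfolding intT by (intro add_mono mult_left_mono intW) auto
  also have "\<dots> = ennreal (2 * K * (\<eta> / (4 * K) * m) + (m * (\<integral>x. square_tail K x \<partial>M) + m * (\<integral>x. square_tail K x \<partial>M)))"
    using K \<eta> t0 by (simp add: ennreal_mult[symmetric] ennreal_plus[symmetric] del: ennreal_plus)
  also have "\<dots> \<le> ennreal (\<eta> * m)"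
  proof (rule ennreal_leI)
    have "2 * K * (\<eta> / (4 * K) * m) = \<eta> / 2 * m" using K by (simp add: field_simps)
    moreover have "m * (\<integral>x. square_tail K x \<partial>M) \<le> m * (\<eta> / 4)" using tK by (intro mult_left_mono) auto
    ultimately show "2 * K * (\<eta> / (4 * K) * m) + (m * (\<integral>x. square_tail K x \<partial>M) + m * (\<integral>x. square_tail K x \<partial>M)) \<le> \<eta> * m"
      by (simp add: field_simps)
  qed
  finally have intQ: "(\<integral>\<^sup>+z. Q z \<partial>iid_seq M) \<le> ennreal (\<eta> * m)" .
  show ?thesis
  proof (intro exI[of _ m] conjI bexI[of _ Q] ballI)
    fix g z assume g: "g \<in> \<G>" and z: "z \<in> space (iid_seq M)"
    show "ennreal \<bar>dev m z (\<lambda>x. (g x)\<^sup>2)\<bar> \<le> Q z"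
    proof (cases "W z = \<infinity>")
      case True
      then show ?thesis using K by (simp add: Q_def ennreal_mult_top)
    next
      case False
      then obtain w where w: "W z = ennreal w" "0 \<le> w" by (cases "W z") auto
      have "\<bar>dev m z (\<lambda>x. \<bar>g x - c\<bar>)\<bar> \<le> w" if "\<bar>c\<bar> \<le> K" for c
        using W[OF g that z] w by simp
      then have "ennreal \<bar>dev m z (\<lambda>x. (g x)\<^sup>2)\<bar> \<le> ennreal (2 * K * w + ((\<Sum>i<m. square_tail K (z i)) + m * (\<integral>x. square_tail K x \<partial>M)))"
        using K by (intro ennreal_leI abs_dev_square_le[OF g _ z]) auto
      also have "\<dots> = Q z"
        using K w(2) t0 by (simp add: Q_def T_def w(1) ennreal_mult square_tail_nonneg sum_nonneg)
      finally show ?thesis .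
    qed
  next
    show "Q \<in> borel_measurable (iid_seq M)" unfolding Q_def by measurable
    show "1 \<le> m" by (simp add: m_def)
  qed (rule intQ)
qed

end

section \<open>Squares of a Glivenko-Cantelli class\<close>

text \<open>
  Majorants that are eventually below each given level, with the level allowed to vary, can be combined: the minimum
  of the first \<open>n\<close> of them tends to zero.
\<close>

lemma as_star_tendsto_zeroI:
  assumes "\<And>j::nat. \<exists>R :: nat \<Rightarrow> 'b \<Rightarrow> real. (\<forall>n\<ge>1. R n \<in> borel_measurable N) \<and>
    (\<forall>n\<ge>1. \<forall>\<omega>\<in>space N. 0 \<le> R n \<omega> \<and> S n \<omega> \<le> ennreal (R n \<omega>)) \<and>
    (AE \<omega> in N. \<forall>\<^sub>F n in sequentially. R n \<omega> \<le> 1 / real (Suc j))"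
  shows "as_star_tendsto_zero N S"
proof -
  have "\<exists>R. \<forall>j. (\<forall>n\<ge>1. R j n \<in> borel_measurable N) \<and>
    (\<forall>n\<ge>1. \<forall>\<omega>\<in>space N. 0 \<le> R j n \<omega> \<and> S n \<omega> \<le> ennreal (R j n \<omega>)) \<and>
    (AE \<omega> in N. \<forall>\<^sub>F n in sequentially. R j n \<omega> \<le> 1 / real (Suc j))"
    by (rule choice) (rule allI, rule assms)
  then obtain R :: "nat \<Rightarrow> nat \<Rightarrow> 'b \<Rightarrow> real" where
    R': "\<forall>j. (\<forall>n\<ge>1. R j n \<in> borel_measurable N) \<and>
    (\<forall>n\<ge>1. \<forall>\<omega>\<in>space N. 0 \<le> R j n \<omega> \<and> S n \<omega> \<le> ennreal (R j n \<omega>)) \<and>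
    (AE \<omega> in N. \<forall>\<^sub>F n in sequentially. R j n \<omega> \<le> 1 / real (Suc j))" ..
  have Rm: "R j n \<in> borel_measurable N" if "1 \<le> n" for j n
    using R'[rule_format, of j] that by simp
  have R: "0 \<le> R j n \<omega> \<and> S n \<omega> \<le> ennreal (R j n \<omega>)" if "1 \<le> n" "\<omega> \<in> space N" for j n \<omega>
    using R'[rule_format, of j] that by simp
  have RAE: "AE \<omega> in N. \<forall>\<^sub>F n in sequentially. R j n \<omega> \<le> 1 / real (Suc j)" for j
    using R'[rule_format, of j] by simp
  define \<Delta> where "\<Delta> n \<omega> = Min ((\<lambda>j. R j n \<omega>) ` {..n})" for n \<omega>
  have in_img: "\<Delta> n \<omega> \<in> (\<lambda>j. R j n \<omega>) ` {..n}" for n \<omega>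
    unfolding \<Delta>_def by (rule Min_in) auto
  have le: "\<Delta> n \<omega> \<le> R j n \<omega>" if "j \<le> n" for j n \<omega>
    unfolding \<Delta>_def using that by (intro Min_le) auto
  have bd: "0 \<le> \<Delta> n \<omega> \<and> S n \<omega> \<le> ennreal (\<Delta> n \<omega>)" if "1 \<le> n" "\<omega> \<in> space N" for n \<omega>
  proof -
    obtain j where "\<Delta> n \<omega> = R j n \<omega>" using in_img[of n \<omega>] by auto
    then show ?thesis using R[OF that, of j] by simp
  qed
  show ?thesis
    unfolding as_star_tendsto_zero_def
  proof (intro exI[of _ \<Delta>] conjI allI impI ballI)
    show "\<Delta> n \<in> borel_measurable N" if "1 \<le> n" for n
      unfolding \<Delta>_def[abs_def] using Rm[OF that] by (intro borel_measurable_Min) auto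
    have "AE \<omega> in N. \<forall>j. \<forall>\<^sub>F n in sequentially. R j n \<omega> \<le> 1 / real (Suc j)"
      using RAE by (simp add: AE_all_countable)
    with AE_space show "AE \<omega> in N. (\<lambda>n. \<Delta> n \<omega>) \<longlonglongrightarrow> 0"
    proof eventually_elim
      case (elim \<omega>)
      show ?case
      proof (rule LIMSEQ_I)
        fix r :: real assume "0 < r"
        then obtain j where j: "1 / real (Suc j) < r"
          using nat_approx_posE by blast
        have "\<forall>\<^sub>F n in sequentially. R j n \<omega> \<le> 1 / real (Suc j) \<and> max 1 j \<le> n"
          by (rule eventually_conj[OF elim(2)[rule_format] eventually_ge_at_top])
        then obtain n0 where n0: "\<And>n. n0 \<le> n \<Longrightarrow> R j n \<omega> \<le> 1 / real (Suc j) \<and> max 1 j \<le> n"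
          unfolding eventually_sequentially by blast
        show "\<exists>no. \<forall>n\<ge>no. norm (\<Delta> n \<omega> - 0) < r"
        proof (intro exI[of _ n0] allI impI)
          fix n assume "n0 \<le> n"
          then show "norm (\<Delta> n \<omega> - 0) < r"
            using n0[of n] le[of j n \<omega>] bd[OF _ elim(1), of n] j by auto
        qed
      qed
    qed
  qed (use bd in auto)
qed

context envelope_class
begin

lemma AE_eventually_square_tail_sum_le:
  "AE z in iid_seq M. \<forall>k::nat. \<forall>\<^sub>F n in sequentially.
    (\<Sum>i<n. square_tail (real k) (z i)) \<le> ((\<integral>x. square_tail (real k) x \<partial>M) + 1 / real (Suc k)) * n"
  unfolding AE_all_countable
  by (intro allI AE_eventually_sum_le integrable_square_tail) simp

text \<open>
  The majorants in the definition of a Glivenko-Cantelli class need not be integrable. Their minimum with the crude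
  bound from the envelope is, and it tends to zero in mean: after subtraction of the averages of a small tail of \<open>G\<close>,
  it is bounded, and dominated convergence applies.
\<close>

lemma gc_majorant:
  assumes gc: "glivenko_cantelli M \<G>"
  obtains \<Delta> :: "nat \<Rightarrow> (nat \<Rightarrow> 'a) \<Rightarrow> real" and d :: "nat \<Rightarrow> real"
  where "\<And>n. 1 \<le> n \<Longrightarrow> \<Delta> n \<in> borel_measurable (iid_seq M)"
    and "\<And>n z. 1 \<le> n \<Longrightarrow> z \<in> space (iid_seq M) \<Longrightarrow> 0 \<le> \<Delta> n z"
    and "\<And>n g z. 1 \<le> n \<Longrightarrow> g \<in> \<G> \<Longrightarrow> z \<in> space (iid_seq M) \<Longrightarrow> \<bar>dev n z g\<bar> \<le> n * \<Delta> n z"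
    and "AE z in iid_seq M. (\<lambda>n. \<Delta> n z) \<longlonglongrightarrow> 0"
    and "\<And>n. 1 \<le> n \<Longrightarrow> (\<integral>\<^sup>+z. ennreal (\<Delta> n z) \<partial>iid_seq M) \<le> ennreal (d n)"
    and "\<And>n. 0 \<le> d n" and "d \<longlonglongrightarrow> 0"
proof -
  interpret S: prob_space "iid_seq M" by (rule prob_space_iid_seq)
  obtain \<Delta> :: "nat \<Rightarrow> (nat \<Rightarrow> 'a) \<Rightarrow> real" where
    \<Delta>m: "\<And>n. 1 \<le> n \<Longrightarrow> \<Delta> n \<in> borel_measurable (iid_seq M)" and
    \<Delta>: "\<And>n z. 1 \<le> n \<Longrightarrow> z \<in> space (iid_seq M) \<Longrightarrow> 0 \<le> \<Delta> n z \<and>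
      (SUP g\<in>\<G>. ennreal \<bar>(\<integral>x. g x \<partial>empirical_measure M n z) - (\<integral>x. g x \<partial>M)\<bar>) \<le> ennreal (\<Delta> n z)" and
    \<Delta>AE: "AE z in iid_seq M. (\<lambda>n. \<Delta> n z) \<longlonglongrightarrow> 0"
    using gc unfolding glivenko_cantelli_def as_star_tendsto_zero_def by blast
  define B where "B = (\<integral>x. G x \<partial>M)"
  have B0: "0 \<le> B" unfolding B_def using envelope_nonneg by (intro integral_nonneg_AE AE_I2)
  define crude where "crude n z = (\<Sum>i<n. G (z i)) / n + B" for n :: nat and z :: "nat \<Rightarrow> 'a"
  define E where "E n z = min (\<Delta> n z) (crude n z)" for n z
  have sumG: "(\<lambda>z. \<Sum>i<n. f (z i)) \<in> borel_measurable (iid_seq M)" if "f \<in> borel_measurable M" for f :: "'a \<Rightarrow> real" and n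
    using borel_measurable_iid_seq_component[OF that] by (intro borel_measurable_sum) auto
  have cm: "crude n \<in> borel_measurable (iid_seq M)" for n
    unfolding crude_def using sumG[of G n] by simp
  have c0: "0 \<le> crude n z" if "z \<in> space (iid_seq M)" for n z
    unfolding crude_def using that B0 envelope_nonneg
    by (intro add_nonneg_nonneg divide_nonneg_nonneg sum_nonneg) (auto simp: space_iid_seq)
  have Em: "E n \<in> borel_measurable (iid_seq M)" if "1 \<le> n" for n
    unfolding E_def using \<Delta>m[OF that] cm[of n] by simp
  have E0: "0 \<le> E n z" if "1 \<le> n" "z \<in> space (iid_seq M)" for n z
    using \<Delta>[OF that] c0[OF that(2), of n] by (simp add: E_def)
  have dev_le: "\<bar>dev n z g\<bar> \<le> n * E n z" if n: "1 \<le> n" and g: "g \<in> \<G>" and z: "z \<in> space (iid_seq M)" for n g z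
  proof -
    have zs: "z i \<in> space M" for i using z by (simp add: space_iid_seq)
    have emp: "(\<integral>x. g x \<partial>empirical_measure M n z) - (\<integral>x. g x \<partial>M) = dev n z g / n"
      using n by (simp add: integral_empirical_measure[OF n zs measurable_class[OF g]] dev_def field_simps)
    have "ennreal \<bar>dev n z g / n\<bar> \<le> (SUP g\<in>\<G>. ennreal \<bar>(\<integral>x. g x \<partial>empirical_measure M n z) - (\<integral>x. g x \<partial>M)\<bar>)"
      unfolding emp[symmetric] using g by (rule SUP_upper)
    also have "\<dots> \<le> ennreal (\<Delta> n z)" using \<Delta>[OF n z] by simp
    finally have 1: "\<bar>dev n z g / n\<bar> \<le> \<Delta> n z"
      using \<Delta>[OF n z] by (subst (asm) ennreal_le_iff) auto
    have "\<bar>dev n z g\<bar> \<le> \<bar>\<Sum>i<n. g (z i)\<bar> + \<bar>n * (\<integral>x. g x \<partial>M)\<bar>"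
      unfolding dev_def by (rule abs_triangle_ineq4)
    also have "\<dots> \<le> (\<Sum>i<n. G (z i)) + n * B"
      using abs_integral_class_le[OF g] envelope[OF g zs] unfolding B_def
      by (intro add_mono order_trans[OF sum_abs] sum_mono) (auto simp: abs_mult intro!: mult_left_mono)
    also have "\<dots> = n * crude n z"
      using n by (simp add: crude_def field_simps)
    finally have "\<bar>dev n z g\<bar> \<le> n * crude n z" .
    then have 2: "\<bar>dev n z g / n\<bar> \<le> crude n z" using n by (simp add: field_simps)
    from 1 2 have "\<bar>dev n z g / n\<bar> \<le> E n z" by (simp add: E_def)
    then show ?thesis using n by (simp add: field_simps)
  qed
  have ci: "integrable (iid_seq M) (crude n)" for n
    unfolding crude_def using integral_sum_iid_seq(1)[OF integrable_envelope, of n] by auto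
  have Ei: "integrable (iid_seq M) (E n)" if "1 \<le> n" for n
    by (rule Bochner_Integration.integrable_bound[OF ci[of n] Em[OF that]])
      (use E0[OF that] c0 in \<open>auto simp: E_def intro!: AE_I2\<close>)
  define d where "d n = (if 1 \<le> n then \<integral>z. E n z \<partial>iid_seq M else 0)" for n
  have d0: "0 \<le> d n" for n
    unfolding d_def using E0 by (auto intro!: integral_nonneg_AE AE_I2)
  have "d \<longlonglongrightarrow> 0"
  proof (rule LIMSEQ_I)
    fix \<epsilon> :: real assume \<epsilon>: "0 < \<epsilon>"
    obtain k :: nat where k: "(\<integral>x. square_tail (real k) x \<partial>M) < \<epsilon> / 2"
      using obtain_small_tail[of "\<epsilon> / 2"] \<epsilon> by auto
    \<comment> \<open>at least \<open>1\<close>, so that \<open>G \<le> G\<^sup>2\<close> above \<open>K\<close>\<close>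
    define K where "K = real k + 1"
    have G_le: "G x \<le> K + square_tail (real k) x" if "x \<in> space M" for x
    proof (cases "K < G x")
      case True
      then have "1 \<le> G x" "real k < G x" by (auto simp: K_def)
      then have "G x \<le> (G x)\<^sup>2" by (simp add: power2_eq_square)
      with \<open>real k < G x\<close> show ?thesis by (simp add: square_tail_def K_def)
    qed (simp add: square_tail_nonneg add_increasing2)
    have E_le: "E n z \<le> min (\<Delta> n z) (K + B) + (\<Sum>i<n. square_tail (real k) (z i)) / n"
      if n: "1 \<le> n" and z: "z \<in> space (iid_seq M)" for n z
    proof -
      have "(\<Sum>i<n. G (z i)) \<le> (\<Sum>i<n. K + square_tail (real k) (z i))"
        using z by (intro sum_mono G_le) (simp add: space_iid_seq)
      then have "(\<Sum>i<n. G (z i)) / n \<le> K + (\<Sum>i<n. square_tail (real k) (z i)) / n"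
        using n by (simp add: sum.distrib field_simps)
      then have "crude n z \<le> K + B + (\<Sum>i<n. square_tail (real k) (z i)) / n"
        by (simp add: crude_def)
      moreover have "0 \<le> (\<Sum>i<n. square_tail (real k) (z i)) / n"
        by (intro divide_nonneg_nonneg sum_nonneg square_tail_nonneg) auto
      ultimately show ?thesis by (auto simp: E_def min_def)
    qed
    have KB: "0 \<le> K + B" using B0 by (simp add: K_def)
    have lim: "(\<lambda>n. \<integral>z. min (\<Delta> (Suc n) z) (K + B) \<partial>iid_seq M) \<longlonglongrightarrow> (\<integral>z. 0 \<partial>iid_seq M)"
    proof (rule integral_dominated_convergence[where w = "\<lambda>_. K + B"])
      show "AE z in iid_seq M. (\<lambda>n. min (\<Delta> (Suc n) z) (K + B)) \<longlonglongrightarrow> 0"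
        using \<Delta>AE
      proof eventually_elim
        case (elim z)
        have "(\<lambda>n. min (\<Delta> (Suc n) z) (K + B)) \<longlonglongrightarrow> min 0 (K + B)"
          by (intro tendsto_min tendsto_const LIMSEQ_Suc[OF elim])
        then show ?case using KB by (simp add: min_absorb1)
      qed
      show "AE z in iid_seq M. norm (min (\<Delta> (Suc n) z) (K + B)) \<le> K + B" for n
        using \<Delta>[of "Suc n"] KB by (intro AE_I2) auto
      show "(\<lambda>z. min (\<Delta> (Suc n) z) (K + B)) \<in> borel_measurable (iid_seq M)" for n
        using \<Delta>m[of "Suc n"] by simp
    qed auto
    then have "(\<lambda>n. \<integral>z. min (\<Delta> (Suc n) z) (K + B) \<partial>iid_seq M) \<longlonglongrightarrow> 0" by simp
    from order_tendstoD(2)[OF this, of "\<epsilon> / 2"] \<epsilon>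
    obtain n0 where n0: "\<And>n. n0 \<le> n \<Longrightarrow> (\<integral>z. min (\<Delta> (Suc n) z) (K + B) \<partial>iid_seq M) < \<epsilon> / 2"
      by (auto simp: eventually_sequentially)
    show "\<exists>no. \<forall>n\<ge>no. norm (d n - 0) < \<epsilon>"
    proof (intro exI[of _ "Suc n0"] allI impI)
      fix n assume n: "Suc n0 \<le> n"
      then obtain n' where n': "n = Suc n'" "n0 \<le> n'" by (cases n) auto
      have n1: "1 \<le> n" using n by simp
      have i1: "integrable (iid_seq M) (\<lambda>z. min (\<Delta> n z) (K + B))"
        by (rule S.integrable_const_bound[where B = "K + B"])
          (use \<Delta>[OF n1] \<Delta>m[OF n1] KB in \<open>auto intro!: AE_I2\<close>)
      have i2: "integrable (iid_seq M) (\<lambda>z. (\<Sum>i<n. square_tail (real k) (z i)) / n)"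
        using integral_sum_iid_seq(1)[OF integrable_square_tail, of "real k" n] by auto
      have "d n \<le> (\<integral>z. min (\<Delta> n z) (K + B) + (\<Sum>i<n. square_tail (real k) (z i)) / n \<partial>iid_seq M)"
      proof -
        have "d n = (\<integral>z. E n z \<partial>iid_seq M)" using n1 by (simp only: d_def if_True)
        then show ?thesis
          using integral_mono[OF Ei[OF n1] Bochner_Integration.integrable_add[OF i1 i2] E_le[OF n1]] by (simp only:)
      qed
      also have "\<dots> = (\<integral>z. min (\<Delta> n z) (K + B) \<partial>iid_seq M) + (\<integral>x. square_tail (real k) x \<partial>M)"
        using i1 i2 n1 integral_sum_iid_seq(2)[OF integrable_square_tail, of "real k" n] by simp
      also have "\<dots> < \<epsilon> / 2 + \<epsilon> / 2"
        using n0[OF n'(2)] k unfolding n'(1) by (rule add_strict_mono)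
      finally show "norm (d n - 0) < \<epsilon>" using d0[of n] by simp
    qed
  qed
  moreover have "AE z in iid_seq M. (\<lambda>n. E n z) \<longlonglongrightarrow> 0"
    using \<Delta>AE AE_space
  proof eventually_elim
    case (elim z)
    show ?case
    proof (rule tendsto_sandwich[OF _ _ tendsto_const elim(1)])
      show "\<forall>\<^sub>F n in sequentially. 0 \<le> E n z"
        using eventually_ge_at_top[of 1] by eventually_elim (rule E0[OF _ elim(2)])
      show "\<forall>\<^sub>F n in sequentially. E n z \<le> \<Delta> n z"
        by (simp add: E_def)
    qed
  qed
  moreover have "(\<integral>\<^sup>+z. ennreal (E n z) \<partial>iid_seq M) \<le> ennreal (d n)" if "1 \<le> n" for n
    using nn_integral_eq_integral[OF Ei[OF that]] E0[OF that] that by (simp add: d_def AE_I2)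
  ultimately show ?thesis
    using that[of E d] Em E0 dev_le d0 by blast
qed

text \<open>
  Fix a block length \<open>m\<close> for which the majorant of the deviation of squares has mean at most \<open>\<eta> * m\<close>. The deviation
  over \<open>n\<close> observations is at most the sum of the deviations over the blocks, to which the law of large numbers for
  blocks applies, plus the contribution of fewer than \<open>m\<close> remaining observations. The latter is at most a
  constant multiple of \<open>m\<close> plus the sum of a small tail of \<open>G\<^sup>2\<close> over the whole sample.
\<close>

lemma gc_squares:
  assumes gc: "glivenko_cantelli M \<G>"
  shows "as_star_tendsto_zero (iid_seq M) (\<lambda>n z. SUP g\<in>\<G>. ennreal (\<bar>dev n z (\<lambda>x. (g x)\<^sup>2)\<bar> / n))"
proof (rule gc_majorant[OF gc])
  fix \<Delta> :: "nat \<Rightarrow> (nat \<Rightarrow> 'a) \<Rightarrow> real" and d :: "nat \<Rightarrow> real"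
  assume \<Delta>: "\<And>n. 1 \<le> n \<Longrightarrow> \<Delta> n \<in> borel_measurable (iid_seq M)"
    "\<And>n z. 1 \<le> n \<Longrightarrow> z \<in> space (iid_seq M) \<Longrightarrow> 0 \<le> \<Delta> n z"
    "\<And>n g z. 1 \<le> n \<Longrightarrow> g \<in> \<G> \<Longrightarrow> z \<in> space (iid_seq M) \<Longrightarrow> \<bar>dev n z g\<bar> \<le> n * \<Delta> n z"
    "AE z in iid_seq M. (\<lambda>n. \<Delta> n z) \<longlonglongrightarrow> 0"
    "\<And>n. 1 \<le> n \<Longrightarrow> (\<integral>\<^sup>+z. ennreal (\<Delta> n z) \<partial>iid_seq M) \<le> ennreal (d n)"
    "\<And>n. 0 \<le> d n" "d \<longlonglongrightarrow> 0"
  show ?thesis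
  proof (rule as_star_tendsto_zeroI)
    fix j :: nat
    interpret S: prob_space "iid_seq M" by (rule prob_space_iid_seq)
    define \<eta> where "\<eta> = 1 / (4 * real (Suc j))"
    have \<eta>: "0 < \<eta>" by (simp add: \<eta>_def)
    have "\<exists>m\<ge>1. \<exists>Q\<in>borel_measurable (iid_seq M).
      (\<forall>g\<in>\<G>. \<forall>z\<in>space (iid_seq M). ennreal \<bar>dev m z (\<lambda>x. (g x)\<^sup>2)\<bar> \<le> Q z) \<and>
      (\<integral>\<^sup>+z. Q z \<partial>iid_seq M) \<le> ennreal (\<eta> * m)"
    proof (rule square_deviation_majorant[where D = "\<lambda>k z. ennreal (\<Delta> k z)", OF _ _ _ \<Delta>(6,7) \<eta>])
      show "ennreal \<bar>dev k z g\<bar> \<le> ennreal k * ennreal (\<Delta> k z)"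
        if "1 \<le> k" "g \<in> \<G>" "z \<in> space (iid_seq M)" for k g z
        using \<Delta>(2,3)[OF that(1)] that by (simp add: ennreal_mult[symmetric] ennreal_leI)
    qed (use \<Delta>(1,5) in auto)
    then obtain m Q where m: "1 \<le> m" and Qm[measurable]: "Q \<in> borel_measurable (iid_seq M)"
      and Q: "\<And>g z. g \<in> \<G> \<Longrightarrow> z \<in> space (iid_seq M) \<Longrightarrow> ennreal \<bar>dev m z (\<lambda>x. (g x)\<^sup>2)\<bar> \<le> Q z"
      and intQ: "(\<integral>\<^sup>+z. Q z \<partial>iid_seq M) \<le> ennreal (\<eta> * m)"
      by blast
    define \<mu> where "\<mu> = (\<integral>x. (G x)\<^sup>2 \<partial>M)"
    have \<mu>0: "0 \<le> \<mu>" by (simp add: \<mu>_def)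
    have sqm: "(\<lambda>z. (G (z i))\<^sup>2) \<in> borel_measurable (iid_seq M)" for i
      by (rule borel_measurable_iid_seq_component) simp
    define c where "c z = (\<Sum>i<m. (G (z i))\<^sup>2 + \<mu>)" for z
    have cm[measurable]: "c \<in> borel_measurable (iid_seq M)"
      unfolding c_def using sqm by simp
    have c0: "0 \<le> c z" for z unfolding c_def using \<mu>0 by (intro sum_nonneg) auto
    have term_le: "\<bar>(g x)\<^sup>2 - (\<integral>x. (g x)\<^sup>2 \<partial>M)\<bar> \<le> (G x)\<^sup>2 + \<mu>" if "g \<in> \<G>" "x \<in> space M" for g x
    proof -
      have nonneg: "0 \<le> (\<integral>x. (g x)\<^sup>2 \<partial>M)" by simp
      show ?thesis
        using square_le_envelope[OF that] integral_class_square_le[OF that(1)] nonneg zero_le_power2[of "g x"]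
        unfolding \<mu>_def by linarith
    qed
    \<comment> \<open>the envelope bound \<open>c\<close> makes the majorant finite everywhere\<close>
    define Q2 where "Q2 z = min (Q z) (ennreal (c z))" for z
    have Q2m[measurable]: "Q2 \<in> borel_measurable (iid_seq M)" unfolding Q2_def by measurable
    have Q2: "ennreal \<bar>dev m z (\<lambda>x. (g x)\<^sup>2)\<bar> \<le> Q2 z" if g: "g \<in> \<G>" and z: "z \<in> space (iid_seq M)" for g z
    proof -
      have "\<bar>dev m z (\<lambda>x. (g x)\<^sup>2)\<bar> \<le> c z"
        unfolding dev_eq c_def using z
        by (intro order_trans[OF sum_abs] sum_mono term_le[OF g]) (simp add: space_iid_seq)
      then show ?thesis using Q[OF g z] by (simp add: Q2_def ennreal_leI)
    qed
    \<comment> \<open>the deviation over a block depends on the first \<open>m\<close> coordinates only, so integrating out the others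
      preserves the majorant and makes it a function of the block\<close>
    define q where "q z = (\<integral>\<^sup>+v. Q2 (comb_seq m z v) \<partial>iid_seq M)" for z
    have qm[measurable]: "q \<in> borel_measurable (iid_seq M)"
      unfolding q_def
      using S.borel_measurable_nn_integral_fst[OF measurable_compose[OF measurable_iid_seq_comb Q2m]] by simp
    have q_le: "q z \<le> ennreal (c z)" for z
    proof -
      have "Q2 (comb_seq m z v) \<le> ennreal (c z)" for v
        by (simp add: Q2_def c_def comb_seq_less min.coboundedI2)
      then have "q z \<le> (\<integral>\<^sup>+v. ennreal (c z) \<partial>iid_seq M)"
        unfolding q_def by (intro nn_integral_mono)
      then show ?thesis by (simp add: S.emeasure_space_1)
    qed
    have q_ge: "ennreal \<bar>dev m z (\<lambda>x. (g x)\<^sup>2)\<bar> \<le> q z" if g: "g \<in> \<G>" and z: "z \<in> space (iid_seq M)" for g z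
    proof -
      have "ennreal \<bar>dev m z (\<lambda>x. (g x)\<^sup>2)\<bar> = (\<integral>\<^sup>+v. ennreal \<bar>dev m z (\<lambda>x. (g x)\<^sup>2)\<bar> \<partial>iid_seq M)"
        by (simp add: S.emeasure_space_1)
      also have "\<dots> \<le> q z"
        unfolding q_def
      proof (rule nn_integral_mono)
        fix v assume v: "v \<in> space (iid_seq M)"
        have "dev m z (\<lambda>x. (g x)\<^sup>2) = dev m (comb_seq m z v) (\<lambda>x. (g x)\<^sup>2)"
          by (simp add: dev_def comb_seq_less)
        then show "ennreal \<bar>dev m z (\<lambda>x. (g x)\<^sup>2)\<bar> \<le> Q2 (comb_seq m z v)"
          using Q2[OF g space_iid_seq_comb[OF z v, of m]] by simp
      qed
      finally show ?thesis .
    qed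
    define X where "X z = enn2real (q z)" for z
    have qX: "q z = ennreal (X z)" for z
      using q_le[of z] by (simp add: X_def top.not_eq_extremum le_less_trans)
    have X0: "0 \<le> X z" for z by (simp add: X_def)
    have Xm[measurable]: "X \<in> borel_measurable (iid_seq M)" unfolding X_def by measurable
    have nnX: "(\<integral>\<^sup>+z. ennreal (X z) \<partial>iid_seq M) \<le> ennreal (\<eta> * m)"
    proof -
      have "(\<integral>\<^sup>+z. q z \<partial>iid_seq M) = (\<integral>\<^sup>+z. Q2 z \<partial>iid_seq M)"
        unfolding q_def by (rule nn_integral_iid_seq_comb[OF Q2m])
      also have "\<dots> \<le> (\<integral>\<^sup>+z. Q z \<partial>iid_seq M)"
        by (intro nn_integral_mono) (simp add: Q2_def)
      finally show ?thesis using intQ by (simp add: qX)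
    qed
    have Xi: "integrable (iid_seq M) X"
      using nnX X0 by (intro integrableI_nonneg) (auto intro: order_le_less_trans)
    have EX: "(\<integral>z. X z \<partial>iid_seq M) \<le> \<eta> * m"
      using nnX nn_integral_eq_integral[OF Xi] X0 \<eta> by (simp add: ennreal_le_iff)
    have Xdep: "X (comb_seq m u v) = X u" for u v
    proof -
      have "comb_seq m (comb_seq m u v) w = comb_seq m u w" for w
        by (auto simp: comb_seq_def fun_eq_iff)
      then show ?thesis by (simp add: X_def q_def)
    qed
    define R where "R n z = ((\<Sum>l<n div m. X (shift_seq (l * m) z)) + (\<Sum>i\<in>{n div m * m..<n}. (G (z i))\<^sup>2 + \<mu>)) / n" for n z
    have R_maj: "\<bar>dev n z (\<lambda>x. (g x)\<^sup>2)\<bar> / n \<le> R n z" if g: "g \<in> \<G>" and z: "z \<in> space (iid_seq M)" for n g z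
    proof -
      define h where "h i = (g (z i))\<^sup>2 - (\<integral>x. (g x)\<^sup>2 \<partial>M)" for i
      define k where "k = n div m"
      have split: "(\<Sum>i<n. h i) = (\<Sum>l<k. \<Sum>i\<in>{l * m..<l * m + m}. h i) + (\<Sum>i\<in>{k * m..<n}. h i)"
      proof -
        have "k * m \<le> n" by (simp add: k_def)
        then have "{..<n} = {..<k * m} \<union> {k * m..<n}" by auto
        then have "(\<Sum>i<n. h i) = (\<Sum>i<k * m. h i) + (\<Sum>i\<in>{k * m..<n}. h i)"
          by (simp add: sum.union_disjoint ivl_disj_int)
        then show ?thesis by (simp add: sum.nat_group)
      qed
      have block: "\<bar>\<Sum>i\<in>{l * m..<l * m + m}. h i\<bar> \<le> X (shift_seq (l * m) z)" for l
      proof -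
        have "(\<Sum>i\<in>{l * m..<l * m + m}. h i) = (\<Sum>i<m. h (l * m + i))"
          by (rule sum.reindex_bij_witness[of _ "\<lambda>i. l * m + i" "\<lambda>i. i - l * m"]) auto
        also have "\<dots> = dev m (shift_seq (l * m) z) (\<lambda>x. (g x)\<^sup>2)"
          by (simp add: dev_eq h_def shift_seq_def)
        finally have eq: "(\<Sum>i\<in>{l * m..<l * m + m}. h i) = dev m (shift_seq (l * m) z) (\<lambda>x. (g x)\<^sup>2)" .
        have "shift_seq (l * m) z \<in> space (iid_seq M)"
          using z by (simp add: space_iid_seq shift_seq_def)
        then have "ennreal \<bar>dev m (shift_seq (l * m) z) (\<lambda>x. (g x)\<^sup>2)\<bar> \<le> ennreal (X (shift_seq (l * m) z))"
          using q_ge[OF g] qX by simp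
        then show ?thesis unfolding eq using X0 by (simp add: ennreal_le_iff)
      qed
      have "\<bar>dev n z (\<lambda>x. (g x)\<^sup>2)\<bar> = \<bar>\<Sum>i<n. h i\<bar>" by (simp add: dev_eq h_def)
      also have "\<dots> \<le> \<bar>\<Sum>l<k. \<Sum>i\<in>{l * m..<l * m + m}. h i\<bar> + \<bar>\<Sum>i\<in>{k * m..<n}. h i\<bar>"
        unfolding split by (rule abs_triangle_ineq)
      also have "\<dots> \<le> (\<Sum>l<k. X (shift_seq (l * m) z)) + (\<Sum>i\<in>{k * m..<n}. (G (z i))\<^sup>2 + \<mu>)"
        using z unfolding h_def
        by (intro add_mono order_trans[OF sum_abs] sum_mono block[unfolded h_def] term_le[OF g])
          (simp add: space_iid_seq)
      finally show ?thesis
        unfolding R_def k_def by (rule divide_right_mono) simp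
    qed
    have R0: "0 \<le> R n z" for n z
      unfolding R_def using X0 \<mu>0 by (intro divide_nonneg_nonneg add_nonneg_nonneg sum_nonneg) auto
    have Rm: "R n \<in> borel_measurable (iid_seq M)" for n
      unfolding R_def using sqm by measurable
    have "AE z in iid_seq M. \<forall>\<^sub>F n in sequentially. R n z \<le> 4 * \<eta>"
    proof -
      obtain k0 :: nat where k0: "(\<integral>x. square_tail (real k0) x \<partial>M) < \<eta>"
        using obtain_small_tail[OF \<eta>] by auto
      have "AE z in iid_seq M. \<forall>\<^sub>F k in sequentially. (\<Sum>l<k. X (shift_seq (l * m) z)) \<le> 2 * \<eta> * m * real k"
      proof (rule AE_eventually_block_sum_le[OF Xi Xdep])
        have "0 < \<eta> * m" using \<eta> m by simp
        then show "(\<integral>z. X z \<partial>iid_seq M) < 2 * \<eta> * m" using EX by linarith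
      qed
      moreover have "AE z in iid_seq M. \<forall>\<^sub>F n in sequentially. (\<Sum>i<n. square_tail (real k0) (z i)) \<le> \<eta> * real n"
        using k0 by (rule AE_eventually_sum_le[OF integrable_square_tail])
      ultimately show ?thesis
        using AE_space
      proof eventually_elim
        case (elim z)
        have "filterlim (\<lambda>n. n div m) sequentially sequentially"
          using m by (intro filterlim_at_top_div_const_nat) simp
        from eventually_compose_filterlim[OF elim(1) this]
        have blocks: "\<forall>\<^sub>F n in sequentially. (\<Sum>l<n div m. X (shift_seq (l * m) z)) \<le> 2 * \<eta> * m * real (n div m)" .
        define C where "C = real m * ((real k0)\<^sup>2 + \<mu>)"
        have "\<forall>\<^sub>F n in sequentially. C / real n < \<eta>"
          using order_tendstoD(2)[OF lim_const_over_n[of C] \<eta>] .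
        with blocks elim(2) eventually_ge_at_top[of 1] show ?case
        proof eventually_elim
          case (elim n)
          have zs: "z i \<in> space M" for i using \<open>z \<in> space (iid_seq M)\<close> by (simp add: space_iid_seq)
          have n: "0 < real n" using elim(3) by simp
          have le_n: "m * (n div m) \<le> n" by simp
          have "2 * \<eta> * m * real (n div m) = 2 * \<eta> * real (m * (n div m))" by simp
          also have "\<dots> \<le> 2 * \<eta> * real n"
            using \<eta> by (intro mult_left_mono of_nat_mono le_n) auto
          finally have 1: "(\<Sum>l<n div m. X (shift_seq (l * m) z)) \<le> 2 * \<eta> * n"
            using elim(1) by linarith
          have "(\<Sum>i\<in>{n div m * m..<n}. (G (z i))\<^sup>2 + \<mu>) \<le> (\<Sum>i\<in>{n div m * m..<n}. ((real k0)\<^sup>2 + \<mu>) + square_tail (real k0) (z i))"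
            using square_le_tail[of "real k0", OF _ zs] by (intro sum_mono) (simp add: add.assoc add_le_imp_le_diff algebra_simps)
          also have "\<dots> = real (n - n div m * m) * ((real k0)\<^sup>2 + \<mu>) + (\<Sum>i\<in>{n div m * m..<n}. square_tail (real k0) (z i))"
            by (simp add: sum.distrib distrib_left)
          also have "\<dots> \<le> C + (\<Sum>i<n. square_tail (real k0) (z i))"
            unfolding C_def
          proof (intro add_mono mult_right_mono sum_mono2)
            have "n - n div m * m = n mod m" by (simp add: minus_div_mult_eq_mod)
            also have "\<dots> \<le> m" using m by (simp add: less_imp_le)
            finally show "real (n - n div m * m) \<le> real m" by (rule of_nat_mono)
          qed (use \<mu>0 in \<open>auto simp: square_tail_nonneg\<close>)
          also have "\<dots> \<le> \<eta> * n + \<eta> * n"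
            using elim(2,4) n by (intro add_mono) (auto simp: field_simps less_imp_le)
          finally have "(\<Sum>i\<in>{n div m * m..<n}. (G (z i))\<^sup>2 + \<mu>) \<le> 2 * \<eta> * n" by simp
          with 1 show ?case
            unfolding R_def using n by (simp add: field_simps)
        qed
      qed
    qed
    moreover have "4 * \<eta> = 1 / real (Suc j)"
      by (simp add: \<eta>_def field_simps)
    ultimately have "AE z in iid_seq M. \<forall>\<^sub>F n in sequentially. R n z \<le> 1 / real (Suc j)"
      by (simp only:)
    then show "\<exists>R :: nat \<Rightarrow> (nat \<Rightarrow> 'a) \<Rightarrow> real. (\<forall>n\<ge>1. R n \<in> borel_measurable (iid_seq M)) \<and>
      (\<forall>n\<ge>1. \<forall>z\<in>space (iid_seq M). 0 \<le> R n z \<and> (SUP g\<in>\<G>. ennreal (\<bar>dev n z (\<lambda>x. (g x)\<^sup>2)\<bar> / n)) \<le> ennreal (R n z)) \<and>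
      (AE z in iid_seq M. \<forall>\<^sub>F n in sequentially. R n z \<le> 1 / real (Suc j))"
      using Rm R0 R_maj by (intro exI[of _ R]) (auto intro!: SUP_least ennreal_leI)
  qed
qed

end

section \<open>Integrals against the posterior base measure\<close>

lemma nn_integral_add_measure:
  assumes s: "sets N = sets M" and f: "f \<in> borel_measurable M"
  shows "(\<integral>\<^sup>+x. f x \<partial>add_measure M N) = (\<integral>\<^sup>+x. f x \<partial>M) + (\<integral>\<^sup>+x. f x \<partial>N)"
  using f
proof induction
  case (cong f g)
  have sp: "space N = space M" using s by (rule sets_eq_imp_space_eq)
  have "(\<integral>\<^sup>+x. f x \<partial>add_measure M N) = (\<integral>\<^sup>+x. g x \<partial>add_measure M N)"
    "(\<integral>\<^sup>+x. f x \<partial>M) = (\<integral>\<^sup>+x. g x \<partial>M)" "(\<integral>\<^sup>+x. f x \<partial>N) = (\<integral>\<^sup>+x. g x \<partial>N)"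
    using cong(3) by (auto intro!: nn_integral_cong simp: sp)
  with cong show ?case by simp
next
  case (set A)
  then show ?case using s by (simp add: emeasure_add_measure)
next
  case (mult u c)
  then have "u \<in> borel_measurable N" "u \<in> borel_measurable (add_measure M N)"
    using s by (simp_all cong: measurable_cong_sets)
  with mult show ?case by (simp add: nn_integral_cmult distrib_left)
next
  case (add u v)
  then have "u \<in> borel_measurable N" "u \<in> borel_measurable (add_measure M N)"
    "v \<in> borel_measurable N" "v \<in> borel_measurable (add_measure M N)"
    using s by (simp_all cong: measurable_cong_sets)
  with add show ?case by (simp add: nn_integral_add add_ac)
next
  case (seq U)
  then have m: "U i \<in> borel_measurable N" "U i \<in> borel_measurable (add_measure M N)" for i
    using s by (simp_all cong: measurable_cong_sets)
  have inc: "incseq (\<lambda>i. \<integral>\<^sup>+x. U i x \<partial>L)" for L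
    using seq(3) by (auto simp: incseq_def le_fun_def intro!: nn_integral_mono)
  have "(\<integral>\<^sup>+x. (SUP i. U i x) \<partial>add_measure M N) = (SUP i. (\<integral>\<^sup>+x. U i x \<partial>M) + (\<integral>\<^sup>+x. U i x \<partial>N))"
    using seq m by (simp add: nn_integral_monotone_convergence_SUP)
  also have "\<dots> = (SUP i. \<integral>\<^sup>+x. U i x \<partial>M) + (SUP i. \<integral>\<^sup>+x. U i x \<partial>N)"
    by (rule ennreal_SUP_add[OF inc inc])
  also have "\<dots> = (\<integral>\<^sup>+x. (SUP i. U i x) \<partial>M) + (\<integral>\<^sup>+x. (SUP i. U i x) \<partial>N)"
    using seq m by (simp add: nn_integral_monotone_convergence_SUP)
  finally show ?case by (simp add: image_comp)
qed

lemma sets_dp_base [simp]: "sets (dp_base \<nu> n z) = sets \<nu>"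
  and space_dp_base [simp]: "space (dp_base \<nu> n z) = space \<nu>"
  by (simp_all add: dp_base_def)

lemma nn_integral_dp_base:
  assumes n: "1 \<le> n" and z: "\<And>i. z i \<in> space \<nu>" and f: "f \<in> borel_measurable \<nu>"
  shows "(\<integral>\<^sup>+x. f x \<partial>dp_base \<nu> n z) = (\<integral>\<^sup>+x. f x \<partial>\<nu>) + (\<Sum>i<n. f (z i))"
proof -
  have zm: "z \<in> uniform_count_measure {..<n} \<rightarrow>\<^sub>M \<nu>"
    using z by (auto simp: measurable_def sets_uniform_count_measure space_uniform_count_measure)
  have s: "sets (scale_measure (of_nat n) (empirical_measure \<nu> n z)) = sets \<nu>"
    by (simp add: empirical_measure_def)
  have "(\<integral>\<^sup>+x. f x \<partial>scale_measure (of_nat n) (empirical_measure \<nu> n z))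
      = of_nat n * (\<integral>\<^sup>+x. f x \<partial>empirical_measure \<nu> n z)"
    using f by (intro nn_integral_scale_measure) (simp add: empirical_measure_def)
  also have "(\<integral>\<^sup>+x. f x \<partial>empirical_measure \<nu> n z) = (\<integral>\<^sup>+i. f (z i) \<partial>uniform_count_measure {..<n})"
    unfolding empirical_measure_def using f by (subst nn_integral_distr[OF zm]) auto
  also have "\<dots> = (\<Sum>i<n. ennreal (1 / n) * f (z i))"
    by (simp add: uniform_count_measure_def nn_integral_point_measure_finite)
  also have "of_nat n * (\<Sum>i<n. ennreal (1 / n) * f (z i)) = (\<Sum>i<n. f (z i))"
    using n by (simp add: sum_distrib_left[symmetric] mult.assoc[symmetric] ennreal_of_nat_eq_real_of_nat ennreal_mult[symmetric])
  finally show ?thesis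
    unfolding dp_base_def by (simp add: nn_integral_add_measure[OF s f])
qed

lemma integral_dp_base:
  fixes f :: "'a \<Rightarrow> real"
  assumes n: "1 \<le> n" and z: "\<And>i. z i \<in> space \<nu>" and f: "integrable \<nu> f"
  shows "integrable (dp_base \<nu> n z) f"
    and "(\<integral>x. f x \<partial>dp_base \<nu> n z) = (\<integral>x. f x \<partial>\<nu>) + (\<Sum>i<n. f (z i))"
proof -
  have fm[measurable]: "f \<in> borel_measurable \<nu>" using f by auto
  have fm': "f \<in> borel_measurable (dp_base \<nu> n z)"
    using fm by (simp cong: measurable_cong_sets)
  note nn = nn_integral_dp_base[OF n z]
  have "(\<integral>\<^sup>+x. ennreal (norm (f x)) \<partial>dp_base \<nu> n z) < \<infinity>"
    using f unfolding integrable_iff_bounded by (subst nn) (auto simp: sum_ennreal)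
  with fm' show i: "integrable (dp_base \<nu> n z) f"
    by (simp add: integrable_iff_bounded)
  have fin: "(\<integral>\<^sup>+x. ennreal (f x) \<partial>\<nu>) < \<infinity>" "(\<integral>\<^sup>+x. ennreal (- f x) \<partial>\<nu>) < \<infinity>"
    using f by (auto simp: real_integrable_def top.not_eq_extremum)
  have parts: "enn2real ((\<integral>\<^sup>+x. ennreal (h x) \<partial>\<nu>) + (\<Sum>i<n. ennreal (h (z i))))
      = enn2real (\<integral>\<^sup>+x. ennreal (h x) \<partial>\<nu>) + (\<Sum>i<n. max 0 (h (z i)))"
    if "(\<integral>\<^sup>+x. ennreal (h x) \<partial>\<nu>) < \<infinity>" for h :: "'a \<Rightarrow> real"
  proof -
    have "(\<Sum>i<n. ennreal (h (z i))) = (\<Sum>i<n. ennreal (max 0 (h (z i))))"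
      by (intro sum.cong refl) (auto simp: max_def ennreal_neg)
    also have "\<dots> = ennreal (\<Sum>i<n. max 0 (h (z i)))"
      by (rule sum_ennreal) simp
    finally show ?thesis using that by (simp add: enn2real_plus sum_nonneg)
  qed
  have "(\<integral>x. f x \<partial>dp_base \<nu> n z) = enn2real (\<integral>\<^sup>+x. ennreal (f x) \<partial>dp_base \<nu> n z)
      - enn2real (\<integral>\<^sup>+x. ennreal (- f x) \<partial>dp_base \<nu> n z)"
    using i by (rule real_lebesgue_integral_def)
  also have "\<dots> = enn2real (\<integral>\<^sup>+x. ennreal (f x) \<partial>\<nu>) - enn2real (\<integral>\<^sup>+x. ennreal (- f x) \<partial>\<nu>)
      + ((\<Sum>i<n. max 0 (f (z i))) - (\<Sum>i<n. max 0 (- f (z i))))"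
    by (simp add: nn parts[OF fin(1)] parts[OF fin(2)])
  also have "(\<Sum>i<n. max 0 (f (z i))) - (\<Sum>i<n. max 0 (- f (z i))) = (\<Sum>i<n. f (z i))"
    unfolding sum_subtractf[symmetric] by (intro sum.cong) auto
  finally show "(\<integral>x. f x \<partial>dp_base \<nu> n z) = (\<integral>x. f x \<partial>\<nu>) + (\<Sum>i<n. f (z i))"
    using real_lebesgue_integral_def[OF f] by simp
qed

section \<open>Expansion of the log Laplace transform\<close>

lemma abs_ln_one_minus_expansion_le:
  fixes y :: real
  assumes y: "\<bar>y\<bar> \<le> 1 / 2"
  shows "\<bar>- ln (1 - y) - y - y\<^sup>2 / 2\<bar> \<le> 2 * \<bar>y\<bar> ^ 3"
proof -
  define h where "h x = - ln (1 - x) - x - x\<^sup>2 / 2" for x :: real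
  have der: "(h has_real_derivative (x\<^sup>2 / (1 - x))) (at x)" if "\<bar>x\<bar> \<le> 1 / 2" for x
    unfolding h_def using that
    by (auto intro!: derivative_eq_intros simp: abs_le_iff field_simps power2_eq_square)
  have bd: "\<bar>x\<^sup>2 / (1 - x)\<bar> \<le> 2 * y\<^sup>2" if "\<bar>x\<bar> \<le> \<bar>y\<bar>" for x
  proof -
    have "1 / 2 \<le> 1 - x" using that y by (auto simp: abs_le_iff)
    then have "x\<^sup>2 / (1 - x) \<le> x\<^sup>2 / (1 / 2)" by (intro divide_left_mono) auto
    then have "x\<^sup>2 / (1 - x) \<le> 2 * x\<^sup>2" by simp
    moreover have "x\<^sup>2 \<le> y\<^sup>2" using that by (simp add: abs_le_square_iff)
    moreover have "0 \<le> x\<^sup>2 / (1 - x)" using \<open>1 / 2 \<le> 1 - x\<close> by simp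
    ultimately show ?thesis by linarith
  qed
  have "\<exists>\<xi>. \<bar>\<xi>\<bar> \<le> \<bar>y\<bar> \<and> h y = y * (\<xi>\<^sup>2 / (1 - \<xi>))"
  proof -
    have h0: "h 0 = 0" by (simp add: h_def)
    consider "0 < y" | "y < 0" | "y = 0" by linarith
    then show ?thesis
    proof cases
      case 1
      then obtain \<xi> where "0 < \<xi>" "\<xi> < y" "h y - h 0 = (y - 0) * (\<xi>\<^sup>2 / (1 - \<xi>))"
        using MVT2[of 0 y h "\<lambda>x. x\<^sup>2 / (1 - x)"] der y by (auto simp: abs_le_iff)
      then show ?thesis using h0 by (intro exI[of _ \<xi>]) auto
    next
      case 2
      then obtain \<xi> where "y < \<xi>" "\<xi> < 0" "h 0 - h y = (0 - y) * (\<xi>\<^sup>2 / (1 - \<xi>))"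
        using MVT2[of y 0 h "\<lambda>x. x\<^sup>2 / (1 - x)"] der y by (auto simp: abs_le_iff)
      then show ?thesis using h0 by (intro exI[of _ \<xi>]) auto
    next
      case 3
      then show ?thesis using h0 by (intro exI[of _ 0]) auto
    qed
  qed
  then obtain \<xi> where \<xi>: "\<bar>\<xi>\<bar> \<le> \<bar>y\<bar>" "h y = y * (\<xi>\<^sup>2 / (1 - \<xi>))" by blast
  have "\<bar>h y\<bar> \<le> \<bar>y\<bar> * (2 * y\<^sup>2)"
    unfolding \<xi>(2) abs_mult by (intro mult_left_mono bd \<xi>(1)) auto
  also have "\<dots> = 2 * \<bar>y\<bar> ^ 3" by (simp add: power3_eq_cube power2_eq_square[of y] abs_mult_self_eq mult_ac)
  finally show ?thesis by (simp add: h_def)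
qed

lemma abs_exp_diff_le:
  fixes x y B :: real
  assumes "x \<le> B" "y \<le> B"
  shows "\<bar>exp x - exp y\<bar> \<le> exp B * \<bar>x - y\<bar>"
proof -
  have *: "exp a - exp b \<le> exp B * (a - b)" if "b \<le> a" "a \<le> B" for a b :: real
  proof -
    have "1 - (a - b) \<le> exp (- (a - b))"
      using exp_ge_add_one_self[of "- (a - b)"] by linarith
    then have "exp a * (1 - (a - b)) \<le> exp a * exp (- (a - b))"
      by (rule mult_left_mono) simp
    then have "exp a - exp b \<le> exp a * (a - b)"
      by (simp add: exp_add[symmetric] algebra_simps)
    also have "\<dots> \<le> exp B * (a - b)"
      using that by (intro mult_right_mono) auto
    finally show ?thesis .
  qed
  show ?thesis
    using *[of x y] *[of y x] assms by (cases "x \<le> y") (auto simp: abs_if)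
qed

text \<open>
  The setting of the theorem, for a class that has a nonnegative square integrable envelope.
\<close>

locale posterior_setting = envelope_class M \<G> G for M :: "'a measure" and \<G> G +
  fixes \<nu> :: "'a measure" and DP :: "nat \<Rightarrow> (nat \<Rightarrow> 'a) \<Rightarrow> 'a measure measure" and c C :: real
  assumes finite_nu: "finite_measure \<nu>" and sets_nu: "sets \<nu> = sets M"
    and DP: "\<And>n z. 1 \<le> n \<Longrightarrow> z \<in> space (iid_seq M) \<Longrightarrow> is_dirichlet_process (dp_base \<nu> n z) (DP n z)"
    and c_pos: "0 < c" and C_pos: "0 < C"
    and exp_bound: "\<And>t. 0 < t \<Longrightarrow> (\<integral>\<^sup>+x. ennreal (exp (t * G x)) \<partial>\<nu>) \<le> ennreal (C * exp (c * t\<^sup>2))"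
begin

sublocale nu: finite_measure \<nu> by (rule finite_nu)

lemma space_nu: "space \<nu> = space M"
  using sets_nu by (rule sets_eq_imp_space_eq)

lemma measurable_nu: "f \<in> borel_measurable M \<Longrightarrow> f \<in> borel_measurable \<nu>"
  by (simp add: sets_nu cong: measurable_cong_sets)

definition "nu_mass = measure \<nu> (space \<nu>)"
definition "nu_moment k = (\<integral>x. G x ^ k \<partial>\<nu>)"

lemma nu_mass_nonneg: "0 \<le> nu_mass" by (simp add: nu_mass_def)

lemma nu_moment_nonneg: "0 \<le> nu_moment k"
  unfolding nu_moment_def using envelope_nonneg by (intro integral_nonneg_AE AE_I2) (simp add: space_nu)

lemma integrable_nu_power: "integrable \<nu> (\<lambda>x. G x ^ k)"
proof (rule nu.sums_integral_exp(2))
  show Gm: "G \<in> borel_measurable \<nu>" by (rule measurable_nu) simp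
  have "(\<integral>\<^sup>+x. ennreal (exp \<bar>G x\<bar>) \<partial>\<nu>) = (\<integral>\<^sup>+x. ennreal (exp (1 * G x)) \<partial>\<nu>)"
    using envelope_nonneg by (intro nn_integral_cong) (simp add: space_nu)
  also have "\<dots> < \<infinity>"
    by (rule order_le_less_trans[OF exp_bound]) auto
  finally show "integrable \<nu> (\<lambda>x. exp \<bar>G x\<bar>)"
    using Gm by (intro integrableI_nonneg) auto
qed

lemma posterior_law:
  assumes n: "1 \<le> n" and z: "z \<in> space (iid_seq M)"
  shows "dirichlet_law (dp_base \<nu> n z) (DP n z)"
    and "dirichlet_law.mass (dp_base \<nu> n z) = nu_mass + n"
proof -
  have zs: "\<And>i. z i \<in> space \<nu>" using z by (simp add: space_iid_seq space_nu)
  have "emeasure (dp_base \<nu> n z) (space \<nu>) = emeasure \<nu> (space \<nu>) + of_nat (card {i. i < n \<and> z i \<in> space \<nu>})"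
    by (rule emeasure_dp_base[OF n zs]) simp
  also have "{i. i < n \<and> z i \<in> space \<nu>} = {..<n}" using zs by auto
  finally have em: "emeasure (dp_base \<nu> n z) (space \<nu>) = ennreal (nu_mass + n)"
    by (simp add: nu.emeasure_eq_measure nu_mass_def ennreal_of_nat_eq_real_of_nat)
  then have m: "measure (dp_base \<nu> n z) (space \<nu>) = nu_mass + n"
    using nu_mass_nonneg unfolding measure_def em by (intro enn2real_ennreal) simp
  show L: "dirichlet_law (dp_base \<nu> n z) (DP n z)"
  proof (rule dirichlet_law.intro)
    show "finite_measure (dp_base \<nu> n z)"
      by (rule finite_measureI) (simp add: em del: ennreal_plus)
    show "0 < measure (dp_base \<nu> n z) (space (dp_base \<nu> n z))"
      using m n nu_mass_nonneg by simp
  qed (rule DP[OF n z])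
  show "dirichlet_law.mass (dp_base \<nu> n z) = nu_mass + n"
    using m by (simp add: dirichlet_law.mass_def[OF L])
qed

definition avg :: "nat \<Rightarrow> (nat \<Rightarrow> 'a) \<Rightarrow> ('a \<Rightarrow> real) \<Rightarrow> real" where
  "avg n z f = (\<Sum>i<n. f (z i)) / n"

definition var :: "('a \<Rightarrow> real) \<Rightarrow> real" where
  "var g = (\<integral>x. (g x - (\<integral>y. g y \<partial>M))\<^sup>2 \<partial>M)"

lemma var_eq: "g \<in> \<G> \<Longrightarrow> var g = (\<integral>x. (g x)\<^sup>2 \<partial>M) - (\<integral>x. g x \<partial>M)\<^sup>2"
proof -
  assume g: "g \<in> \<G>"
  define \<mu> where "\<mu> = (\<integral>x. g x \<partial>M)"
  have "var g = (\<integral>x. (g x)\<^sup>2 - 2 * \<mu> * g x + \<mu>\<^sup>2 \<partial>M)"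
    unfolding var_def \<mu>_def by (simp add: power2_diff algebra_simps)
  also have "\<dots> = (\<integral>x. (g x)\<^sup>2 \<partial>M) - 2 * \<mu> * \<mu> + \<mu>\<^sup>2"
    using integrable_class[OF g] integrable_class_square[OF g] by (simp add: prob_space \<mu>_def)
  finally show ?thesis
    by (simp add: power2_eq_square \<mu>_def)
qed

lemma var_bounds:
  assumes g: "g \<in> \<G>"
  shows "0 \<le> var g" "var g \<le> (\<integral>x. (G x)\<^sup>2 \<partial>M)"
proof -
  show "0 \<le> var g" by (simp add: var_def)
  show "var g \<le> (\<integral>x. (G x)\<^sup>2 \<partial>M)"
    using integral_class_square_le[OF g] zero_le_power2[of "\<integral>x. g x \<partial>M"] unfolding var_eq[OF g] by linarith
qed

text \<open>
  The error of the expansion of the log Laplace transform, for \<open>r = 1 / sqrt n\<close>. The summands stem from, in this order: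
  the linear and the quadratic term under \<open>\<nu>\<close>; the difference of sample variance and variance, where \<open>\<Delta>\<close> and \<open>\<Theta>\<close>
  bound the normalized deviations of \<open>g\<close> and \<open>g\<^sup>2\<close>; the replacement of the mass of the base measure by \<open>n\<close>; the
  cubic term under \<open>\<nu>\<close> and over the sample. The arguments \<open>b\<close>, \<open>q\<close>, \<open>mx\<close> are the sample mean of \<open>G\<close>, that of \<open>G\<^sup>2\<close>,
  and a bound for \<open>G\<close> on the sample.
\<close>

definition expansion_error :: "real \<Rightarrow> real \<Rightarrow> real \<Rightarrow> real \<Rightarrow> real \<Rightarrow> real \<Rightarrow> real" where
  "expansion_error r b q mx \<Delta> \<Theta> = r * (nu_moment 1 + nu_mass * b) + r\<^sup>2 * (nu_moment 2 + nu_mass * b\<^sup>2)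
    + (\<Theta> + \<Delta> * (b + (\<integral>x. G x \<partial>M))) / 2 + r\<^sup>2 * (nu_mass * q)
    + 8 * r ^ 3 * (nu_moment 3 + nu_mass * b ^ 3) + 4 * r * (mx + b) * (q + b\<^sup>2)"

text \<open>
  The mean subtracted is that of \<open>g\<close> itself. If \<open>G \<le> sqrt n\<close> on the sample, the truncation does not act there and the
  centred function sums to zero exactly.
\<close>

definition centred :: "nat \<Rightarrow> (nat \<Rightarrow> 'a) \<Rightarrow> ('a \<Rightarrow> real) \<Rightarrow> 'a \<Rightarrow> real" where
  "centred n z g x = max (- sqrt n) (min (sqrt n) (g x)) - avg n z g"

lemma sum_cube_le: "0 \<le> x \<Longrightarrow> 0 \<le> y \<Longrightarrow> (x + y) ^ 3 \<le> 4 * x ^ 3 + 4 * (y::real) ^ 3"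
proof -
  assume xy: "0 \<le> x" "0 \<le> y"
  have "4 * x ^ 3 + 4 * y ^ 3 - (x + y) ^ 3 = 3 * (x + y) * (x - y)\<^sup>2"
    by (simp add: power3_eq_cube power2_eq_square algebra_simps)
  moreover have "0 \<le> 3 * (x + y) * (x - y)\<^sup>2" using xy by simp
  ultimately show ?thesis by linarith
qed

lemma sum_square_le: "(x + y)\<^sup>2 \<le> 2 * x\<^sup>2 + 2 * (y::real)\<^sup>2"
  using zero_le_power2[of "x - y"] by (simp add: power2_sum power2_diff)

lemma abs_centred_le:
  fixes mx :: real
  assumes n: "1 \<le> n" and z: "z \<in> space (iid_seq M)" and g: "g \<in> \<G>"
    and mx: "\<And>i. i < n \<Longrightarrow> G (z i) \<le> mx" "mx \<le> sqrt n"
  shows "\<bar>avg n z g\<bar> \<le> avg n z G" "0 \<le> avg n z G" "avg n z G \<le> mx"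
    and "\<And>x. x \<in> space M \<Longrightarrow> \<bar>centred n z g x\<bar> \<le> G x + avg n z G"
    and "\<And>x. \<bar>centred n z g x\<bar> \<le> 2 * sqrt n"
    and "\<And>i. i < n \<Longrightarrow> centred n z g (z i) = g (z i) - avg n z g"
proof -
  have zs: "z i \<in> space M" for i using z by (simp add: space_iid_seq)
  have "\<bar>\<Sum>i<n. g (z i)\<bar> \<le> (\<Sum>i<n. G (z i))"
    by (intro order_trans[OF sum_abs] sum_mono envelope g zs)
  then show 1: "\<bar>avg n z g\<bar> \<le> avg n z G"
    by (simp add: avg_def divide_right_mono)
  then show 2: "0 \<le> avg n z G" by linarith
  have "(\<Sum>i<n. G (z i)) \<le> (\<Sum>i<n. mx)" using mx(1) by (intro sum_mono) auto
  then show 3: "avg n z G \<le> mx" using n by (simp add: avg_def field_simps)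
  show "\<bar>centred n z g x\<bar> \<le> G x + avg n z G" if "x \<in> space M" for x
  proof -
    have "\<bar>max (- sqrt n) (min (sqrt n) (g x))\<bar> \<le> \<bar>g x\<bar>" by (auto simp: max_def min_def)
    then show ?thesis using envelope[OF g that] 1 unfolding centred_def by linarith
  qed
  show "\<bar>centred n z g x\<bar> \<le> 2 * sqrt n" for x
  proof -
    have "\<bar>max (- sqrt n) (min (sqrt n) (g x))\<bar> \<le> sqrt n" by (auto simp: max_def min_def)
    then show ?thesis using 1 3 mx(2) unfolding centred_def by linarith
  qed
  show "centred n z g (z i) = g (z i) - avg n z g" if "i < n" for i
  proof -
    have "\<bar>g (z i)\<bar> \<le> sqrt n" using envelope[OF g zs[of i]] mx that by force
    then have "max (- sqrt n) (min (sqrt n) (g (z i))) = g (z i)" by (auto simp: max_def min_def abs_le_iff)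
    then show ?thesis by (simp add: centred_def)
  qed
qed

text \<open>
  With \<open>v = t * sqrt n / a\<close> the argument \<open>v * h\<close> is at most \<open>1 / 2\<close> in absolute value, which is what the truncation at
  \<open>sqrt n\<close> and \<open>\<bar>t\<bar> \<le> 1 / 4\<close> are for. In the quadratic term \<open>v\<^sup>2 * n\<close> is \<open>t\<^sup>2\<close> up to the factor \<open>(n / a)\<^sup>2\<close>.
\<close>

lemma log_laplace_estimate:
  fixes mx t \<Delta> \<Theta> :: real
  assumes n: "1 \<le> n" and z: "z \<in> space (iid_seq M)" and g: "g \<in> \<G>"
    and mx: "\<And>i. i < n \<Longrightarrow> G (z i) \<le> mx" "mx \<le> sqrt n" and t: "\<bar>t\<bar> \<le> 1 / 4"
    and \<Delta>: "\<bar>dev n z g\<bar> \<le> n * \<Delta>" and \<Theta>: "\<bar>dev n z (\<lambda>x. (g x)\<^sup>2)\<bar> \<le> n * \<Theta>"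
  shows "\<bar>dirichlet_law.log_laplace (dp_base \<nu> n z) (centred n z g) (t * sqrt n / (nu_mass + n)) - t\<^sup>2 * var g / 2\<bar>
    \<le> expansion_error (1 / sqrt n) (avg n z G) (avg n z (\<lambda>x. (G x)\<^sup>2)) mx \<Delta> \<Theta>"
proof -
  note law = posterior_law[OF n z]
  interpret L: dirichlet_law "dp_base \<nu> n z" "DP n z" by (rule law(1))
  have zs: "z i \<in> space M" for i using z by (simp add: space_iid_seq)
  have zs': "z i \<in> space \<nu>" for i using zs by (simp add: space_nu)
  define a where "a = nu_mass + n"
  define v where "v = t * sqrt n / a"
  define r where "r = 1 / sqrt n"
  define b where "b = avg n z G"
  define q where "q = avg n z (\<lambda>x. (G x)\<^sup>2)"
  define m where "m = avg n z g"
  define h where "h = centred n z g"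
  note ce = abs_centred_le[OF n z g mx, folded b_def m_def h_def]
  have n0: "0 < real n" using n by simp
  have a0: "0 < a" "real n \<le> a" using n0 nu_mass_nonneg by (auto simp: a_def)
  have r0: "0 < r" using n0 by (simp add: r_def)
  have r2: "r\<^sup>2 = 1 / n" using n0 by (simp add: r_def power_divide)
  have sqrt_r: "sqrt n * r = 1" using n0 by (simp add: r_def)
  have q0: "0 \<le> q" unfolding q_def avg_def by (intro divide_nonneg_nonneg sum_nonneg) auto
  have v_le: "\<bar>v\<bar> \<le> \<bar>t\<bar> * r"
  proof -
    have "sqrt n / a \<le> sqrt n / n" using a0 n0 by (intro divide_left_mono) auto
    also have "\<dots> = r" using n0 real_div_sqrt[of "real n"] by (simp add: r_def field_simps)
    finally have "\<bar>t\<bar> * (sqrt n / a) \<le> \<bar>t\<bar> * r" by (rule mult_left_mono) simp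
    then show ?thesis using a0 by (simp add: v_def abs_mult)
  qed
  also have "\<bar>t\<bar> * r \<le> 1 * r" using t r0 by (intro mult_right_mono) auto
  finally have v_r: "\<bar>v\<bar> \<le> r" by simp
  have hm: "h \<in> borel_measurable M"
    unfolding h_def centred_def[abs_def] using measurable_class[OF g] by measurable
  have hm\<nu>[measurable]: "h \<in> borel_measurable \<nu>" by (rule measurable_nu[OF hm])
  have hm\<alpha>[measurable]: "h \<in> borel_measurable (dp_base \<nu> n z)"
    using hm\<nu> by (simp cong: measurable_cong_sets)
  have vh: "\<bar>v * h x\<bar> \<le> 1 / 2" for x
  proof -
    have "\<bar>v\<bar> * \<bar>h x\<bar> \<le> (\<bar>t\<bar> * r) * (2 * sqrt n)"
      by (intro mult_mono v_le ce(5)) (use r0 in auto)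
    also have "\<dots> = 2 * \<bar>t\<bar> * (sqrt n * r)" by simp
    also have "\<dots> \<le> 1 / 2" unfolding sqrt_r using t by simp
    finally show ?thesis by (simp add: abs_mult)
  qed
  have bounded_int: "integrable (dp_base \<nu> n z) f" "integrable \<nu> f"
    if "f \<in> borel_measurable \<nu>" "\<And>x. \<bar>f x\<bar> \<le> B" for f :: "'a \<Rightarrow> real" and B
  proof -
    have "f \<in> borel_measurable (dp_base \<nu> n z)" using that(1) by (simp cong: measurable_cong_sets)
    then show "integrable (dp_base \<nu> n z) f"
      using that(2) by (intro L.base.integrable_const_bound[where B = B]) auto
    show "integrable \<nu> f"
      using that by (intro nu.integrable_const_bound[where B = B]) auto
  qed
  have pow_bd: "\<bar>h x\<bar> ^ k \<le> (2 * sqrt n) ^ k" for x k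
    by (intro power_mono ce(5)) auto
  have ih: "integrable \<nu> h" using bounded_int(2)[OF hm\<nu> ce(5)] .
  have ih2: "integrable \<nu> (\<lambda>x. (h x)\<^sup>2)"
  proof (rule bounded_int(2))
    show "\<bar>(h x)\<^sup>2\<bar> \<le> (2 * sqrt n)\<^sup>2" for x using pow_bd[of x 2] by simp
  qed measurable
  have ih3: "integrable \<nu> (\<lambda>x. \<bar>h x\<bar> ^ 3)"
  proof (rule bounded_int(2))
    show "\<bar>\<bar>h x\<bar> ^ 3\<bar> \<le> (2 * sqrt n) ^ 3" for x using pow_bd[of x 3] by simp
  qed measurable
  have iln: "integrable (dp_base \<nu> n z) (\<lambda>x. ln (1 - v * h x))"
  proof (rule bounded_int(1))
    fix x
    have "1 / 2 \<le> 1 - v * h x" "1 - v * h x \<le> 2" using vh[of x] by (auto simp: abs_le_iff)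
    then have "ln (1 / 2) \<le> ln (1 - v * h x)" "ln (1 - v * h x) \<le> ln 2" by auto
    then show "\<bar>ln (1 - v * h x)\<bar> \<le> ln 2" by (simp add: ln_div)
  qed measurable
  note dpi = integral_dp_base[OF n zs']
  \<comment> \<open>third order expansion of the logarithm under the integral\<close>
  have LL: "\<bar>L.log_laplace h v - (v * (\<integral>x. h x \<partial>dp_base \<nu> n z) + v\<^sup>2 / 2 * (\<integral>x. (h x)\<^sup>2 \<partial>dp_base \<nu> n z))\<bar>
      \<le> 2 * \<bar>v\<bar> ^ 3 * (\<integral>x. \<bar>h x\<bar> ^ 3 \<partial>dp_base \<nu> n z)"
  proof -
    have eq: "L.log_laplace h v - (v * (\<integral>x. h x \<partial>dp_base \<nu> n z) + v\<^sup>2 / 2 * (\<integral>x. (h x)\<^sup>2 \<partial>dp_base \<nu> n z))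
        = (\<integral>x. - ln (1 - v * h x) - v * h x - (v * h x)\<^sup>2 / 2 \<partial>dp_base \<nu> n z)"
      using iln dpi(1)[OF ih] dpi(1)[OF ih2] by (simp add: L.log_laplace_def power_mult_distrib)
    have "\<bar>\<integral>x. - ln (1 - v * h x) - v * h x - (v * h x)\<^sup>2 / 2 \<partial>dp_base \<nu> n z\<bar>
        \<le> (\<integral>x. \<bar>- ln (1 - v * h x) - v * h x - (v * h x)\<^sup>2 / 2\<bar> \<partial>dp_base \<nu> n z)"
      by (rule integral_abs_bound)
    also have "\<dots> \<le> (\<integral>x. 2 * \<bar>v\<bar> ^ 3 * \<bar>h x\<bar> ^ 3 \<partial>dp_base \<nu> n z)"
    proof (rule integral_mono)
      have "integrable (dp_base \<nu> n z) (\<lambda>x. - ln (1 - v * h x) - v * h x - (v * h x)\<^sup>2 / 2)"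
        unfolding power_mult_distrib
        by (intro Bochner_Integration.integrable_diff Bochner_Integration.integrable_minus iln
            integrable_divide integrable_mult_right dpi(1) ih ih2)
      then show "integrable (dp_base \<nu> n z) (\<lambda>x. \<bar>- ln (1 - v * h x) - v * h x - (v * h x)\<^sup>2 / 2\<bar>)"
        by (rule integrable_abs)
      show "integrable (dp_base \<nu> n z) (\<lambda>x. 2 * \<bar>v\<bar> ^ 3 * \<bar>h x\<bar> ^ 3)"
        by (intro integrable_mult_right dpi(1) ih3)
      show "\<bar>- ln (1 - v * h x) - v * h x - (v * h x)\<^sup>2 / 2\<bar> \<le> 2 * \<bar>v\<bar> ^ 3 * \<bar>h x\<bar> ^ 3" for x
        using abs_ln_one_minus_expansion_le[OF vh[of x]] by (simp add: abs_mult power_mult_distrib)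
    qed
    finally show ?thesis unfolding eq by simp
  qed
  have iG: "integrable \<nu> G" using integrable_nu_power[of 1] by simp
  have I1: "\<bar>\<integral>x. h x \<partial>\<nu>\<bar> \<le> nu_moment 1 + nu_mass * b"
  proof -
    have "\<bar>\<integral>x. h x \<partial>\<nu>\<bar> \<le> (\<integral>x. G x + b \<partial>\<nu>)"
      using ce(4) iG ih by (intro order_trans[OF integral_abs_bound] integral_mono) (auto simp: space_nu)
    also have "\<dots> = nu_moment 1 + nu_mass * b"
      using iG by (simp add: nu_moment_def nu_mass_def)
    finally show ?thesis .
  qed
  have I2: "(\<integral>x. (h x)\<^sup>2 \<partial>\<nu>) \<le> 2 * (nu_moment 2 + nu_mass * b\<^sup>2)"
  proof -
    have "(\<integral>x. (h x)\<^sup>2 \<partial>\<nu>) \<le> (\<integral>x. 2 * G x ^ 2 + 2 * b\<^sup>2 \<partial>\<nu>)"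
    proof (rule integral_mono[OF ih2])
      fix x assume "x \<in> space \<nu>"
      then have "\<bar>h x\<bar> \<le> \<bar>G x + b\<bar>" using ce(4)[of x] by (simp add: space_nu)
      then have "(h x)\<^sup>2 \<le> (G x + b)\<^sup>2" by (simp add: abs_le_square_iff)
      then show "(h x)\<^sup>2 \<le> 2 * G x ^ 2 + 2 * b\<^sup>2" using sum_square_le[of "G x" b] by linarith
    qed (use integrable_nu_power[of 2] in auto)
    also have "\<dots> = 2 * (nu_moment 2 + nu_mass * b\<^sup>2)"
      using integrable_nu_power[of 2] by (simp add: nu_moment_def nu_mass_def)
    finally show ?thesis .
  qed
  have I3: "(\<integral>x. \<bar>h x\<bar> ^ 3 \<partial>\<nu>) \<le> 4 * (nu_moment 3 + nu_mass * b ^ 3)"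
  proof -
    have "(\<integral>x. \<bar>h x\<bar> ^ 3 \<partial>\<nu>) \<le> (\<integral>x. 4 * G x ^ 3 + 4 * b ^ 3 \<partial>\<nu>)"
    proof (rule integral_mono[OF ih3])
      fix x assume x: "x \<in> space \<nu>"
      then have "\<bar>h x\<bar> ^ 3 \<le> (G x + b) ^ 3" using ce(4)[of x] by (intro power_mono) (auto simp: space_nu)
      also have "\<dots> \<le> 4 * G x ^ 3 + 4 * b ^ 3"
        using envelope_nonneg[of x] x ce(2) by (intro sum_cube_le) (auto simp: space_nu)
      finally show "\<bar>h x\<bar> ^ 3 \<le> 4 * G x ^ 3 + 4 * b ^ 3" .
    qed (use integrable_nu_power[of 3] in auto)
    also have "\<dots> = 4 * (nu_moment 3 + nu_mass * b ^ 3)"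
      using integrable_nu_power[of 3] by (simp add: nu_moment_def nu_mass_def)
    finally show ?thesis .
  qed
  have S1: "(\<Sum>i<n. h (z i)) = 0"
    using n0 by (simp add: ce(6) sum_subtractf m_def avg_def)
  define V where "V = avg n z (\<lambda>x. (g x)\<^sup>2) - m\<^sup>2"
  have S2: "(\<Sum>i<n. (h (z i))\<^sup>2) = n * V"
  proof -
    have "(\<Sum>i<n. (h (z i))\<^sup>2) = (\<Sum>i<n. (g (z i))\<^sup>2 - 2 * m * g (z i) + m\<^sup>2)"
      by (intro sum.cong) (auto simp: ce(6) power2_diff)
    also have "\<dots> = (\<Sum>i<n. (g (z i))\<^sup>2) - 2 * m * (\<Sum>i<n. g (z i)) + n * m\<^sup>2"
      by (simp add: sum.distrib sum_subtractf sum_distrib_left)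
    also have "(\<Sum>i<n. g (z i)) = n * m" using n0 by (simp add: m_def avg_def)
    also have "(\<Sum>i<n. (g (z i))\<^sup>2) = n * avg n z (\<lambda>x. (g x)\<^sup>2)" using n0 by (simp add: avg_def)
    finally show ?thesis by (simp add: V_def power2_eq_square algebra_simps)
  qed
  have V0: "0 \<le> V"
  proof -
    have "0 \<le> n * V" unfolding S2[symmetric] by (intro sum_nonneg) auto
    then show ?thesis using n0 by (simp add: zero_le_mult_iff)
  qed
  have Vq: "V \<le> q"
  proof -
    have "avg n z (\<lambda>x. (g x)\<^sup>2) \<le> q"
      unfolding q_def avg_def by (intro divide_right_mono sum_mono square_le_envelope g zs) auto
    then show ?thesis unfolding V_def using zero_le_power2[of m] by linarith
  qed
  have S3: "(\<Sum>i<n. \<bar>h (z i)\<bar> ^ 3) \<le> n * ((mx + b) * (2 * (q + b\<^sup>2)))"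
  proof -
    have "\<bar>h (z i)\<bar> ^ 3 \<le> (mx + b) * (2 * (G (z i))\<^sup>2 + 2 * b\<^sup>2)" if i: "i < n" for i
    proof -
      have 1: "\<bar>h (z i)\<bar> \<le> G (z i) + b" by (rule ce(4)) (auto simp: zs)
      have "(h (z i))\<^sup>2 \<le> (G (z i) + b)\<^sup>2" using 1 by (intro abs_le_square_iff[THEN iffD1]) simp
      then have 2: "(h (z i))\<^sup>2 \<le> 2 * (G (z i))\<^sup>2 + 2 * b\<^sup>2" using sum_square_le[of "G (z i)" b] by linarith
      have "\<bar>h (z i)\<bar> ^ 3 = \<bar>h (z i)\<bar> * (h (z i))\<^sup>2" by (simp add: power3_eq_cube power2_eq_square abs_mult_self_eq mult.assoc)
      also have "\<dots> \<le> (mx + b) * (2 * (G (z i))\<^sup>2 + 2 * b\<^sup>2)"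
        using 1 2 mx(1)[OF i] by (intro mult_mono) auto
      finally show ?thesis .
    qed
    then have "(\<Sum>i<n. \<bar>h (z i)\<bar> ^ 3) \<le> (\<Sum>i<n. (mx + b) * (2 * (G (z i))\<^sup>2 + 2 * b\<^sup>2))"
      by (intro sum_mono) auto
    also have "\<dots> = (mx + b) * (2 * (\<Sum>i<n. (G (z i))\<^sup>2) + n * (2 * b\<^sup>2))"
      by (simp only: sum_distrib_left[symmetric] sum.distrib) simp
    also have "(\<Sum>i<n. (G (z i))\<^sup>2) = n * q" using n0 by (simp add: q_def avg_def)
    finally show ?thesis by (simp add: algebra_simps)
  qed
  \<comment> \<open>linear term: only \<open>\<nu>\<close> contributes\<close>
  have T1: "\<bar>v * (\<integral>x. h x \<partial>dp_base \<nu> n z)\<bar> \<le> r * (nu_moment 1 + nu_mass * b)"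
    unfolding dpi(2)[OF ih] S1 abs_mult using v_r I1 r0 by (intro mult_mono) auto
  have v2: "v\<^sup>2 \<le> r\<^sup>2" using v_r r0 by (simp add: abs_le_square_iff[symmetric])
  have T2: "0 \<le> v\<^sup>2 / 2 * (\<integral>x. (h x)\<^sup>2 \<partial>\<nu>)" "v\<^sup>2 / 2 * (\<integral>x. (h x)\<^sup>2 \<partial>\<nu>) \<le> r\<^sup>2 * (nu_moment 2 + nu_mass * b\<^sup>2)"
  proof -
    show "0 \<le> v\<^sup>2 / 2 * (\<integral>x. (h x)\<^sup>2 \<partial>\<nu>)" by simp
    have "v\<^sup>2 * (\<integral>x. (h x)\<^sup>2 \<partial>\<nu>) \<le> r\<^sup>2 * (2 * (nu_moment 2 + nu_mass * b\<^sup>2))"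
      using v2 I2 by (intro mult_mono) auto
    then show "v\<^sup>2 / 2 * (\<integral>x. (h x)\<^sup>2 \<partial>\<nu>) \<le> r\<^sup>2 * (nu_moment 2 + nu_mass * b\<^sup>2)"
      by (simp add: algebra_simps)
  qed
  have T3: "2 * \<bar>v\<bar> ^ 3 * (\<integral>x. \<bar>h x\<bar> ^ 3 \<partial>dp_base \<nu> n z)
      \<le> 8 * r ^ 3 * (nu_moment 3 + nu_mass * b ^ 3) + 4 * r * (mx + b) * (q + b\<^sup>2)"
  proof -
    have "\<bar>v\<bar> ^ 3 * (\<integral>x. \<bar>h x\<bar> ^ 3 \<partial>dp_base \<nu> n z)
        \<le> r ^ 3 * (4 * (nu_moment 3 + nu_mass * b ^ 3) + n * ((mx + b) * (2 * (q + b\<^sup>2))))"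
    proof (intro mult_mono power_mono v_r)
      show "(\<integral>x. \<bar>h x\<bar> ^ 3 \<partial>dp_base \<nu> n z) \<le> 4 * (nu_moment 3 + nu_mass * b ^ 3) + n * ((mx + b) * (2 * (q + b\<^sup>2)))"
        unfolding dpi(2)[OF ih3] by (rule add_mono[OF I3 S3])
    qed (use r0 in auto)
    also have "r ^ 3 * (4 * (nu_moment 3 + nu_mass * b ^ 3) + n * ((mx + b) * (2 * (q + b\<^sup>2))))
        = 4 * r ^ 3 * (nu_moment 3 + nu_mass * b ^ 3) + 2 * r * (mx + b) * (q + b\<^sup>2)"
    proof -
      have cube: "r ^ 3 * n = r"
        using n0 r2 by (simp add: power3_eq_cube power2_eq_square)
      have "r ^ 3 * (4 * A + n * (B * (2 * E))) = 4 * r ^ 3 * A + 2 * r * B * E" for A B E :: real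
      proof -
        have "r ^ 3 * (4 * A + n * (B * (2 * E))) = 4 * r ^ 3 * A + r ^ 3 * n * (2 * B * E)"
          by (simp add: algebra_simps)
        then show ?thesis unfolding cube by simp
      qed
      then show ?thesis .
    qed
    finally show ?thesis by simp
  qed
  \<comment> \<open>quadratic term over the sample, against its limit\<close>
  have T4: "\<bar>v\<^sup>2 * (n * V) - t\<^sup>2 * var g\<bar> \<le> \<Theta> + \<Delta> * (b + (\<integral>x. G x \<partial>M)) + 2 * (r\<^sup>2 * (nu_mass * q))"
  proof -
    define \<rho> where "\<rho> = n / a"
    have \<rho>: "0 \<le> \<rho>" "\<rho> \<le> 1" "1 - \<rho> \<le> nu_mass * r\<^sup>2"
    proof -
      show "0 \<le> \<rho>" "\<rho> \<le> 1" using a0 n0 by (auto simp: \<rho>_def)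
      have "1 - \<rho> = nu_mass / a" using a0 by (simp add: \<rho>_def a_def field_simps)
      also have "\<dots> \<le> nu_mass / n" using a0 n0 nu_mass_nonneg by (intro divide_left_mono) auto
      finally show "1 - \<rho> \<le> nu_mass * r\<^sup>2" by (simp add: r2)
    qed
    have vn: "v\<^sup>2 * (n * V) = t\<^sup>2 * (\<rho>\<^sup>2 * V)"
      using n0 by (simp add: v_def \<rho>_def power_mult_distrib power_divide power2_eq_square)
    have "1 - \<rho>\<^sup>2 = (1 - \<rho>) * (1 + \<rho>)" by (simp add: power2_eq_square algebra_simps)
    also have "\<dots> \<le> nu_mass * r\<^sup>2 * 2" using \<rho> nu_mass_nonneg by (intro mult_mono) auto
    finally have "1 - \<rho>\<^sup>2 \<le> 2 * (nu_mass * r\<^sup>2)" by simp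
    moreover have \<rho>2: "0 \<le> 1 - \<rho>\<^sup>2" using \<rho> by (simp add: power_le_one)
    ultimately have A: "(1 - \<rho>\<^sup>2) * V \<le> 2 * (nu_mass * r\<^sup>2) * q"
      using V0 Vq nu_mass_nonneg by (intro mult_mono) auto
    define \<mu> where "\<mu> = (\<integral>x. g x \<partial>M)"
    have m\<mu>: "\<bar>m - \<mu>\<bar> \<le> \<Delta>"
    proof -
      have "dev n z g = n * (m - \<mu>)" using n0 by (simp add: dev_def m_def avg_def \<mu>_def field_simps)
      then show ?thesis using \<Delta> n0 by (simp add: abs_mult)
    qed
    have sq: "\<bar>avg n z (\<lambda>x. (g x)\<^sup>2) - (\<integral>x. (g x)\<^sup>2 \<partial>M)\<bar> \<le> \<Theta>"
    proof -
      have "dev n z (\<lambda>x. (g x)\<^sup>2) = n * (avg n z (\<lambda>x. (g x)\<^sup>2) - (\<integral>x. (g x)\<^sup>2 \<partial>M))"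
        using n0 by (simp add: dev_def avg_def field_simps)
      then show ?thesis using \<Theta> n0 by (simp add: abs_mult)
    qed
    have "\<bar>m\<^sup>2 - \<mu>\<^sup>2\<bar> = \<bar>m - \<mu>\<bar> * \<bar>m + \<mu>\<bar>"
      unfolding abs_mult[symmetric] by (simp add: power2_eq_square algebra_simps)
    also have "\<dots> \<le> \<Delta> * (b + (\<integral>x. G x \<partial>M))"
    proof (rule mult_mono[OF m\<mu>])
      show "\<bar>m + \<mu>\<bar> \<le> b + (\<integral>x. G x \<partial>M)"
        using ce(1) abs_integral_class_le[OF g] unfolding \<mu>_def by linarith
      show "0 \<le> \<Delta>" using m\<mu> by linarith
    qed simp
    finally have B: "\<bar>V - var g\<bar> \<le> \<Theta> + \<Delta> * (b + (\<integral>x. G x \<partial>M))"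
      unfolding var_eq[OF g] V_def \<mu>_def[symmetric] using sq by linarith
    have "\<bar>v\<^sup>2 * (n * V) - t\<^sup>2 * var g\<bar> = t\<^sup>2 * \<bar>\<rho>\<^sup>2 * V - var g\<bar>"
      unfolding vn by (simp add: right_diff_distrib[symmetric] abs_mult)
    also have "\<dots> \<le> 1 * \<bar>\<rho>\<^sup>2 * V - var g\<bar>"
    proof (intro mult_right_mono)
      have "t\<^sup>2 \<le> 1\<^sup>2" using t by (intro abs_le_square_iff[THEN iffD1]) simp
      then show "t\<^sup>2 \<le> 1" by simp
    qed auto
    also have "\<dots> \<le> \<bar>V - var g\<bar> + (1 - \<rho>\<^sup>2) * V"
    proof -
      have "\<bar>x - y\<bar> \<le> \<bar>w - y\<bar> + (w - x)" if "x \<le> w" for x y w :: real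
        using that by linarith
      moreover have "\<rho>\<^sup>2 * V \<le> V" using \<rho>2 V0 by (intro mult_left_le_one_le) auto
      ultimately show ?thesis by (simp add: left_diff_distrib)
    qed
    finally show ?thesis using A B by (simp add: mult_ac)
  qed
  have "\<bar>L.log_laplace h v - t\<^sup>2 * var g / 2\<bar> \<le> expansion_error r b q mx \<Delta> \<Theta>"
  proof -
    have split: "v\<^sup>2 / 2 * (\<integral>x. (h x)\<^sup>2 \<partial>dp_base \<nu> n z) = v\<^sup>2 / 2 * (\<integral>x. (h x)\<^sup>2 \<partial>\<nu>) + v\<^sup>2 * (n * V) / 2"
      unfolding dpi(2)[OF ih2] S2 by (simp add: distrib_left)
    have combine: "\<bar>X - \<tau> / 2\<bar> \<le> e1 + e2 + e4 / 2 + e5 + e6 + e7"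
      if "\<bar>X - (Y + (Z + w / 2))\<bar> \<le> e3" "\<bar>Y\<bar> \<le> e1" "0 \<le> Z" "Z \<le> e2" "e3 \<le> e6 + e7"
        "\<bar>w - \<tau>\<bar> \<le> e4 + 2 * e5" for X Y Z w \<tau> e1 e2 e3 e4 e5 e6 e7 :: real
      using that by linarith
    show ?thesis
      unfolding expansion_error_def by (rule combine[OF LL[unfolded split] T1 T2 T3 T4])
  qed
  then show ?thesis
    by (simp only: v_def a_def r_def b_def q_def h_def)
qed

abbreviation "square_mass \<equiv> (\<integral>x. (G x)\<^sup>2 \<partial>M)"

section \<open>The posterior Laplace transform of one function\<close>

text \<open>
  Exponential Chebyshev: with \<open>\<tau> = 1 / (8 * c)\<close> and \<open>s = 4 * \<tau> * sqrt n\<close>, where \<open>G > sqrt n\<close> the integrand is at most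
  \<open>exp (s * G - 2 * \<tau> * n)\<close>, and for this \<open>s\<close> the sub-Gaussian bound is \<open>C * exp (2 * \<tau> * n)\<close>.
\<close>

lemma nu_tail_le:
  fixes n :: nat and t :: real
  assumes n: "1 \<le> n" and t: "\<bar>t\<bar> * (8 * c) \<le> 1"
  shows "(\<integral>\<^sup>+x. ennreal (exp (2 * \<bar>t * sqrt n\<bar> * G x)) * indicator {x. sqrt n < G x} x \<partial>\<nu>) \<le> ennreal C"
proof -
  note measurable_nu[OF measurable_envelope, measurable]
  define \<tau> where "\<tau> = 1 / (8 * c)"
  have \<tau>: "0 < \<tau>" "\<bar>t\<bar> \<le> \<tau>" using c_pos t by (auto simp: \<tau>_def field_simps)
  define s where "s = 4 * \<tau> * sqrt n"
  have s: "0 < s" using \<tau> n by (simp add: s_def)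
  have "(\<integral>\<^sup>+x. ennreal (exp (2 * \<bar>t * sqrt n\<bar> * G x)) * indicator {x. sqrt n < G x} x \<partial>\<nu>)
      \<le> (\<integral>\<^sup>+x. ennreal (exp (- 2 * \<tau> * n)) * ennreal (exp (s * G x)) \<partial>\<nu>)"
  proof (rule nn_integral_mono)
    fix x assume "x \<in> space \<nu>"
    then have G0: "0 \<le> G x" by (intro envelope_nonneg) (simp add: space_nu)
    show "ennreal (exp (2 * \<bar>t * sqrt n\<bar> * G x)) * indicator {x. sqrt n < G x} x
        \<le> ennreal (exp (- 2 * \<tau> * n)) * ennreal (exp (s * G x))"
    proof (cases "sqrt n < G x")
      case True
      have "2 * \<bar>t * sqrt n\<bar> * G x \<le> 2 * (\<tau> * sqrt n) * G x"
      proof (intro mult_right_mono mult_left_mono G0)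
        show "\<bar>t * sqrt n\<bar> \<le> \<tau> * sqrt n"
          using mult_right_mono[OF \<tau>(2), of "sqrt n"] by (simp add: abs_mult)
      qed simp
      moreover have "2 * \<tau> * n \<le> 2 * \<tau> * (sqrt n * G x)"
      proof (intro mult_left_mono)
        have "sqrt n * sqrt n \<le> sqrt n * G x" using True by (intro mult_left_mono) auto
        then show "real n \<le> sqrt n * G x" by simp
      qed (use \<tau> in auto)
      ultimately have "2 * \<bar>t * sqrt n\<bar> * G x \<le> - 2 * \<tau> * n + s * G x"
        unfolding s_def by (simp add: mult_ac)
      then have "exp (2 * \<bar>t * sqrt n\<bar> * G x) \<le> exp (- 2 * \<tau> * n) * exp (s * G x)"
        by (simp add: exp_add[symmetric])
      then have "ennreal (exp (2 * \<bar>t * sqrt n\<bar> * G x)) \<le> ennreal (exp (- 2 * \<tau> * n) * exp (s * G x))"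
        by (rule ennreal_leI)
      then show ?thesis using True by (simp add: ennreal_mult)
    qed simp
  qed
  also have "\<dots> = ennreal (exp (- 2 * \<tau> * n)) * (\<integral>\<^sup>+x. ennreal (exp (s * G x)) \<partial>\<nu>)"
    by (rule nn_integral_cmult) measurable
  also have "\<dots> \<le> ennreal (exp (- 2 * \<tau> * n)) * ennreal (C * exp (c * s\<^sup>2))"
    by (intro mult_left_mono exp_bound s) auto
  also have "\<dots> = ennreal C"
  proof -
    have "c * s\<^sup>2 = 2 * \<tau> * n"
      using c_pos by (simp add: s_def \<tau>_def power_mult_distrib power2_eq_square field_simps)
    then have "exp (- 2 * \<tau> * n) * (C * exp (c * s\<^sup>2)) = C * (exp (- (2 * \<tau> * n)) * exp (2 * \<tau> * n))"
      by simp
    also have "\<dots> = C" by (simp add: exp_minus)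
    finally show ?thesis using C_pos by (simp add: ennreal_mult[symmetric])
  qed
  finally show ?thesis .
qed

text \<open>
  The three comparisons together: truncation, passage to the gamma process, and expansion, with \<open>\<eta> = 1 / sqrt n\<close> in
  the truncation error. The truncation error involves the transform at \<open>2 * t\<close>, the comparison with the gamma process
  at \<open>\<tau>\<close> requires \<open>\<bar>\<tau>\<bar> \<le> 1 / 16\<close> and involves \<open>2 * \<tau>\<close>; this explains \<open>\<bar>t\<bar> \<le> 1 / 32\<close>.
\<close>

lemma posterior_laplace_estimate:
  fixes mx t \<Delta> \<Theta> :: real
  assumes n: "1 \<le> n" and z: "z \<in> space (iid_seq M)" and g: "g \<in> \<G>"
    and mx: "\<And>i. i < n \<Longrightarrow> G (z i) \<le> mx" "mx \<le> sqrt n"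
    and t: "\<bar>t\<bar> \<le> 1 / 32" "\<bar>t\<bar> * (8 * c) \<le> 1"
    and \<Delta>: "\<bar>dev n z g\<bar> \<le> n * \<Delta>" and \<Theta>: "\<bar>dev n z (\<lambda>x. (g x)\<^sup>2)\<bar> \<le> n * \<Theta>"
    and e: "expansion_error (1 / sqrt n) (avg n z G) (avg n z (\<lambda>x. (G x)\<^sup>2)) mx \<Delta> \<Theta> = e"
  shows "\<bar>(\<integral>P. exp (t * sqrt n * ((\<integral>x. g x \<partial>P) - avg n z g)) \<partial>DP n z) - exp (t\<^sup>2 * var g / 2)\<bar>
    \<le> exp (square_mass + e) * (2 * (1 / sqrt n)\<^sup>2 + 3 / 2 * (1 / sqrt n) + e) + C / 2 * (1 / sqrt n)"
proof -
  note law = posterior_law[OF n z]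
  interpret L: dirichlet_law "dp_base \<nu> n z" "DP n z" by (rule law(1))
  have zs: "z i \<in> space M" for i using z by (simp add: space_iid_seq)
  have zs': "z i \<in> space \<nu>" for i using zs by (simp add: space_nu)
  define a where "a = nu_mass + n"
  have n0: "0 < real n" using n by simp
  have a0: "0 < a" "real n \<le> a" using n0 nu_mass_nonneg by (auto simp: a_def)
  have mass: "L.mass = a" using law(2) by (simp add: a_def)
  define r where "r = 1 / sqrt n"
  have r0: "0 < r" using n0 by (simp add: r_def)
  have r2: "r\<^sup>2 = 1 / n" using n0 by (simp add: r_def power_divide)
  define h where "h = centred n z g"
  define m where "m = avg n z g"
  define B where "B = exp (square_mass + e)"
  note ce = abs_centred_le[OF n z g mx, folded h_def]
  have gm: "g \<in> borel_measurable M" using g by (rule measurable_class)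
  have base_meas: "f \<in> borel_measurable (dp_base \<nu> n z)" if "f \<in> borel_measurable M" for f :: "'a \<Rightarrow> real"
    using measurable_nu[OF that] by (simp cong: measurable_cong_sets)
  have hm: "h \<in> borel_measurable (dp_base \<nu> n z)"
  proof (rule base_meas)
    note gm[measurable]
    show "h \<in> borel_measurable M" unfolding h_def centred_def[abs_def] by measurable
  qed
  have LL: "\<bar>L.log_laplace h (\<tau> * sqrt n / a) - \<tau>\<^sup>2 * var g / 2\<bar> \<le> e" if "\<bar>\<tau>\<bar> \<le> 1 / 4" for \<tau>
    unfolding h_def a_def using log_laplace_estimate[OF n z g mx that \<Delta> \<Theta>] e by simp
  have e0: "0 \<le> e" using LL[of 0] by linarith
  have var_le: "\<tau>\<^sup>2 * var g / 2 \<le> square_mass" if "\<bar>\<tau>\<bar> \<le> 1" for \<tau>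
  proof -
    have "\<tau>\<^sup>2 \<le> 1\<^sup>2" using that by (intro abs_le_square_iff[THEN iffD1]) simp
    then have "\<tau>\<^sup>2 * var g \<le> 1 * var g" using var_bounds(1)[OF g] by (intro mult_right_mono) auto
    then show ?thesis using var_bounds[OF g] by linarith
  qed
  have LB: "exp (L.log_laplace h (\<tau> * sqrt n / a)) \<le> B" if "\<bar>\<tau>\<bar> \<le> 1 / 4" for \<tau>
    using LL[OF that] var_le[of \<tau>] that unfolding B_def by simp
  have approx: "\<bar>(\<integral>P. exp (\<tau> * sqrt n * (\<integral>x. h x \<partial>P)) \<partial>DP n z) - exp (L.log_laplace h (\<tau> * sqrt n / a))\<bar> \<le> 2 * B * r\<^sup>2"
    if \<tau>: "\<bar>\<tau>\<bar> \<le> 1 / 16" for \<tau>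
  proof -
    \<comment> \<open>on \<open>h\<close>, which is bounded by \<open>2 * sqrt n\<close>\<close>
    have cond: "8 * (\<bar>\<tau> * sqrt n\<bar> * (2 * sqrt n)) \<le> L.mass"
    proof -
      have "8 * (\<bar>\<tau> * sqrt n\<bar> * (2 * sqrt n)) = 16 * \<bar>\<tau>\<bar> * (sqrt n * sqrt n)" by (simp add: abs_mult)
      also have "\<dots> = 16 * \<bar>\<tau>\<bar> * n" by simp
      also have "\<dots> \<le> 1 * real n" using \<tau> by (intro mult_right_mono) auto
      finally show ?thesis using a0 by (simp add: mass)
    qed
    have "\<bar>(\<integral>P. exp (\<tau> * sqrt n * (\<integral>x. h x \<partial>P)) \<partial>DP n z) - exp (L.log_laplace h (\<tau> * sqrt n / a))\<bar>
        \<le> (exp (L.log_laplace h (2 * (\<tau> * sqrt n) / a)) + exp (L.log_laplace h (- 2 * (\<tau> * sqrt n) / a))) / a"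
      using L.laplace_bounded[OF hm ce(5) cond] by (simp add: mass)
    also have "\<dots> \<le> (B + B) / n"
    proof (intro frac_le add_mono)
      show "exp (L.log_laplace h (2 * (\<tau> * sqrt n) / a)) \<le> B"
        using LB[of "2 * \<tau>"] \<tau> by (simp add: mult.assoc)
      show "exp (L.log_laplace h (- 2 * (\<tau> * sqrt n) / a)) \<le> B"
        using LB[of "- 2 * \<tau>"] \<tau> by (simp add: mult.assoc)
    qed (use n0 a0 in \<open>auto simp: B_def\<close>)
    finally show ?thesis by (simp add: r2)
  qed
  have r1: "r\<^sup>2 \<le> 1" using n by (simp add: r2)
  have B0: "0 < B" by (simp add: B_def)
  have EB: "(\<integral>P. exp (2 * (t * sqrt n) * (\<integral>x. h x \<partial>P)) \<partial>DP n z) \<le> 3 * B"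
  proof -
    have t2: "\<bar>2 * t\<bar> \<le> 1 / 16" "\<bar>2 * t\<bar> \<le> 1 / 4" using t by auto
    have "2 * B * r\<^sup>2 \<le> 2 * B * 1" using r1 B0 by (intro mult_left_mono) auto
    then show ?thesis
      using approx[OF t2(1)] LB[OF t2(2)] by (simp add: mult.assoc)
  qed
  have trunc: "\<bar>(\<integral>P. exp (t * sqrt n * ((\<integral>x. g x \<partial>P) - m)) \<partial>DP n z) - (\<integral>P. exp (t * sqrt n * (\<integral>x. h x \<partial>P)) \<partial>DP n z)\<bar>
    \<le> (r * (3 * B) + C / (r * a)) / 2"
  proof -
    \<comment> \<open>no observation exceeds \<open>sqrt n\<close>, so only \<open>\<nu>\<close> contributes\<close>
    have nu_tail: "(\<integral>\<^sup>+x. ennreal (exp (2 * \<bar>t * sqrt n\<bar> * G x)) * indicator {x. sqrt n < G x} x \<partial>dp_base \<nu> n z) \<le> ennreal C"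
    proof -
      have "\<not> sqrt n < G (z i)" if "i < n" for i using mx(1)[OF that] mx(2) by linarith
      then have "(\<Sum>i<n. ennreal (exp (2 * \<bar>t * sqrt n\<bar> * G (z i))) * indicator {x. sqrt n < G x} (z i)) = 0"
        by (intro sum.neutral) auto
      moreover have "(\<lambda>x. ennreal (exp (2 * \<bar>t * sqrt n\<bar> * G x)) * indicator {x. sqrt n < G x} x) \<in> borel_measurable \<nu>"
        using measurable_nu[OF measurable_envelope] by measurable
      ultimately show ?thesis
        using nu_tail_le[OF n t(2)] by (subst nn_integral_dp_base[OF n zs']) auto
    qed
    have hform: "h = (\<lambda>x. max (- sqrt n) (min (sqrt n) (g x)) - m)"
      by (simp add: h_def centred_def[abs_def] m_def)
    show ?thesis
      using L.exp_truncation_error[OF base_meas[OF gm] base_meas[OF measurable_envelope] _ _ r0 nu_tail _ EB[unfolded hform]]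
        envelope[OF g] C_pos unfolding hform by (simp add: space_nu mass)
  qed
  have ra: "C / (r * a) \<le> C * r"
  proof -
    have "1 / (r * a) \<le> 1 / (r * n)" using r0 a0 n0 by (intro divide_left_mono) auto
    also have "r * n = sqrt n" using n0 by (simp add: r_def real_div_sqrt)
    also have "1 / sqrt n = r" by (simp add: r_def)
    finally have "C * (1 / (r * a)) \<le> C * r" using C_pos by (intro mult_left_mono) auto
    then show ?thesis by simp
  qed
  have t4: "\<bar>t\<bar> \<le> 1 / 4" "\<bar>t\<bar> \<le> 1 / 16" "\<bar>t\<bar> \<le> 1" using t by auto
  have expo: "\<bar>exp (L.log_laplace h (t * sqrt n / a)) - exp (t\<^sup>2 * var g / 2)\<bar> \<le> B * e"
  proof -
    have "\<bar>exp (L.log_laplace h (t * sqrt n / a)) - exp (t\<^sup>2 * var g / 2)\<bar>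
        \<le> B * \<bar>L.log_laplace h (t * sqrt n / a) - t\<^sup>2 * var g / 2\<bar>"
      unfolding B_def using LL[OF t4(1)] var_le[OF t4(3)] e0 by (intro abs_exp_diff_le) auto
    also have "\<dots> \<le> B * e" using LL[OF t4(1)] B0 by (intro mult_left_mono) auto
    finally show ?thesis .
  qed
  have "(r * (3 * B) + C / (r * a)) / 2 \<le> (r * (3 * B) + C * r) / 2"
    by (intro divide_right_mono add_left_mono ra) simp
  then have "\<bar>(\<integral>P. exp (t * sqrt n * ((\<integral>x. g x \<partial>P) - m)) \<partial>DP n z) - exp (t\<^sup>2 * var g / 2)\<bar>
    \<le> (r * (3 * B) + C * r) / 2 + 2 * B * r\<^sup>2 + B * e"
    using trunc approx[OF t4(2)] expo by linarith
  also have "\<dots> = B * (2 * r\<^sup>2 + 3 / 2 * r + e) + C / 2 * r"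
    by (simp add: field_simps)
  finally show ?thesis by (simp only: B_def r_def m_def)
qed

text \<open>
  A finite bound valid for every sample. It provides a majorant on the event that some observation exceeds \<open>sqrt n\<close>, which
  almost surely happens for finitely many \<open>n\<close> only.
\<close>

lemma posterior_laplace_crude:
  assumes n: "1 \<le> n" and z: "z \<in> space (iid_seq M)" and g: "g \<in> \<G>" and t: "\<bar>t\<bar> \<le> 1"
  shows "\<bar>(\<integral>P. exp (t * sqrt n * ((\<integral>x. g x \<partial>P) - avg n z g)) \<partial>DP n z) - exp (t\<^sup>2 * var g / 2)\<bar>
    \<le> exp (\<bar>t * sqrt n\<bar> * avg n z G) / (nu_mass + n) *
        (enn2real (\<integral>\<^sup>+x. ennreal (exp (\<bar>t * sqrt n\<bar> * G x)) \<partial>\<nu>) + (\<Sum>i<n. exp (\<bar>t * sqrt n\<bar> * G (z i)))) + exp square_mass"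
proof -
  note law = posterior_law[OF n z]
  interpret L: dirichlet_law "dp_base \<nu> n z" "DP n z" by (rule law(1))
  have zs: "z i \<in> space M" for i using z by (simp add: space_iid_seq)
  have zs': "z i \<in> space \<nu>" for i using zs by (simp add: space_nu)
  define s where "s = t * sqrt n"
  define E where "E = enn2real (\<integral>\<^sup>+x. ennreal (exp (\<bar>s\<bar> * G x)) \<partial>\<nu>)"
  have G\<nu>[measurable]: "G \<in> borel_measurable \<nu>" by (rule measurable_nu) simp
  have base_meas: "f \<in> borel_measurable (dp_base \<nu> n z)" if "f \<in> borel_measurable M" for f :: "'a \<Rightarrow> real"
    using measurable_nu[OF that] by (simp cong: measurable_cong_sets)
  have gm: "g \<in> borel_measurable (dp_base \<nu> n z)" using measurable_class[OF g] by (rule base_meas)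
  have "(\<integral>\<^sup>+x. ennreal (exp (\<bar>s\<bar> * G x)) \<partial>\<nu>) \<le> (\<integral>\<^sup>+x. ennreal (exp ((\<bar>s\<bar> + 1) * G x)) \<partial>\<nu>)"
    using envelope_nonneg by (intro nn_integral_mono ennreal_leI) (auto simp: space_nu intro!: mult_right_mono)
  also have "\<dots> < \<infinity>" by (rule order_le_less_trans[OF exp_bound]) auto
  finally have E: "(\<integral>\<^sup>+x. ennreal (exp (\<bar>s\<bar> * G x)) \<partial>\<nu>) = ennreal E"
    unfolding E_def by (simp add: top.not_eq_extremum)
  have E0: "0 \<le> E" by (simp add: E_def)
  define R where "R = exp (\<bar>s\<bar> * avg n z G) / (nu_mass + n) * (E + (\<Sum>i<n. exp (\<bar>s\<bar> * G (z i))))"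
  have mpos: "0 < nu_mass + n" using n nu_mass_nonneg by simp
  have R0: "0 \<le> R" unfolding R_def using mpos E0 by (intro mult_nonneg_nonneg add_nonneg_nonneg sum_nonneg) auto
  have avg_le: "\<bar>avg n z g\<bar> \<le> avg n z G"
  proof -
    have "\<bar>\<Sum>i<n. g (z i)\<bar> \<le> (\<Sum>i<n. G (z i))"
      by (intro order_trans[OF sum_abs] sum_mono envelope g zs)
    then show ?thesis by (simp add: avg_def divide_right_mono)
  qed
  have "(\<integral>\<^sup>+P. ennreal (exp (s * ((\<integral>x. g x \<partial>P) - avg n z g))) \<partial>DP n z)
      \<le> ennreal (exp (\<bar>s\<bar> * \<bar>avg n z g\<bar>) / L.mass) * (\<integral>\<^sup>+x. ennreal (exp (\<bar>s\<bar> * G x)) \<partial>dp_base \<nu> n z)"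
    using envelope[OF g] by (intro L.nn_integral_exp_le gm base_meas measurable_envelope) (simp add: space_nu)
  also have "(\<integral>\<^sup>+x. ennreal (exp (\<bar>s\<bar> * G x)) \<partial>dp_base \<nu> n z) = ennreal (E + (\<Sum>i<n. exp (\<bar>s\<bar> * G (z i))))"
    using E0 by (subst nn_integral_dp_base[OF n zs']) (auto simp: E sum_nonneg)
  also have "ennreal (exp (\<bar>s\<bar> * \<bar>avg n z g\<bar>) / L.mass) * ennreal (E + (\<Sum>i<n. exp (\<bar>s\<bar> * G (z i)))) \<le> ennreal R"
  proof -
    have "exp (\<bar>s\<bar> * \<bar>avg n z g\<bar>) / L.mass * (E + (\<Sum>i<n. exp (\<bar>s\<bar> * G (z i)))) \<le> R"
      unfolding R_def law(2) using avg_le mpos E0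
      by (intro mult_right_mono divide_right_mono) (auto intro!: mult_left_mono sum_nonneg add_nonneg_nonneg)
    then show ?thesis
      using mpos E0 by (subst ennreal_mult[symmetric]) (auto simp: law(2) sum_nonneg intro!: ennreal_leI)
  qed
  finally have nn: "(\<integral>\<^sup>+P. ennreal (exp (s * ((\<integral>x. g x \<partial>P) - avg n z g))) \<partial>DP n z) \<le> ennreal R" .
  have m: "(\<lambda>P. exp (s * ((\<integral>x. g x \<partial>P) - avg n z g))) \<in> borel_measurable (DP n z)"
    using L.borel_measurable_integral_D[OF gm] by measurable
  have "(\<integral>P. exp (s * ((\<integral>x. g x \<partial>P) - avg n z g)) \<partial>DP n z) = enn2real (\<integral>\<^sup>+P. ennreal (exp (s * ((\<integral>x. g x \<partial>P) - avg n z g))) \<partial>DP n z)"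
    using m by (intro integral_eq_nn_integral) auto
  also have "\<dots> \<le> R" by (rule enn2real_leI[OF R0 nn])
  finally have up: "(\<integral>P. exp (s * ((\<integral>x. g x \<partial>P) - avg n z g)) \<partial>DP n z) \<le> R" .
  have low: "0 \<le> (\<integral>P. exp (s * ((\<integral>x. g x \<partial>P) - avg n z g)) \<partial>DP n z)" by simp
  have "t\<^sup>2 * var g / 2 \<le> square_mass"
  proof -
    have "t\<^sup>2 \<le> 1\<^sup>2" using t by (intro abs_le_square_iff[THEN iffD1]) simp
    then have "t\<^sup>2 * var g \<le> 1 * var g" using var_bounds(1)[OF g] by (intro mult_right_mono) auto
    then show ?thesis using var_bounds[OF g] by linarith
  qed
  then have "exp (t\<^sup>2 * var g / 2) \<le> exp square_mass" by simp
  moreover have "0 < exp (t\<^sup>2 * var g / 2)" by simp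
  ultimately have "\<bar>(\<integral>P. exp (s * ((\<integral>x. g x \<partial>P) - avg n z g)) \<partial>DP n z) - exp (t\<^sup>2 * var g / 2)\<bar> \<le> R + exp square_mass"
    using up low R0 by linarith
  then show ?thesis unfolding R_def E_def s_def .
qed

section \<open>Uniformity over the class\<close>

lemma expansion_error_nonneg:
  "0 \<le> r \<Longrightarrow> 0 \<le> b \<Longrightarrow> 0 \<le> q \<Longrightarrow> 0 \<le> mx \<Longrightarrow> 0 \<le> \<Delta> \<Longrightarrow> 0 \<le> \<Theta> \<Longrightarrow> 0 \<le> expansion_error r b q mx \<Delta> \<Theta>"
  unfolding expansion_error_def using nu_mass_nonneg nu_moment_nonneg envelope_nonneg
  by (intro add_nonneg_nonneg mult_nonneg_nonneg divide_nonneg_nonneg zero_le_power integral_nonneg_AE AE_I2) auto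

lemma expansion_error_mono:
  assumes "0 \<le> r" "0 \<le> b" "0 \<le> q" "0 \<le> mx" "0 \<le> \<Delta>" "b \<le> b'" "q \<le> q'"
  shows "expansion_error r b q mx \<Delta> \<Theta> \<le> expansion_error r b' q' mx \<Delta> \<Theta>"
proof -
  have "0 \<le> (\<integral>x. G x \<partial>M)" using envelope_nonneg by (intro integral_nonneg_AE AE_I2)
  then show ?thesis
    unfolding expansion_error_def using assms nu_mass_nonneg nu_moment_nonneg
    by (intro add_mono mult_mono mult_left_mono power_mono divide_right_mono order_refl)
      (auto intro!: add_nonneg_nonneg mult_nonneg_nonneg)
qed

text \<open>
  The maximum of the sample is \<open>o (sqrt n)\<close>, because \<open>G\<^sup>2 \<le> k\<^sup>2 + square_tail k\<close>: the square of the maximum is at most \<open>k\<^sup>2\<close>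
  plus the sum of all the tails, which is a small multiple of \<open>n\<close>.
\<close>

lemma AE_envelope_asymptotics:
  "AE z in iid_seq M. (\<forall>\<^sub>F n in sequentially. avg n z (\<lambda>x. (G x)\<^sup>2) \<le> square_mass + 1 \<and> avg n z G \<le> square_mass + 2) \<and>
    (\<lambda>n. 1 / sqrt n * Max ((\<lambda>i. G (z i)) ` {..<n})) \<longlonglongrightarrow> 0"
  using AE_eventually_square_tail_sum_le AE_space
proof eventually_elim
  case (elim z)
  have zs: "z i \<in> space M" for i using elim(2) by (simp add: space_iid_seq)
  have mx0: "0 \<le> Max ((\<lambda>i. G (z i)) ` {..<n})" if "1 \<le> n" for n
  proof -
    have "G (z 0) \<le> Max ((\<lambda>i. G (z i)) ` {..<n})" using that by (intro Max_ge) auto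
    then show ?thesis using envelope_nonneg[OF zs[of 0]] by linarith
  qed
  show ?case
  proof
    have tail0: "square_tail 0 x = (G x)\<^sup>2" if "x \<in> space M" for x
      using envelope_nonneg[OF that] by (auto simp: square_tail_def indicator_def)
    then have int0: "(\<integral>x. square_tail 0 x \<partial>M) = square_mass"
      by (intro Bochner_Integration.integral_cong) auto
    have "\<forall>\<^sub>F n in sequentially. (\<Sum>i<n. square_tail (real 0) (z i)) \<le> ((\<integral>x. square_tail (real 0) x \<partial>M) + 1 / real (Suc 0)) * n"
      using elim(1) by (rule spec)
    with eventually_ge_at_top[of 1]
    show "\<forall>\<^sub>F n in sequentially. avg n z (\<lambda>x. (G x)\<^sup>2) \<le> square_mass + 1 \<and> avg n z G \<le> square_mass + 2"
    proof eventually_elim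
      case (elim n)
      have n0: "0 < real n" using elim by simp
      have sq: "(\<Sum>i<n. (G (z i))\<^sup>2) \<le> (square_mass + 1) * n"
        using elim(2) by (simp add: tail0[OF zs] int0)
      have "(\<Sum>i<n. G (z i)) \<le> (\<Sum>i<n. 1 + (G (z i))\<^sup>2)"
      proof (rule sum_mono)
        fix i
        have "0 \<le> (1 - G (z i))\<^sup>2 + (G (z i))\<^sup>2 + 1" by (intro add_nonneg_nonneg) auto
        then show "G (z i) \<le> 1 + (G (z i))\<^sup>2" by (simp add: power2_diff)
      qed
      also have "\<dots> \<le> n + (square_mass + 1) * n" using sq by (simp add: sum.distrib)
      finally have "(\<Sum>i<n. G (z i)) \<le> (square_mass + 2) * n" by (simp add: algebra_simps)
      with sq show ?case using n0 by (simp add: avg_def pos_divide_le_eq)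
    qed
    show "(\<lambda>n. 1 / sqrt n * Max ((\<lambda>i. G (z i)) ` {..<n})) \<longlonglongrightarrow> 0"
    proof (rule LIMSEQ_I)
      fix \<epsilon> :: real assume \<epsilon>: "0 < \<epsilon>"
      define \<eta> where "\<eta> = \<epsilon>\<^sup>2 / 4"
      have \<eta>: "0 < \<eta>" using \<epsilon> by (simp add: \<eta>_def)
      have "\<forall>\<^sub>F k in sequentially. (\<integral>x. square_tail (real k) x \<partial>M) < \<eta>"
        by (rule order_tendstoD(2)[OF square_tail_integral_tendsto \<eta>])
      moreover have "\<forall>\<^sub>F k in sequentially. 1 / real (Suc k) < \<eta>"
        by (rule order_tendstoD(2)[OF LIMSEQ_Suc[OF lim_const_over_n] \<eta>])
      ultimately have "\<forall>\<^sub>F k in sequentially. (\<integral>x. square_tail (real k) x \<partial>M) < \<eta> \<and> 1 / real (Suc k) < \<eta>"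
        by (rule eventually_conj)
      then obtain k :: nat where k: "(\<integral>x. square_tail (real k) x \<partial>M) < \<eta>" "1 / real (Suc k) < \<eta>"
        by (auto simp: eventually_sequentially)
      have "\<forall>\<^sub>F n in sequentially. (\<Sum>i<n. square_tail (real k) (z i)) \<le> ((\<integral>x. square_tail (real k) x \<partial>M) + 1 / real (Suc k)) * n"
        using elim(1) by (rule spec)
      moreover have "\<forall>\<^sub>F n in sequentially. (real k)\<^sup>2 / real n < \<eta>"
        by (rule order_tendstoD(2)[OF lim_const_over_n \<eta>])
      ultimately have "\<forall>\<^sub>F n in sequentially. norm (1 / sqrt n * Max ((\<lambda>i. G (z i)) ` {..<n}) - 0) < \<epsilon>"
        using eventually_ge_at_top[of 1]
      proof eventually_elim
        case (elim n)
        define mx where "mx = Max ((\<lambda>i. G (z i)) ` {..<n})"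
        have n0: "0 < real n" using elim(3) by simp
        have "mx \<in> (\<lambda>i. G (z i)) ` {..<n}" unfolding mx_def using elim(3) by (intro Max_in) (auto simp: lessThan_empty_iff)
        then obtain i where i: "i < n" "mx = G (z i)" by auto
        have "mx\<^sup>2 \<le> (real k)\<^sup>2 + square_tail (real k) (z i)"
          unfolding i(2) by (rule square_le_tail[OF _ zs]) simp
        also have "square_tail (real k) (z i) \<le> (\<Sum>i<n. square_tail (real k) (z i))"
          using i(1) by (intro member_le_sum) (auto simp: square_tail_nonneg)
        also have "\<dots> \<le> ((\<integral>x. square_tail (real k) x \<partial>M) + 1 / real (Suc k)) * n" by (rule elim(1))
        also have "\<dots> \<le> (\<eta> + \<eta>) * n" using k by (intro mult_right_mono) auto
        finally have "mx\<^sup>2 \<le> (real k)\<^sup>2 + (\<eta> + \<eta>) * n" by simp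
        also have "(real k)\<^sup>2 < \<eta> * n" using elim(2) n0 by (simp add: pos_divide_less_eq)
        finally have "mx\<^sup>2 < 4 * \<eta> * n" using mult_pos_pos[OF \<eta> n0] by (simp add: distrib_right mult.commute mult.left_commute)
        then have "mx\<^sup>2 < (\<epsilon> * sqrt n)\<^sup>2" by (simp add: \<eta>_def power_mult_distrib)
        then have "mx < \<epsilon> * sqrt n" using \<epsilon> by (intro power2_less_imp_less[of mx]) auto
        moreover have "0 \<le> mx" unfolding mx_def by (rule mx0[OF elim(3)])
        ultimately show ?case
          unfolding mx_def[symmetric] using n0 by (simp add: pos_divide_less_eq mult.commute)
      qed
      then show "\<exists>no. \<forall>n\<ge>no. norm (1 / sqrt n * Max ((\<lambda>i. G (z i)) ` {..<n}) - 0) < \<epsilon>"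
        by (simp add: eventually_sequentially)
    qed
  qed
qed

lemma expansion_error_tendsto_zero:
  assumes r: "r \<longlonglongrightarrow> 0" and mx: "(\<lambda>n. r n * mx n) \<longlonglongrightarrow> 0" and \<Delta>: "\<Delta> \<longlonglongrightarrow> 0" and \<Theta>: "\<Theta> \<longlonglongrightarrow> 0"
  shows "(\<lambda>n. expansion_error (r n) b q (mx n) (\<Delta> n) (\<Theta> n)) \<longlonglongrightarrow> 0"
proof -
  have "(\<lambda>n. r n * (nu_moment 1 + nu_mass * b) + (r n)\<^sup>2 * (nu_moment 2 + nu_mass * b\<^sup>2)
    + (\<Theta> n + \<Delta> n * (b + (\<integral>x. G x \<partial>M))) / 2 + (r n)\<^sup>2 * (nu_mass * q)
    + 8 * (r n) ^ 3 * (nu_moment 3 + nu_mass * b ^ 3) + 4 * (r n * mx n + r n * b) * (q + b\<^sup>2))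
    \<longlonglongrightarrow> 0 * (nu_moment 1 + nu_mass * b) + 0\<^sup>2 * (nu_moment 2 + nu_mass * b\<^sup>2)
    + (0 + 0 * (b + (\<integral>x. G x \<partial>M))) / 2 + 0\<^sup>2 * (nu_mass * q)
    + 8 * 0 ^ 3 * (nu_moment 3 + nu_mass * b ^ 3) + 4 * (0 + 0 * b) * (q + b\<^sup>2)"
    by (intro tendsto_intros assms) auto
  moreover have "4 * (r n * mx n + r n * b) * (q + b\<^sup>2) = 4 * r n * (mx n + b) * (q + b\<^sup>2)" for n
    by (simp add: algebra_simps)
  ultimately have "(\<lambda>n. r n * (nu_moment 1 + nu_mass * b) + (r n)\<^sup>2 * (nu_moment 2 + nu_mass * b\<^sup>2)
    + (\<Theta> n + \<Delta> n * (b + (\<integral>x. G x \<partial>M))) / 2 + (r n)\<^sup>2 * (nu_mass * q)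
    + 8 * (r n) ^ 3 * (nu_moment 3 + nu_mass * b ^ 3) + 4 * r n * (mx n + b) * (q + b\<^sup>2)) \<longlonglongrightarrow> 0"
    by (simp only:) simp
  then show ?thesis
    unfolding expansion_error_def .
qed

text \<open>
  The bounds obtained so far depend on the sample through measurable quantities that do not involve \<open>g\<close>, namely the
  majorants for the deviations of the class and of its squares, the sample means of \<open>G\<close> and \<open>G\<^sup>2\<close>, and the sample
  maximum. Together they form the required majorant \<open>R\<close>.
\<close>

lemma posterior_laplace_as_star:
  assumes gc: "glivenko_cantelli M \<G>" and t: "\<bar>t\<bar> \<le> 1 / 32" "\<bar>t\<bar> * (8 * c) \<le> 1"
  shows "as_star_tendsto_zero (iid_seq M) (\<lambda>n z. SUP g\<in>\<G>. ennreal
    \<bar>(\<integral>P. exp (t * sqrt n * ((\<integral>x. g x \<partial>P) - (\<integral>x. g x \<partial>empirical_measure M n z))) \<partial>DP n z) - exp (t\<^sup>2 * var g / 2)\<bar>)"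
proof (rule gc_majorant[OF gc])
  fix \<Delta> :: "nat \<Rightarrow> (nat \<Rightarrow> 'a) \<Rightarrow> real" and d :: "nat \<Rightarrow> real"
  assume \<Delta>m: "\<And>n. 1 \<le> n \<Longrightarrow> \<Delta> n \<in> borel_measurable (iid_seq M)"
    and \<Delta>0: "\<And>n z. 1 \<le> n \<Longrightarrow> z \<in> space (iid_seq M) \<Longrightarrow> 0 \<le> \<Delta> n z"
    and \<Delta>: "\<And>n g z. 1 \<le> n \<Longrightarrow> g \<in> \<G> \<Longrightarrow> z \<in> space (iid_seq M) \<Longrightarrow> \<bar>dev n z g\<bar> \<le> n * \<Delta> n z"
    and \<Delta>AE: "AE z in iid_seq M. (\<lambda>n. \<Delta> n z) \<longlonglongrightarrow> 0"
    and "\<And>n. 1 \<le> n \<Longrightarrow> (\<integral>\<^sup>+z. ennreal (\<Delta> n z) \<partial>iid_seq M) \<le> ennreal (d n)"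
    and "\<And>n. 0 \<le> d n" "d \<longlonglongrightarrow> 0"
  from gc_squares[OF gc] obtain \<Theta> :: "nat \<Rightarrow> (nat \<Rightarrow> 'a) \<Rightarrow> real" where
    \<Theta>m: "\<forall>n\<ge>1. \<Theta> n \<in> borel_measurable (iid_seq M)" and
    \<Theta>bd: "\<forall>n\<ge>1. \<forall>z\<in>space (iid_seq M). 0 \<le> \<Theta> n z \<and>
      (SUP g\<in>\<G>. ennreal (\<bar>dev n z (\<lambda>x. (g x)\<^sup>2)\<bar> / n)) \<le> ennreal (\<Theta> n z)" and
    \<Theta>AE: "AE z in iid_seq M. (\<lambda>n. \<Theta> n z) \<longlonglongrightarrow> 0"
    unfolding as_star_tendsto_zero_def by auto
  have \<Theta>: "\<bar>dev n z (\<lambda>x. (g x)\<^sup>2)\<bar> \<le> n * \<Theta> n z" if n: "1 \<le> n" and g: "g \<in> \<G>" and z: "z \<in> space (iid_seq M)" for n g z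
  proof -
    have "ennreal (\<bar>dev n z (\<lambda>x. (g x)\<^sup>2)\<bar> / n) \<le> (SUP g\<in>\<G>. ennreal (\<bar>dev n z (\<lambda>x. (g x)\<^sup>2)\<bar> / n))"
      using g by (rule SUP_upper)
    also have "\<dots> \<le> ennreal (\<Theta> n z)" using \<Theta>bd n z by blast
    finally have "\<bar>dev n z (\<lambda>x. (g x)\<^sup>2)\<bar> / n \<le> \<Theta> n z"
      using \<Theta>bd n z by (subst (asm) ennreal_le_iff) auto
    then show ?thesis using n by (simp add: field_simps)
  qed
  define mx where "mx n z = Max ((\<lambda>i. G (z i)) ` {..<n})" for n :: nat and z :: "nat \<Rightarrow> 'a"
  define e where "e n z = expansion_error (1 / sqrt n) (avg n z G) (avg n z (\<lambda>x. (G x)\<^sup>2)) (mx n z) (\<Delta> n z) (\<Theta> n z)"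
    for n :: nat and z :: "nat \<Rightarrow> 'a"
  define est where "est y r = exp (square_mass + y) * (2 * r\<^sup>2 + 3 / 2 * r + y) + C / 2 * r" for y r :: real
  define crude where "crude n z = exp (\<bar>t * sqrt n\<bar> * avg n z G) / (nu_mass + n) *
        (enn2real (\<integral>\<^sup>+x. ennreal (exp (\<bar>t * sqrt n\<bar> * G x)) \<partial>\<nu>) + (\<Sum>i<n. exp (\<bar>t * sqrt n\<bar> * G (z i)))) + exp square_mass"
    for n :: nat and z :: "nat \<Rightarrow> 'a"
  define R where "R n z = (if mx n z \<le> sqrt n then est (e n z) (1 / sqrt n) else crude n z)" for n z
  have comp: "(\<lambda>z. G (z i)) \<in> borel_measurable (iid_seq M)" for i
    by (rule borel_measurable_iid_seq_component) simp
  have avg_meas[measurable]: "(\<lambda>z. avg n z f) \<in> borel_measurable (iid_seq M)" if "f \<in> borel_measurable M" for n f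
    unfolding avg_def using borel_measurable_iid_seq_component[OF that]
    by (intro borel_measurable_divide borel_measurable_sum) auto
  have mx_meas: "mx n \<in> borel_measurable (iid_seq M)" for n
    unfolding mx_def[abs_def] using comp by (intro borel_measurable_Max) auto
  have e_meas: "e n \<in> borel_measurable (iid_seq M)" if "1 \<le> n" for n
  proof -
    have [measurable]: "\<Delta> n \<in> borel_measurable (iid_seq M)" "\<Theta> n \<in> borel_measurable (iid_seq M)" "mx n \<in> borel_measurable (iid_seq M)"
      using \<Delta>m[OF that] \<Theta>m that mx_meas by auto
    have [measurable]: "(\<lambda>z. avg n z G) \<in> borel_measurable (iid_seq M)" "(\<lambda>z. avg n z (\<lambda>x. (G x)\<^sup>2)) \<in> borel_measurable (iid_seq M)"
      by (intro avg_meas; measurable)+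
    show ?thesis unfolding e_def[abs_def] expansion_error_def by measurable
  qed
  have R_meas: "R n \<in> borel_measurable (iid_seq M)" if n: "1 \<le> n" for n
  proof -
    note [measurable] = e_meas[OF n] mx_meas[of n] comp
    have [measurable]: "(\<lambda>z. avg n z G) \<in> borel_measurable (iid_seq M)"
      by (intro avg_meas) measurable
    have [measurable]: "crude n \<in> borel_measurable (iid_seq M)"
      unfolding crude_def[abs_def] by measurable
    show ?thesis unfolding R_def[abs_def] est_def by measurable
  qed
  have mx_ge: "G (z i) \<le> mx n z" if "i < n" for n z i
    unfolding mx_def using that by (intro Max_ge) auto
  have G0: "0 \<le> G (z i)" if "z \<in> space (iid_seq M)" for z i
    using that by (intro envelope_nonneg) (simp add: space_iid_seq)
  have avg0: "0 \<le> avg n z G" "0 \<le> avg n z (\<lambda>x. (G x)\<^sup>2)" "1 \<le> n \<Longrightarrow> 0 \<le> mx n z" if z: "z \<in> space (iid_seq M)" for n z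
  proof -
    show "0 \<le> avg n z G" "0 \<le> avg n z (\<lambda>x. (G x)\<^sup>2)"
      unfolding avg_def using G0[OF z] by (auto intro!: divide_nonneg_nonneg sum_nonneg)
    show "0 \<le> mx n z" if "1 \<le> n"
      using mx_ge[of 0 n z] G0[OF z, of 0] that by linarith
  qed
  have e0: "0 \<le> e n z" if "1 \<le> n" "z \<in> space (iid_seq M)" for n z
    unfolding e_def using avg0[OF that(2)] that \<Delta>0[OF that] \<Theta>bd by (intro expansion_error_nonneg) auto
  have est0: "0 \<le> est y r" if "0 \<le> y" "0 \<le> r" for y r
    unfolding est_def using that C_pos by (intro add_nonneg_nonneg mult_nonneg_nonneg) auto
  have crude0: "0 \<le> crude n z" for n z
    unfolding crude_def using nu_mass_nonneg
    by (intro add_nonneg_nonneg mult_nonneg_nonneg divide_nonneg_nonneg sum_nonneg) auto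
  have R0: "0 \<le> R n z" if "1 \<le> n" "z \<in> space (iid_seq M)" for n z
    unfolding R_def using est0[OF e0[OF that], of "1 / sqrt n"] crude0 by auto
  have maj: "\<bar>(\<integral>P. exp (t * sqrt n * ((\<integral>x. g x \<partial>P) - (\<integral>x. g x \<partial>empirical_measure M n z))) \<partial>DP n z) - exp (t\<^sup>2 * var g / 2)\<bar> \<le> R n z"
    if n: "1 \<le> n" and z: "z \<in> space (iid_seq M)" and g: "g \<in> \<G>" for n z g
  proof -
    have zs: "z i \<in> space M" for i using z by (simp add: space_iid_seq)
    have emp: "(\<integral>x. g x \<partial>empirical_measure M n z) = avg n z g"
      unfolding avg_def by (rule integral_empirical_measure[OF n zs measurable_class[OF g]])
    show ?thesis
    proof (cases "mx n z \<le> sqrt n")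
      case True
      then show ?thesis
        using posterior_laplace_estimate[OF n z g mx_ge True t \<Delta>[OF n g z] \<Theta>[OF n g z] e_def[symmetric]]
        unfolding emp R_def est_def by simp
    next
      case False
      have "\<bar>t\<bar> \<le> 1" using t by simp
      then show ?thesis
        using posterior_laplace_crude[OF n z g] False unfolding emp R_def crude_def by simp
    qed
  qed
  have lim: "AE z in iid_seq M. (\<lambda>n. R n z) \<longlonglongrightarrow> 0"
    using AE_envelope_asymptotics \<Delta>AE \<Theta>AE AE_space
  proof eventually_elim
    case (elim z)
    \<comment> \<open>the sample means of the envelope replaced by eventual upper bounds\<close>
    define e' where "e' n = expansion_error (1 / sqrt n) (square_mass + 2) (square_mass + 1) (mx n z) (\<Delta> n z) (\<Theta> n z)" for n :: nat
    have r: "(\<lambda>n. 1 / sqrt (real n)) \<longlonglongrightarrow> 0"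
      using tendsto_inverse_0_at_top[OF filterlim_compose[OF sqrt_at_top filterlim_real_sequentially]]
      by (simp add: inverse_eq_divide)
    have mxlim: "(\<lambda>n. 1 / sqrt n * mx n z) \<longlonglongrightarrow> 0" using elim(1) by (simp add: mx_def)
    have e'lim: "e' \<longlonglongrightarrow> 0"
      unfolding e'_def by (rule expansion_error_tendsto_zero[OF r mxlim elim(2,3)])
    have "(\<lambda>n. est (e' n) (1 / sqrt (real n))) \<longlonglongrightarrow> exp (square_mass + 0) * (2 * 0\<^sup>2 + 3 / 2 * 0 + 0) + C / 2 * 0"
      unfolding est_def by (intro tendsto_intros e'lim r)
    then have upper: "(\<lambda>n. est (e' n) (1 / sqrt (real n))) \<longlonglongrightarrow> 0" by simp
    have "\<forall>\<^sub>F n in sequentially. 1 / sqrt n * mx n z < 1"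
      by (rule order_tendstoD(2)[OF mxlim]) simp
    with conjunct1[OF elim(1)] eventually_ge_at_top[of 1]
    have le: "\<forall>\<^sub>F n in sequentially. R n z \<le> est (e' n) (1 / sqrt (real n))"
    proof eventually_elim
      case (elim n)
      have n0: "0 < sqrt n" using elim(2) by simp
      have mxn: "mx n z \<le> sqrt n" using elim(3) n0 by (simp add: pos_divide_less_eq less_imp_le)
      have ee: "e n z \<le> e' n"
        unfolding e_def e'_def using elim(1,2) avg0[OF \<open>z \<in> space (iid_seq M)\<close>] \<Delta>0[OF elim(2) \<open>z \<in> space (iid_seq M)\<close>]
        by (intro expansion_error_mono) auto
      have "est (e n z) (1 / sqrt n) \<le> est (e' n) (1 / sqrt n)"
        unfolding est_def using ee e0[OF elim(2) \<open>z \<in> space (iid_seq M)\<close>] C_pos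
        by (intro add_mono mult_mono) auto
      then show ?case unfolding R_def using mxn by simp
    qed
    show ?case
    proof (rule tendsto_sandwich[OF _ le tendsto_const upper])
      show "\<forall>\<^sub>F n in sequentially. 0 \<le> R n z"
        using eventually_ge_at_top[of 1] by eventually_elim (rule R0[OF _ elim(4)])
    qed
  qed
  show ?thesis
    unfolding as_star_tendsto_zero_def
  proof (intro exI[of _ R] conjI allI impI ballI lim)
    show "R n \<in> borel_measurable (iid_seq M)" if "1 \<le> n" for n
      using that by (rule R_meas)
    show "0 \<le> R n z" if "1 \<le> n" "z \<in> space (iid_seq M)" for n z
      using that by (rule R0)
    show "(SUP g\<in>\<G>. ennreal \<bar>(\<integral>P. exp (t * sqrt n * ((\<integral>x. g x \<partial>P) - (\<integral>x. g x \<partial>empirical_measure M n z))) \<partial>DP n z) - exp (t\<^sup>2 * var g / 2)\<bar>)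
        \<le> ennreal (R n z)" if "1 \<le> n" "z \<in> space (iid_seq M)" for n z
      by (intro SUP_least ennreal_leI maj that)
  qed
qed

end

theorem theorem1:
  fixes P\<^sub>0 \<nu> :: "'a measure"
    and \<G> :: "('a \<Rightarrow> real) set"
    and G :: "'a \<Rightarrow> real"
    and c C \<delta> :: real
    and DP :: "nat \<Rightarrow> (nat \<Rightarrow> 'a) \<Rightarrow> 'a measure measure"
  assumes "prob_space P\<^sub>0"
    and "finite_measure \<nu>" and "sets \<nu> = sets P\<^sub>0"
    and "\<And>n z. n \<ge> 1 \<Longrightarrow> z \<in> space (iid_seq P\<^sub>0) \<Longrightarrow> is_dirichlet_process (dp_base \<nu> n z) (DP n z)"
    and "\<G> \<subseteq> borel_measurable P\<^sub>0"
    and "glivenko_cantelli P\<^sub>0 \<G>"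
    and "G \<in> borel_measurable P\<^sub>0" and "envelope P\<^sub>0 \<G> G"
    and "c > 0" and "C > 0"
    and "\<And>t. t > 0 \<Longrightarrow> (\<integral>\<^sup>+x. ennreal (exp (t * G x)) \<partial>\<nu>) \<le> ennreal (C * exp (c * t\<^sup>2))"
    and "\<delta> > 0" and "(\<integral>\<^sup>+x. ennreal (G x powr (2 + \<delta>)) \<partial>P\<^sub>0) < \<infinity>"
  shows "\<exists>U. open U \<and> (0::real) \<in> U \<and> (\<forall>t\<in>U.
    as_star_tendsto_zero (iid_seq P\<^sub>0)
      (\<lambda>n z. SUP g\<in>\<G>. ennreal
        \<bar>(\<integral>P. exp (t * sqrt (real n) * ((\<integral>x. g x \<partial>P) - (\<integral>x. g x \<partial>empirical_measure P\<^sub>0 n z))) \<partial>DP n z)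
         - exp (t\<^sup>2 * (\<integral>x. (g x - (\<integral>y. g y \<partial>P\<^sub>0))\<^sup>2 \<partial>P\<^sub>0) / 2)\<bar>))"
proof (cases "\<G> = {}")
  case True
  show ?thesis
  proof (intro exI[of _ UNIV] conjI ballI)
    show "as_star_tendsto_zero (iid_seq P\<^sub>0)
      (\<lambda>n z. SUP g\<in>\<G>. ennreal
        \<bar>(\<integral>P. exp (t * sqrt (real n) * ((\<integral>x. g x \<partial>P) - (\<integral>x. g x \<partial>empirical_measure P\<^sub>0 n z))) \<partial>DP n z)
         - exp (t\<^sup>2 * (\<integral>x. (g x - (\<integral>y. g y \<partial>P\<^sub>0))\<^sup>2 \<partial>P\<^sub>0) / 2)\<bar>)" for t
      unfolding as_star_tendsto_zero_def True by (intro exI[of _ "\<lambda>_ _. 0"]) (auto simp: bot_ennreal)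
  qed auto
next
  case False
  then obtain g0 where g0: "g0 \<in> \<G>" by blast
  interpret prob_space P\<^sub>0 by fact
  have env: "\<bar>g x\<bar> \<le> G x" if "g \<in> \<G>" "x \<in> space P\<^sub>0" for g x
    using assms(8) that by (auto simp: envelope_def)
  have G0: "0 \<le> G x" if "x \<in> space P\<^sub>0" for x
    using env[OF g0 that] by linarith
  have Gm[measurable]: "G \<in> borel_measurable P\<^sub>0" by fact
  have Gp: "integrable P\<^sub>0 (\<lambda>x. G x powr (2 + \<delta>))"
    using assms(13) by (intro integrableI_nonneg) auto
  have sq: "integrable P\<^sub>0 (\<lambda>x. (G x)\<^sup>2)"
  proof (rule Bochner_Integration.integrable_bound[OF Bochner_Integration.integrable_add[OF integrable_const[of 1] Gp]])
    \<comment> \<open>\<open>G\<^sup>2\<close> is at most \<open>1\<close> where \<open>G < 1\<close>, and at most \<open>G powr (2 + \<delta>)\<close> elsewhere\<close>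
    show "AE x in P\<^sub>0. norm ((G x)\<^sup>2) \<le> norm (1 + G x powr (2 + \<delta>))"
    proof (rule AE_I2)
      fix x assume x: "x \<in> space P\<^sub>0"
      have "(G x)\<^sup>2 \<le> 1 + G x powr (2 + \<delta>)"
      proof (cases "1 \<le> G x")
        case True
        then have "(G x)\<^sup>2 = G x powr 2" by (simp add: powr_numeral)
        also have "\<dots> \<le> G x powr (2 + \<delta>)" using True \<open>\<delta> > 0\<close> by (intro powr_mono) auto
        finally show ?thesis by simp
      next
        case False
        then have "(G x)\<^sup>2 \<le> 1" using G0[OF x] by (simp add: power_le_one)
        then show ?thesis by (simp add: add_increasing2)
      qed
      then show "norm ((G x)\<^sup>2) \<le> norm (1 + G x powr (2 + \<delta>))" by simp
    qed
  qed measurable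
  interpret posterior_setting P\<^sub>0 \<G> G \<nu> DP c C
  proof (intro posterior_setting.intro envelope_class.intro envelope_class_axioms.intro posterior_setting_axioms.intro)
    show "g \<in> borel_measurable P\<^sub>0" if "g \<in> \<G>" for g using assms(5) that by blast
  qed (fact assms env G0 Gm sq)+
  \<comment> \<open>the bound \<open>1 / 32\<close> keeps the Laplace transforms within the range of the expansions, \<open>1 / (8 * c)\<close> controls
    the part of \<open>\<nu>\<close> beyond the truncation\<close>
  define t0 where "t0 = min (1 / 32) (1 / (8 * c))"
  have t0: "0 < t0" using \<open>c > 0\<close> by (simp add: t0_def)
  show ?thesis
  proof (intro exI[of _ "ball 0 t0"] conjI ballI)
    fix t :: real assume "t \<in> ball 0 t0"
    then have "\<bar>t\<bar> < t0" by simp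
    then have "\<bar>t\<bar> \<le> 1 / 32" "\<bar>t\<bar> * (8 * c) \<le> 1"
      using \<open>c > 0\<close> by (auto simp: t0_def field_simps)
    from posterior_laplace_as_star[OF assms(6) this]
    show "as_star_tendsto_zero (iid_seq P\<^sub>0)
      (\<lambda>n z. SUP g\<in>\<G>. ennreal
        \<bar>(\<integral>P. exp (t * sqrt (real n) * ((\<integral>x. g x \<partial>P) - (\<integral>x. g x \<partial>empirical_measure P\<^sub>0 n z))) \<partial>DP n z)
         - exp (t\<^sup>2 * (\<integral>x. (g x - (\<integral>y. g y \<partial>P\<^sub>0))\<^sup>2 \<partial>P\<^sub>0) / 2)\<bar>)"
      unfolding var_def .
  qed (use t0 in auto)
qed

end
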